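(* Let $N\geq 2$ and put $M(x)=\left(1-\tanh^{2}\left(\frac{\rho(x)}{2}\right)\right)^{N}$. There exists a universal constant $K>0$ such that for all $u\in W^{1,2}(\mathbb{H}^{N})$ with $\int_{\mathbb{H}^{N}}\rho^{2}(x)|u|^{2}dV_{\mathbb{H}}<\infty$, $$\begin{aligned}\delta_{1,\mathbb{H}}(u)&\geq K\inf_{c\in\mathbb{R},\,\lambda>0}\int_{\mathbb{H}^{N}}\left|u-ce^{-\frac{\rho^{2}(x)}{2\lambda^{2}}}\right|^{2}\left(1-\tanh^{2}\left(\frac{\rho(x)}{2}\right)\right)^{N}dV_{\mathbb{H}}\\&\geq K\inf_{c\in\mathbb{R},\,\lambda>0}\left\|u-ce^{-\frac{\rho^{2}(x)}{2\lambda^{2}}}\right\|_{L^{2}(\mathbb{H}^{N},M)}^{2}\\&\geq K\,d_{1}^{2}(u,E,M).\end{aligned}$$ Consequently, $$\delta_{2,\mathbb{H}}(u)\geq K\left(\int_{\mathbb{H}^{N}}\left[N+(N-1)\frac{\rho(x)\cosh\rho(x)-\sinh\rho(x)}{\sinh\rho(x)}\right]|u|^{2}dV_{\mathbb{H}}\right)d_{1}^{2}(u,E,M)+K^{2}d_{1}^{4}(u,E,M).$$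
   Context: $\mathbb{H}^{N}$ is the hyperbolic space in the Poincaré ball model: the Euclidean unit ball with Riemannian metric $\left(\frac{2}{1-|x|^{2}}\right)^{2}dx^{2}$, volume element $dV_{\mathbb{H}}=\left(\frac{2}{1-|x|^{2}}\right)^{N}dx$, Riemannian gradient $\nabla_{\mathbb{H}}=\left(\frac{1-|x|^{2}}{2}\right)^{2}\nabla$; $|\nabla_{\mathbb H}u|$ is the Riemannian norm. $\rho(x)=\log\frac{1+|x|}{1-|x|}$ is the hyperbolic distance from $x$ to $0$. Functions are real-valued. "Universal" means independent of $u$ (the dimension $N$ is fixed). $E=\{ce^{-\alpha\rho^{2}(x)}:c\in\mathbb{R},\alpha>0\}$; $\|f\|^2_{L^2(\mathbb{H}^N,M)}=\int_{\mathbb{H}^N}|f|^2M\,dV_{\mathbb{H}}$; $$d_{1}(u,E,M)=\inf\left\{\left(\int_{\mathbb{H}^{N}}|u-ce^{-\alpha\rho^{2}(x)}|^{2}M\,dV_{\mathbb{H}}\right)^{1/2}:c\in\mathbb{R},\alpha>0\right\}.$$ The Heisenberg deficits are $$\delta_{1,\mathbb{H}}(u)=\left(\int_{\mathbb{H}^{N}}|\nabla_{\mathbb{H}}u|^{2}dV_{\mathbb{H}}\right)^{1/2}\left(\int_{\mathbb{H}^{N}}\rho^{2}|u|^{2}dV_{\mathbb{H}}\right)^{1/2}-\frac12\int_{\mathbb{H}^{N}}\left(N+(N-1)\frac{\rho\cosh\rho-\sinh\rho}{\sinh\rho}\right)|u|^{2}dV_{\mathbb{H}},$$ $$\delta_{2,\mathbb{H}}(u)=\left(\int_{\mathbb{H}^{N}}|\nabla_{\mathbb{H}}u|^{2}dV_{\mathbb{H}}\right)\left(\int_{\mathbb{H}^{N}}\rho^{2}|u|^{2}dV_{\mathbb{H}}\right)-\frac14\left(\int_{\mathbb{H}^{N}}\left[N+(N-1)\frac{\rho\cosh\rho-\sinh\rho}{\sinh\rho}\right]|u|^{2}dV_{\mathbb{H}}\right)^{2}.$$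 *)

theory Defs
  imports "HOL-Analysis.Analysis"
begin

text \<open>
  Hyperbolic space is the Poincare ball \<^term>\<open>ball 0 1\<close> of a Euclidean space of
  dimension N = \<^term>\<open>DIM('a::euclidean_space)\<close>. Functions on it are total functions on
  \<^typ>\<open>'a\<close> whose values outside the ball play no role.
\<close>

definition hvol :: "'a::euclidean_space measure" where
  "hvol = density (lebesgue_on (ball 0 1))
            (\<lambda>x. ennreal ((2 / (1 - (norm x)\<^sup>2)) ^ DIM('a)))"

definition rho :: "'a::euclidean_space \<Rightarrow> real" where
  "rho x = ln ((1 + norm x) / (1 - norm x))"

definition riem_norm :: "'a::euclidean_space \<Rightarrow> 'a \<Rightarrow> real" where
  "riem_norm x v = 2 / (1 - (norm x)\<^sup>2) * norm v"

fun Ck :: "nat \<Rightarrow> ('a::euclidean_space \<Rightarrow> real) \<Rightarrow> bool" where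
  "Ck 0 f \<longleftrightarrow> continuous_on UNIV f"
| "Ck (Suc k) f \<longleftrightarrow>
     (\<forall>x. f differentiable (at x)) \<and> (\<forall>v. Ck k (\<lambda>x. frechet_derivative f (at x) v))"

text \<open>
  Smooth functions with compact support in the ball, extended by zero. The closed support is
  bounded, so its compactness is automatic.
\<close>
definition test_functions :: "('a::euclidean_space \<Rightarrow> real) set" where
  "test_functions = {\<phi>. (\<forall>k. Ck k \<phi>) \<and> closure {x. \<phi> x \<noteq> 0} \<subseteq> ball 0 1}"

text \<open>The Euclidean distributional gradient in the open unit ball.\<close>
definition has_weak_gradient ::
    "('a::euclidean_space \<Rightarrow> real) \<Rightarrow> ('a \<Rightarrow> 'a) \<Rightarrow> bool" where
  "has_weak_gradient u g \<longleftrightarrow>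
     (\<forall>S. compact S \<and> S \<subseteq> ball 0 1 \<longrightarrow>
        u absolutely_integrable_on S \<and> g absolutely_integrable_on S) \<and>
     (\<forall>\<phi>\<in>test_functions. \<forall>b\<in>Basis.
        (\<integral>x. u x * frechet_derivative \<phi> (at x) b \<partial>lebesgue_on (ball 0 1)) =
        - (\<integral>x. (g x \<bullet> b) * \<phi> x \<partial>lebesgue_on (ball 0 1)))"

text \<open>
  A weak gradient is unique up to a null set of the ball, so no integral below depends on the
  representative chosen here.
\<close>
definition weak_gradient :: "('a::euclidean_space \<Rightarrow> real) \<Rightarrow> 'a \<Rightarrow> 'a" where
  "weak_gradient u = (SOME g. has_weak_gradient u g)"

definition hyp_gradient :: "('a::euclidean_space \<Rightarrow> real) \<Rightarrow> 'a \<Rightarrow> 'a" where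
  "hyp_gradient u x = ((1 - (norm x)\<^sup>2) / 2)\<^sup>2 *\<^sub>R weak_gradient u x"

definition W12 :: "('a::euclidean_space \<Rightarrow> real) set" where
  "W12 = {u. u \<in> borel_measurable hvol \<and> integrable hvol (\<lambda>x. \<bar>u x\<bar>\<^sup>2) \<and>
             (\<exists>g. has_weak_gradient u g) \<and>
             integrable hvol (\<lambda>x. (riem_norm x (hyp_gradient u x))\<^sup>2)}"

definition grad_energy :: "('a::euclidean_space \<Rightarrow> real) \<Rightarrow> real" where
  "grad_energy u = (\<integral>x. (riem_norm x (hyp_gradient u x))\<^sup>2 \<partial>hvol)"

definition second_moment :: "('a::euclidean_space \<Rightarrow> real) \<Rightarrow> real" where
  "second_moment u = (\<integral>x. (rho x)\<^sup>2 * \<bar>u x\<bar>\<^sup>2 \<partial>hvol)"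

text \<open>At the origin, a null set, division by zero gives the fraction its limit value 0.\<close>
definition heis_term :: "('a::euclidean_space \<Rightarrow> real) \<Rightarrow> real" where
  "heis_term u =
     (\<integral>x. (real DIM('a) + (real DIM('a) - 1) *
             ((rho x * cosh (rho x) - sinh (rho x)) / sinh (rho x))) * \<bar>u x\<bar>\<^sup>2 \<partial>hvol)"

definition delta1 :: "('a::euclidean_space \<Rightarrow> real) \<Rightarrow> real" where
  "delta1 u = sqrt (grad_energy u) * sqrt (second_moment u) - 1 / 2 * heis_term u"

definition delta2 :: "('a::euclidean_space \<Rightarrow> real) \<Rightarrow> real" where
  "delta2 u = grad_energy u * second_moment u - 1 / 4 * (heis_term u)\<^sup>2"

definition L2norm ::
    "('a::euclidean_space \<Rightarrow> real) \<Rightarrow> ('a \<Rightarrow> real) \<Rightarrow> real" where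
  "L2norm M f = sqrt (\<integral>x. \<bar>f x\<bar>\<^sup>2 * M x \<partial>hvol)"

definition Gaussians :: "('a::euclidean_space \<Rightarrow> real) set" where
  "Gaussians = {\<lambda>x. c * exp (- \<alpha> * (rho x)\<^sup>2) | c \<alpha>. \<alpha> > 0}"

definition dist1 ::
    "('a::euclidean_space \<Rightarrow> real) \<Rightarrow> ('a \<Rightarrow> real) set \<Rightarrow> ('a \<Rightarrow> real) \<Rightarrow> real" where
  "dist1 u F M = (INF f\<in>F. L2norm M (\<lambda>x. u x - f x))"

definition tanh_weight :: "'a::euclidean_space \<Rightarrow> real" where
  "tanh_weight x = (1 - (tanh (rho x / 2))\<^sup>2) ^ DIM('a)"

end

theory Submission
  imports Defs
begin

text \<open>
  Let \<open>h = exp (- \<rho>\<^sup>2 / (2 l\<^sup>2))\<close>. For \<open>l\<^sup>2 = \<parallel>\<rho> u\<parallel> / \<parallel>\<nabla>u\<parallel>\<close>, expanding the square and integrating by parts gives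
  \<open>2 \<delta>\<^sub>1 (u) = l\<^sup>2 \<integral> |\<nabla>u + u \<rho> \<nabla>\<rho> / l\<^sup>2|\<^sup>2 dV = l\<^sup>2 \<integral> |\<nabla>(u/h)|\<^sup>2 h\<^sup>2 dV\<close>. Since \<open>tanh (\<rho> / 2) = |x|\<close>, the measure \<open>M dV\<close> is
  \<open>2\<^sup>N\<close> times Lebesgue measure, and because \<open>N \<ge> 2\<close> the energy dominates its Euclidean counterpart. What remains is a
  Poincare inequality \<open>\<integral> |v - c|\<^sup>2 h\<^sup>2 dx \<le> K l\<^sup>2 \<integral> |\<nabla>v|\<^sup>2 h\<^sup>2 dx\<close> on the unit ball with \<open>K\<close> independent of \<open>l\<close>.
  As \<open>\<rho> \<nabla>\<rho> \<cdot> x \<ge> 4 |x|\<^sup>2\<close>, testing with the field \<open>x h\<^sup>2\<close> controls \<open>v - c\<close> outside the ball of radius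
  \<open>R = min (l sqrt (N / 2)) 1\<close>; inside it, \<open>h\<^sup>2\<close> is radially decreasing and averaging along segments suffices.
  The second deficit is \<open>\<delta>\<^sub>2 = \<delta>\<^sub>1 (\<delta>\<^sub>1 + H)\<close>, where \<open>H\<close> is the Heisenberg term.
\<close>

section \<open>Smooth bump functions\<close>

text \<open>The gradient is a distribution on the open ball, and only weighted integrals control it
  near the sphere. Each differential identity is therefore proved for C1 functions, carried over by
  mollification on balls of radius s < 1, and extended to the whole ball by cutoffs in \<rho> / k.
  All fields involved are radial, so the divergence theorem reduces to a statement about dilations.
  The delicate point is uniformity in l. For small l the weight lives on scale l and the constant
  has to shrink like \<open>l\<^sup>2\<close>; for large l the ball itself is the relevant scale.
  The drift handles the region where the weight is steep, and the cap 1 in R merges the two regimes.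
  On the ball of radius R / 2 the weight is at least exp (- 9 N / 8), whatever l is. The resulting K
  is 1 / C with C = 2 * 2^N * (2 N 4^N exp (9 N / 8) + 1): 2^N is the density of M dV, the leading 2
  comes from \<open>2 \<delta>\<^sub>1\<close>, and 4^N is a Jacobian bound times the volume ratio
  of a ball to its half. If the energy or the second moment vanishes, no optimal scale exists; then
  u = 0 almost everywhere.\<close>

definition flat :: "nat \<Rightarrow> real \<Rightarrow> real" where
  "flat k t = (if t \<le> 0 then 0 else inverse t ^ k * exp (- inverse t))"

lemma flat_tendsto_0: "(flat k \<longlongrightarrow> 0) (at 0)"
proof (rule filterlim_split_at)
  have "((\<lambda>t::real. inverse t ^ k / exp (inverse t)) \<longlongrightarrow> 0) (at_right 0)"
    by (rule filterlim_compose[OF tendsto_power_div_exp_0 filterlim_inverse_at_top_right])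
  moreover have "\<forall>\<^sub>F t in at_right (0::real). inverse t ^ k / exp (inverse t) = flat k t"
    by (auto simp: eventually_at_right_less flat_def exp_minus field_simps
        intro!: eventually_mono[OF eventually_at_right_less])
  ultimately show "(flat k \<longlongrightarrow> 0) (at_right 0)"
    by (rule Lim_transform_eventually)
  show "(flat k \<longlongrightarrow> 0) (at_left 0)"
    by (rule tendsto_eventually) (auto simp: flat_def eventually_at_filter)
qed

text \<open>Differentiating \<open>inverse t ^ k * exp (- inverse t)\<close> yields members of index
  k + 2 and k + 1 only. This closure is why the powers of \<open>inverse t\<close> are built into
  \<open>flat\<close>.\<close>

lemma flat_has_real_derivative:
  "(flat k has_real_derivative flat (k + 2) t - real k * flat (k + 1) t) (at t)"
proof (cases t "0::real" rule: linorder_cases)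
  case less
  have "((\<lambda>_. 0) has_real_derivative 0) (at t)" by simp
  then have "(flat k has_real_derivative 0) (at t)"
    by (rule has_field_derivative_transform_within_open[where S = "{..<0}"])
       (use less in \<open>auto simp: flat_def\<close>)
  then show ?thesis using less by (simp add: flat_def)
next
  case equal
  \<comment> \<open>At the origin the difference quotient of \<open>flat k\<close> is
    \<open>flat (Suc k)\<close>, whose limit 0 is already known.\<close>
  have "((\<lambda>h. (flat k (0 + h) - flat k 0) / h) \<longlongrightarrow> 0) (at 0)"
    by (rule Lim_transform_eventually[OF flat_tendsto_0[of "Suc k"]])
       (auto simp: flat_def eventually_at_filter field_simps)
  then show ?thesis using equal by (simp add: flat_def DERIV_def)
next
  case greater
  have "((\<lambda>t. inverse t ^ k * exp (- inverse t)) has_real_derivative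
      flat (k + 2) t - real k * flat (k + 1) t) (at t)"
  proof (rule DERIV_cong[OF DERIV_mult[OF DERIV_power[OF DERIV_inverse]
        DERIV_chain2[OF DERIV_exp DERIV_minus[OF DERIV_inverse]]]])
    show "of_nat k * (- (inverse t ^ Suc (Suc 0)) * inverse t ^ (k - Suc 0)) * exp (- inverse t)
        + exp (- inverse t) * - (- (inverse t ^ Suc (Suc 0))) * inverse t ^ k
      = flat (k + 2) t - real k * flat (k + 1) t"
      by (cases k) (use greater in \<open>simp_all add: flat_def algebra_simps\<close>)
  qed (use greater in auto)
  then show ?thesis
    by (rule has_field_derivative_transform_within_open[where S = "{0<..}"])
       (use greater in \<open>auto simp: flat_def\<close>)
qed

lemma flat_nonneg: "0 \<le> flat k t"
  by (simp add: flat_def)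

lemma continuous_flat: "continuous_on S (flat k)"
  using flat_has_real_derivative by (meson DERIV_isCont continuous_at_imp_continuous_on)

lemma borel_flat [measurable]: "flat k \<in> borel_measurable borel"
  by (rule borel_measurable_continuous_onI) (rule continuous_flat)

lemma flat_le: "flat 0 t \<le> 1"
  by (auto simp: flat_def)

text \<open>Closed under directional derivatives, so that all members are smooth.\<close>
inductive bump_algebra :: "real \<Rightarrow> 'a::euclidean_space \<Rightarrow> ('a \<Rightarrow> real) \<Rightarrow> bool" for e a where
  const: "bump_algebra e a (\<lambda>x. c)"
| inner: "bump_algebra e a (\<lambda>x. x \<bullet> v)"
| bump: "bump_algebra e a (\<lambda>x. flat k (e - (x - a) \<bullet> (x - a)))"
| add: "bump_algebra e a f \<Longrightarrow> bump_algebra e a g \<Longrightarrow> bump_algebra e a (\<lambda>x. f x + g x)"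
| mult: "bump_algebra e a f \<Longrightarrow> bump_algebra e a g \<Longrightarrow> bump_algebra e a (\<lambda>x. f x * g x)"

lemma flat_bump_has_derivative:
  "((\<lambda>x. flat k (e - (x - a) \<bullet> (x - a))) has_derivative
     (\<lambda>v. (flat (k + 2) (e - (x - a) \<bullet> (x - a)) - real k * flat (k + 1) (e - (x - a) \<bullet> (x - a)))
           * (- 2 * ((x - a) \<bullet> v)))) (at x)"
proof -
  have "((\<lambda>x. e - (x - a) \<bullet> (x - a)) has_derivative (\<lambda>v. - 2 * ((x - a) \<bullet> v))) (at x)"
    by (auto intro!: derivative_eq_intros simp: inner_commute)
  from has_derivative_compose[OF this flat_has_real_derivative[unfolded has_field_derivative_def]]
  show ?thesis by (simp add: mult.commute)
qed

text \<open>Structural induction. The quadratic argument of a bump contributes a factor that is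
  affine in x, which is why coordinates and constants are among the generators. The derivative is
  one function \<open>f'\<close> of point and direction, so that it serves all directions at
  once.\<close>

lemma bump_algebra_derivative:
  assumes "bump_algebra e a f"
  shows "\<exists>f'. (\<forall>x. (f has_derivative f' x) (at x)) \<and> (\<forall>v. bump_algebra e a (\<lambda>x. f' x v))"
  using assms
proof induction
  case (const c)
  show ?case by (rule exI[of _ "\<lambda>x v. 0"]) (auto intro: bump_algebra.intros)
next
  case (inner v)
  show ?case
    by (rule exI[of _ "\<lambda>x u. u \<bullet> v"]) (auto intro!: bump_algebra.intros derivative_eq_intros)
next
  case (bump k)
  \<comment> \<open>The chain rule is spelled with sums and products, since subtraction is not an
    introduction rule.\<close>
  have "bump_algebra e a (\<lambda>x. (flat (k + 2) (e - (x - a) \<bullet> (x - a))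
      + (- real k) * flat (k + 1) (e - (x - a) \<bullet> (x - a))) * (- 2 * (x \<bullet> v + - (a \<bullet> v))))" for v
    by (intro bump_algebra.intros)
  then have "bump_algebra e a (\<lambda>x. (flat (k + 2) (e - (x - a) \<bullet> (x - a))
      - real k * flat (k + 1) (e - (x - a) \<bullet> (x - a))) * (- 2 * ((x - a) \<bullet> v)))" for v
    by (simp add: inner_diff_left)
  then show ?case
    by (intro exI[of _ "\<lambda>x v. (flat (k + 2) (e - (x - a) \<bullet> (x - a))
      - real k * flat (k + 1) (e - (x - a) \<bullet> (x - a))) * (- 2 * ((x - a) \<bullet> v))"])
      (use flat_bump_has_derivative in blast)
next
  case (add f g)
  then obtain f' g' where "\<forall>x. (f has_derivative f' x) (at x)" "\<forall>v. bump_algebra e a (\<lambda>x. f' x v)"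
    "\<forall>x. (g has_derivative g' x) (at x)" "\<forall>v. bump_algebra e a (\<lambda>x. g' x v)" by blast
  then show ?case
    by (intro exI[of _ "\<lambda>x v. f' x v + g' x v"]) (auto intro: bump_algebra.intros derivative_intros)
next
  case (mult f g)
  then obtain f' g' where "\<forall>x. (f has_derivative f' x) (at x)" "\<forall>v. bump_algebra e a (\<lambda>x. f' x v)"
    "\<forall>x. (g has_derivative g' x) (at x)" "\<forall>v. bump_algebra e a (\<lambda>x. g' x v)" by blast
  with mult.hyps show ?case
    by (intro exI[of _ "\<lambda>x v. f x * g' x v + f' x v * g x"])
       (auto intro!: bump_algebra.add bump_algebra.mult has_derivative_mult)
qed

text \<open>\<open>Ck (Suc k)\<close> asks for \<open>Ck k\<close> of every directional derivative,
  which is another member of the algebra; hence the induction on k leaves f arbitrary.\<close>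

lemma bump_algebra_Ck: "bump_algebra e a f \<Longrightarrow> Ck k f"
proof (induction k arbitrary: f)
  case 0
  then obtain f' where "\<forall>x. (f has_derivative f' x) (at x)" using bump_algebra_derivative by blast
  then show ?case by (auto intro!: continuous_at_imp_continuous_on dest: has_derivative_continuous)
next
  case (Suc k)
  obtain f' where f': "\<forall>x. (f has_derivative f' x) (at x)" "\<forall>v. bump_algebra e a (\<lambda>x. f' x v)"
    using bump_algebra_derivative[OF Suc.prems] by blast
  then have "frechet_derivative f (at x) = f' x" for x
    by (metis frechet_derivative_at)
  with f' Suc.IH show ?case by (auto simp: differentiable_def)
qed

text \<open>The mollifying kernel is \<open>bump e\<close> divided by its integral; its support has radius \<open>sqrt e\<close>.\<close>
definition bump :: "real \<Rightarrow> 'a::euclidean_space \<Rightarrow> real" where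
  "bump e z = flat 0 (e - z \<bullet> z)"

text \<open>Only index 2 occurs because the other term in the derivative of \<open>flat 0\<close>
  carries the coefficient 0.\<close>

definition bump_grad :: "real \<Rightarrow> 'a::euclidean_space \<Rightarrow> 'a" where
  "bump_grad e z = (- 2 * flat 2 (e - z \<bullet> z)) *\<^sub>R z"

lemma bump_nonneg: "0 \<le> bump e z" and bump_le: "bump e z \<le> 1"
  by (simp_all add: bump_def flat_nonneg flat_le)

lemma bump_eq_0: "sqrt e \<le> norm z \<Longrightarrow> bump e z = 0"
  using sqrt_le_D[of e "norm z"] by (simp add: bump_def flat_def power2_norm_eq_inner)

lemma bump_pos: "norm z < sqrt e \<Longrightarrow> 0 < bump e z"
  using real_sqrt_le_iff[of e "(norm z)\<^sup>2"]
  by (auto simp: bump_def flat_def power2_norm_eq_inner[symmetric] not_le[symmetric])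

lemma bump_minus: "bump e (x - y) = bump e (y - x)"
  by (simp add: bump_def inner_diff_left inner_diff_right inner_commute algebra_simps)

lemma bump_has_derivative: "(bump e has_derivative (\<lambda>v. bump_grad e z \<bullet> v)) (at z)"
  using flat_bump_has_derivative[of 0 e 0 z] by (simp add: bump_def[abs_def] bump_grad_def numeral_2_eq_2 mult.left_commute mult.assoc)

lemma continuous_bump: "continuous_on S (bump e)"
  using bump_has_derivative by (meson continuous_at_imp_continuous_on has_derivative_continuous)

lemma continuous_bump_grad: "continuous_on S (bump_grad e)"
  unfolding bump_grad_def
  by (intro continuous_intros continuous_on_compose2[OF continuous_flat[of UNIV]]) auto

lemma borel_bump [measurable]: "bump e \<in> borel_measurable borel"
  by (rule borel_measurable_continuous_onI) (rule continuous_bump)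

lemma borel_bump_grad [measurable]: "bump_grad e \<in> borel_measurable borel"
  by (rule borel_measurable_continuous_onI) (rule continuous_bump_grad)

lemma bump_grad_eq_0: "sqrt e \<le> norm z \<Longrightarrow> bump_grad e z = 0"
  using sqrt_le_D[of e "norm z"] by (simp add: bump_grad_def flat_def power2_norm_eq_inner)

text \<open>The hypothesis puts the closed ball of radius sqrt e about x inside the unit ball. Here
  x is a parameter: these translated kernels are the test functions with which a weak gradient is
  probed.\<close>

lemma bump_test_function:
  assumes "0 < e" "norm x + sqrt e < 1"
  shows "(\<lambda>y. bump e (x - y)) \<in> test_functions"
proof -
  have *: "bump_algebra e x (\<lambda>y. flat 0 (e - (y - x) \<bullet> (y - x)))" by (rule bump_algebra.bump)
  have "\<forall>k. Ck k (\<lambda>y. bump e (x - y))"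
  proof -
    have "(\<lambda>y. bump e (x - y)) = (\<lambda>y. flat 0 (e - (y - x) \<bullet> (y - x)))"
      by (rule ext, subst bump_minus) (simp add: bump_def)
    then show ?thesis using bump_algebra_Ck[OF *] by simp
  qed
  moreover have "closure {y. bump e (x - y) \<noteq> 0} \<subseteq> cball x (sqrt e)"
  proof (rule closure_minimal)
    show "{y. bump e (x - y) \<noteq> 0} \<subseteq> cball x (sqrt e)"
      using bump_eq_0[of e] by (force simp: dist_norm)
  qed auto
  moreover have "cball x (sqrt e) \<subseteq> ball 0 1"
    using assms by (auto simp: dist_norm) (smt (verit) norm_minus_commute norm_triangle_sub)
  ultimately show ?thesis unfolding test_functions_def by blast
qed

lemma bump_translate_derivative:
  "frechet_derivative (\<lambda>y. bump e (x - y)) (at y) b = - (bump_grad e (x - y) \<bullet> b)"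
proof -
  have "((\<lambda>y. bump e (x - y)) has_derivative (\<lambda>v. bump_grad e (x - y) \<bullet> (0 - v))) (at y)"
    by (rule has_derivative_compose[OF has_derivative_diff[OF has_derivative_const has_derivative_ident] bump_has_derivative])
  from frechet_derivative_at[OF this, symmetric] show ?thesis by simp
qed

lemma bump_integrable: "integrable lborel (bump e :: 'a::euclidean_space \<Rightarrow> real)"
proof (rule Bochner_Integration.integrable_bound)
  show "integrable lborel (indicator (cball (0::'a) (sqrt e)) :: 'a \<Rightarrow> real)"
    by (intro integrable_real_indicator) (use emeasure_bounded_finite[OF bounded_cball] in auto)
  show "AE x::'a in lborel. norm (bump e x) \<le> norm (indicator (cball 0 (sqrt e)) x :: real)"
  proof (rule AE_I2)
    fix x :: 'a
    show "norm (bump e x) \<le> norm (indicator (cball 0 (sqrt e)) x :: real)"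
      using bump_eq_0[of e x] bump_nonneg[of e x] bump_le[of e x]
      by (cases "norm x \<le> sqrt e") auto
  qed
qed auto

lemma integral_bump_pos: "0 < e \<Longrightarrow> 0 < (\<integral>z. bump e z \<partial>(lborel :: 'a::euclidean_space measure))"
proof -
  assume e: "0 < e"
  have "\<not> (AE z::'a in lborel. bump e z = 0)"
  proof
    assume "AE z::'a in lborel. bump e z = 0"
    then have "AE z::'a in lborel. z \<notin> ball 0 (sqrt e)"
      by eventually_elim (use bump_pos[of _ e] in force)
    then have "emeasure lborel (ball (0::'a) (sqrt e)) = 0"
      by (auto simp: AE_iff_null null_sets_def ball_def)
    then show False using e emeasure_ball[of "sqrt e" "0::'a"] unit_ball_vol_pos[of "real DIM('a)"]
      by (auto simp: zero_less_power)
  qed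
  then have "(\<integral>z. bump e z \<partial>(lborel :: 'a measure)) \<noteq> 0"
    using integral_nonneg_eq_0_iff_AE[OF bump_integrable[of e]] bump_nonneg by blast
  moreover have "0 \<le> (\<integral>z. bump e z \<partial>(lborel :: 'a measure))"
    by (simp add: bump_nonneg)
  ultimately show ?thesis by linarith
qed

section \<open>Mollification\<close>

definition clamp_real :: "real \<Rightarrow> real \<Rightarrow> real" where
  "clamp_real k t = max (- k) (min k t)"

lemma abs_clamp_real: "0 \<le> k \<Longrightarrow> \<bar>clamp_real k t\<bar> \<le> k"
  by (auto simp: clamp_real_def)

lemma clamp_real_eq: "\<bar>t\<bar> \<le> k \<Longrightarrow> clamp_real k t = t"
  by (auto simp: clamp_real_def)

lemma clamp_real_diff_le: "0 \<le> k \<Longrightarrow> \<bar>t - clamp_real k t\<bar> \<le> \<bar>t\<bar>"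
  by (auto simp: clamp_real_def)

lemma continuous_clamp_real: "continuous_on S (clamp_real k)"
  unfolding clamp_real_def by (intro continuous_intros)

lemma borel_clamp_real [measurable]: "clamp_real k \<in> borel_measurable borel"
  by (rule borel_measurable_continuous_onI) (rule continuous_clamp_real)

section \<open>Square-integrable functions and approximation by continuous ones\<close>

lemma square_integrable_add:
  fixes f g :: "'b \<Rightarrow> real"
  assumes [measurable]: "f \<in> borel_measurable M" "g \<in> borel_measurable M"
    and "integrable M (\<lambda>x. (f x)\<^sup>2)" "integrable M (\<lambda>x. (g x)\<^sup>2)"
  shows "integrable M (\<lambda>x. (f x + g x)\<^sup>2)"
proof (rule Bochner_Integration.integrable_bound)
  show "integrable M (\<lambda>x. 2 * (f x)\<^sup>2 + 2 * (g x)\<^sup>2)" using assms by auto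
  have "(f x + g x)\<^sup>2 \<le> 2 * (f x)\<^sup>2 + 2 * (g x)\<^sup>2" for x
    using sum_squares_bound[of "f x" "g x"] by (simp add: power2_sum)
  then show "AE x in M. norm ((f x + g x)\<^sup>2) \<le> norm (2 * (f x)\<^sup>2 + 2 * (g x)\<^sup>2)" by auto
qed auto

lemma square_integrable_diff:
  fixes f g :: "'b \<Rightarrow> real"
  assumes "f \<in> borel_measurable M" "g \<in> borel_measurable M"
    and "integrable M (\<lambda>x. (f x)\<^sup>2)" "integrable M (\<lambda>x. (g x)\<^sup>2)"
  shows "integrable M (\<lambda>x. (f x - g x)\<^sup>2)"
  using square_integrable_add[of f M "\<lambda>x. - g x"] assms by simp

lemma square_integrable_mult:
  fixes f g :: "'b \<Rightarrow> real"
  assumes [measurable]: "f \<in> borel_measurable M" "g \<in> borel_measurable M"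
    and "integrable M (\<lambda>x. (f x)\<^sup>2)" "integrable M (\<lambda>x. (g x)\<^sup>2)"
  shows "integrable M (\<lambda>x. f x * g x)"
proof (rule Bochner_Integration.integrable_bound)
  show "integrable M (\<lambda>x. (f x)\<^sup>2 + (g x)\<^sup>2)" using assms by auto
  have "\<bar>f x * g x\<bar> \<le> (f x)\<^sup>2 + (g x)\<^sup>2" for x
  proof -
    have "0 \<le> \<bar>f x * g x\<bar>" by simp
    moreover have "2 * \<bar>f x * g x\<bar> \<le> (f x)\<^sup>2 + (g x)\<^sup>2"
      using sum_squares_bound[of "\<bar>f x\<bar>" "\<bar>g x\<bar>"] by (simp add: abs_mult)
    ultimately show ?thesis by linarith
  qed
  then show "AE x in M. norm (f x * g x) \<le> norm ((f x)\<^sup>2 + (g x)\<^sup>2)" by auto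
qed auto

lemma emeasure_lborel_finite: "bounded S \<Longrightarrow> emeasure lborel S < top"
  using emeasure_bounded_finite by auto

lemma integrable_bounded_support:
  fixes f :: "'a::euclidean_space \<Rightarrow> real"
  assumes [measurable]: "f \<in> borel_measurable borel" "S \<in> sets borel"
    and "bounded S" "\<And>x. x \<notin> S \<Longrightarrow> f x = 0" "\<And>x. x \<in> S \<Longrightarrow> \<bar>f x\<bar> \<le> C"
  shows "integrable lborel f"
proof (rule Bochner_Integration.integrable_bound)
  show "integrable lborel (\<lambda>x. C * indicator S x)"
    using emeasure_lborel_finite[OF \<open>bounded S\<close>]
    by (intro integrable_mult_right integrable_real_indicator) auto
  show "AE x in lborel. norm (f x) \<le> norm (C * indicator S x)"
  proof (rule AE_I2)
    fix x show "norm (f x) \<le> norm (C * indicator S x)"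
      using assms(4,5)[of x] by (cases "x \<in> S") auto
  qed
qed auto

text \<open>Truncations converge to f in L2 by dominated convergence. A truncated function is an
  almost everywhere limit of continuous functions which, clamped to the same level, converge
  boundedly on the bounded set S. The bound k is part of the conclusion because w is later
  multiplied by an indicator and the product has to be square integrable.\<close>

lemma continuous_dense_L2:
  fixes f :: "'a::euclidean_space \<Rightarrow> real"
  assumes [measurable]: "f \<in> borel_measurable borel" "S \<in> sets borel"
    and f: "integrable lborel (\<lambda>x. (f x)\<^sup>2)" and S: "bounded S" and "0 < \<epsilon>"
  shows "\<exists>w k. continuous_on UNIV w \<and> (\<forall>x. \<bar>w x\<bar> \<le> k) \<and> (LBINT x. indicator S x * (f x - w x)\<^sup>2) < \<epsilon>"
proof -
  have "(\<lambda>k. LBINT x. (f x - clamp_real (real k) (f x))\<^sup>2) \<longlonglongrightarrow> (\<integral>x. 0 \<partial>(lborel :: 'a measure))"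
  proof (rule integral_dominated_convergence[where w = "\<lambda>x. (f x)\<^sup>2"])
    show "AE x in lborel. (\<lambda>k. (f x - clamp_real (real k) (f x))\<^sup>2) \<longlonglongrightarrow> 0"
    proof (rule AE_I2, rule tendsto_eventually)
      fix x
      obtain k0 where "\<bar>f x\<bar> \<le> real k0" using real_arch_simple by blast
      then show "\<forall>\<^sub>F k in sequentially. (f x - clamp_real (real k) (f x))\<^sup>2 = 0"
        by (intro eventually_sequentiallyI[of k0]) (simp add: clamp_real_eq)
    qed
    show "AE x in lborel. norm ((f x - clamp_real (real k) (f x))\<^sup>2) \<le> (f x)\<^sup>2" for k
      using clamp_real_diff_le[of "real k"] by (auto intro!: AE_I2 simp: abs_le_square_iff[symmetric])
  qed (use f in auto)
  \<comment> \<open>\<open>(a + b)\<^sup>2 \<le> 2 a\<^sup>2 + 2 b\<^sup>2\<close> will double both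
    errors, hence the budget \<epsilon> / 4 for each.\<close>
  then have "\<forall>\<^sub>F k in sequentially. (LBINT x. (f x - clamp_real (real k) (f x))\<^sup>2) < \<epsilon> / 4"
    using \<open>0 < \<epsilon>\<close> by (intro order_tendstoD) auto
  then obtain k :: nat where k: "(LBINT x. (f x - clamp_real (real k) (f x))\<^sup>2) < \<epsilon> / 4"
    by (auto simp: eventually_sequentially)
  define F where "F = (\<lambda>x. clamp_real (real k) (f x))"
  have [measurable]: "F \<in> borel_measurable borel" by (simp add: F_def)
  have Fk: "\<bar>F x\<bar> \<le> real k" for x by (simp add: F_def abs_clamp_real)
  \<comment> \<open>\<open>measurable_on\<close> unfolds to pointwise convergence of continuous
    functions off a negligible set; this is the source of continuity.\<close>
  have "F measurable_on UNIV"
    by (rule lebesgue_measurable_imp_measurable_on) (auto intro: measurable_completion)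
  then obtain N g where N: "negligible N" and g: "\<And>n. continuous_on UNIV (g n)"
    "\<And>x. x \<notin> N \<Longrightarrow> (\<lambda>n. g n x) \<longlonglongrightarrow> F x"
    unfolding measurable_on_def by auto
  have [measurable]: "g n \<in> borel_measurable borel" for n
    using g(1) by (rule borel_measurable_continuous_onI)
  have "AE x in lebesgue. x \<notin> N"
    using N by (metis AE_not_in negligible_iff_null_sets)
  then have N': "AE x in lborel. x \<notin> N" by (simp add: AE_completion_iff)
  \<comment> \<open>Clamping at the level of \<open>F\<close> leaves the limit unchanged and
    supplies the dominating function.\<close>
  define w where "w = (\<lambda>n x. clamp_real (real k) (g n x))"
  have [measurable]: "w n \<in> borel_measurable borel" for n by (simp add: w_def)
  have wk: "\<bar>w n x\<bar> \<le> real k" for n x by (simp add: w_def abs_clamp_real)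
  have Fwk: "(F x - w n x)\<^sup>2 \<le> (2 * real k)\<^sup>2" for n x
    using Fk[of x] wk[of n x] by (intro abs_le_square_iff[THEN iffD1]) linarith
  have "(\<lambda>n. LBINT x. indicator S x * (F x - w n x)\<^sup>2) \<longlonglongrightarrow> (\<integral>x. 0 \<partial>(lborel :: 'a measure))"
  proof (rule integral_dominated_convergence[where w = "\<lambda>x. indicator S x * (2 * real k)\<^sup>2"])
    show "AE x in lborel. (\<lambda>n. indicator S x * (F x - w n x)\<^sup>2) \<longlonglongrightarrow> 0"
      using N'
    proof eventually_elim
      fix x assume "x \<notin> N"
      from g(2)[OF this] have *: "(\<lambda>n. w n x) \<longlonglongrightarrow> clamp_real (real k) (F x)"
        unfolding w_def by (rule continuous_on_tendsto_compose[OF continuous_clamp_real[of UNIV]]) auto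
      have "clamp_real (real k) (F x) = F x" using Fk by (rule clamp_real_eq)
      with tendsto_diff[OF tendsto_const *, of "F x"] have "(\<lambda>n. F x - w n x) \<longlonglongrightarrow> 0" by simp
      from tendsto_mult_right_zero[OF tendsto_null_power[OF this, of 2]]
      have "(\<lambda>n. indicator S x * (F x - w n x)\<^sup>2) \<longlonglongrightarrow> 0" by simp
      then show "(\<lambda>n. indicator S x * (F x - w n x)\<^sup>2) \<longlonglongrightarrow> 0" .
    qed
    show "AE x in lborel. norm (indicator S x * (F x - w n x)\<^sup>2) \<le> indicator S x * (2 * real k)\<^sup>2" for n
      using Fwk by (auto intro!: AE_I2 simp: abs_mult mult_left_mono)
    show "integrable lborel (\<lambda>x. indicator S x * (2 * real k)\<^sup>2)"
      by (rule integrable_bounded_support[of _ S]) (use S in auto)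
  qed auto
  then have "\<forall>\<^sub>F n in sequentially. (LBINT x. indicator S x * (F x - w n x)\<^sup>2) < \<epsilon> / 4"
    using \<open>0 < \<epsilon>\<close> by (intro order_tendstoD) auto
  then obtain n where n: "(LBINT x. indicator S x * (F x - w n x)\<^sup>2) < \<epsilon> / 4"
    by (auto simp: eventually_sequentially)
  have i1: "integrable lborel (\<lambda>x. (f x - F x)\<^sup>2)"
  proof (rule Bochner_Integration.integrable_bound[OF f])
    show "AE x in lborel. norm ((f x - F x)\<^sup>2) \<le> norm ((f x)\<^sup>2)"
      using clamp_real_diff_le[of "real k"] by (auto intro!: AE_I2 simp: abs_le_square_iff[symmetric] F_def)
  qed auto
  have i2: "integrable lborel (\<lambda>x. indicator S x * (F x - w n x)\<^sup>2)"
    by (rule integrable_bounded_support[of _ S "(2 * real k)\<^sup>2"]) (use S Fwk in auto)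
  have "(LBINT x. indicator S x * (f x - w n x)\<^sup>2)
      \<le> (LBINT x. 2 * (f x - F x)\<^sup>2 + 2 * (indicator S x * (F x - w n x)\<^sup>2))"
  proof (rule integral_mono_AE')
    have "(f x - w n x)\<^sup>2 \<le> 2 * (f x - F x)\<^sup>2 + 2 * (F x - w n x)\<^sup>2" for x
      using sum_squares_bound[of "f x - F x" "F x - w n x"] power2_sum[of "f x - F x" "F x - w n x"] by simp
    then show "AE x in lborel. indicator S x * (f x - w n x)\<^sup>2
        \<le> 2 * (f x - F x)\<^sup>2 + 2 * (indicator S x * (F x - w n x)\<^sup>2)"
      by (auto intro!: AE_I2 simp: indicator_def)
  qed (use i1 i2 in \<open>auto intro!: AE_I2\<close>)
  also have "\<dots> = 2 * (LBINT x. (f x - F x)\<^sup>2) + 2 * (LBINT x. indicator S x * (F x - w n x)\<^sup>2)"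
    using i1 i2 by simp
  also have "\<dots> < \<epsilon>" using k n by (simp add: F_def)
  finally have "(LBINT x. indicator S x * (f x - w n x)\<^sup>2) < \<epsilon>" .
  moreover have "continuous_on UNIV (w n)"
    unfolding w_def by (rule continuous_on_compose2[OF continuous_clamp_real[of UNIV] g(1)]) auto
  ultimately show ?thesis using wk by blast
qed

section \<open>Convolution with the normalised kernel\<close>

definition conv :: "real \<Rightarrow> ('a::euclidean_space \<Rightarrow> real) \<Rightarrow> 'a \<Rightarrow> real" where
  "conv e f x = (LBINT y. f y * bump e (x - y)) / (LBINT z. bump e (z::'a))"

text \<open>Compactness gives uniform continuity on a bounded set. The ball \<open>K\<close> exceeds
  the support by 1, so if z or z + v leaves it, a shift shorter than 1 keeps both points off the
  support and the difference is 0.\<close>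

lemma bump_grad_uniform:
  assumes "0 < \<eta>"
  shows "\<exists>d>0. \<forall>z v :: 'a::euclidean_space. norm v < d \<longrightarrow> norm (bump_grad e (z + v) - bump_grad e z) < \<eta>"
proof -
  define K where "K = cball (0::'a) (sqrt e + 1)"
  have "uniformly_continuous_on K (bump_grad e)"
    unfolding K_def by (intro compact_uniformly_continuous continuous_bump_grad) auto
  then obtain d where d: "0 < d" "\<And>x y. x \<in> K \<Longrightarrow> y \<in> K \<Longrightarrow> dist y x < d \<Longrightarrow>
      dist (bump_grad e y) (bump_grad e x) < \<eta>"
    using assms unfolding uniformly_continuous_on_def by metis
  have "norm (bump_grad e (z + v) - bump_grad e z) < \<eta>" if v: "norm v < min d 1" for z v :: 'a
  proof (cases "z \<in> K \<and> z + v \<in> K")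
    case True
    then show ?thesis using d(2)[of z "z + v"] v by (simp add: dist_norm)
  next
    case False
    then have "sqrt e \<le> norm z" "sqrt e \<le> norm (z + v)"
      using v norm_triangle_ineq[of z v] norm_triangle_ineq4[of "z + v" v] by (auto simp: K_def)
    then show ?thesis using assms by (simp add: bump_grad_eq_0)
  qed
  then show ?thesis using d(1) by (intro exI[of _ "min d 1"]) auto
qed

lemma bump_grad_bounded: "\<exists>C. \<forall>z::'a::euclidean_space. norm (bump_grad e z) \<le> C"
proof -
  have "bounded (bump_grad e ` cball (0::'a) (sqrt e))"
    by (intro compact_imp_bounded compact_continuous_image continuous_bump_grad) auto
  then obtain C where C: "0 < C" "\<And>z::'a. norm z \<le> sqrt e \<Longrightarrow> norm (bump_grad e z) \<le> C"
    by (auto simp: bounded_pos)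
  then have "norm (bump_grad e z) \<le> C" for z :: 'a
    using bump_grad_eq_0[of e z] by (cases "norm z \<le> sqrt e") auto
  then show ?thesis by blast
qed

lemma conv_integrable:
  fixes f :: "'a::euclidean_space \<Rightarrow> real"
  assumes f: "integrable lborel f"
  shows "integrable lborel (\<lambda>y. f y * bump e (x - y))"
proof (rule Bochner_Integration.integrable_bound[OF f])
  have [measurable]: "f \<in> borel_measurable borel" using f by auto
  show "(\<lambda>y. f y * bump e (x - y)) \<in> borel_measurable lborel" by measurable
  show "AE y in lborel. norm (f y * bump e (x - y)) \<le> norm (f y)"
    by (rule AE_I2) (simp add: abs_mult abs_of_nonneg[OF bump_nonneg] mult_left_le bump_le)
qed

text \<open>Differentiation under the integral: the linearisation error of the kernel is at most
  \<open>norm v * (\<eta> / A)\<close> uniformly in the base point, so integrating it against the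
  absolute value of f costs only a constant. Integrability of f suffices since all smoothness sits
  in the kernel.\<close>

lemma conv_has_derivative:
  fixes f :: "'a::euclidean_space \<Rightarrow> real"
  assumes f: "integrable lborel f"
  shows "(conv e f has_derivative
    (\<lambda>v. (LBINT y. f y * (bump_grad e (x - y) \<bullet> v)) / (LBINT z. bump e (z::'a)))) (at x)"
proof -
  have [measurable]: "f \<in> borel_measurable borel" using f by auto
  obtain C where C: "\<And>z::'a. norm (bump_grad e z) \<le> C" using bump_grad_bounded by blast
  have ig: "integrable lborel (\<lambda>y. f y *\<^sub>R bump_grad e (x - y))"
  proof (rule Bochner_Integration.integrable_bound)
    show "integrable lborel (\<lambda>y. C * f y)" using f by auto
    have "\<bar>f y\<bar> * norm (bump_grad e (x - y)) \<le> \<bar>C * f y\<bar>" for y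
      using mult_left_mono[OF order_trans[OF C[of "x - y"] abs_ge_self], of "\<bar>f y\<bar>"]
      by (simp add: abs_mult mult.commute)
    then show "AE y in lborel. norm (f y *\<^sub>R bump_grad e (x - y)) \<le> norm (C * f y)" by auto
  qed auto
  define L where "L = (LBINT y. f y *\<^sub>R bump_grad e (x - y))"
  have Lv: "integrable lborel (\<lambda>y. f y * (bump_grad e (x - y) \<bullet> v))"
    "(LBINT y. f y * (bump_grad e (x - y) \<bullet> v)) = L \<bullet> v" for v
  proof -
    have "(\<lambda>y. f y * (bump_grad e (x - y) \<bullet> v)) = (\<lambda>y. (f y *\<^sub>R bump_grad e (x - y)) \<bullet> v)" by simp
    then show "integrable lborel (\<lambda>y. f y * (bump_grad e (x - y) \<bullet> v))"
      "(LBINT y. f y * (bump_grad e (x - y) \<bullet> v)) = L \<bullet> v"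
      using integrable_inner_left[of v, OF ig] integral_inner_left[of v, OF ig] unfolding L_def by metis+
  qed
  have "((\<lambda>x. LBINT y. f y * bump e (x - y)) has_derivative (\<lambda>v. L \<bullet> v)) (at x)"
    unfolding has_derivative_at_alt
  proof (intro conjI allI impI)
    show "bounded_linear ((\<bullet>) L)" by (rule bounded_linear_inner_right)
    fix \<eta> :: real assume "0 < \<eta>"
    \<comment> \<open>The summand 1 keeps \<open>A\<close> positive when f vanishes almost
      everywhere.\<close>
    define A where "A = (LBINT y. \<bar>f y\<bar>) + 1"
    have A: "0 < A" unfolding A_def by (intro add_nonneg_pos) auto
    have "0 < \<eta> / A" using A \<open>0 < \<eta>\<close> by simp
    then obtain d where d: "0 < d"
      "\<And>z v::'a. norm v < d \<Longrightarrow> norm (bump_grad e (z + v) - bump_grad e z) < \<eta> / A"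
      using bump_grad_uniform[of "\<eta> / A" e] by blast
    have lin: "\<bar>bump e (z + v) - bump e z - bump_grad e z \<bullet> v\<bar> \<le> norm v * (\<eta> / A)" if "norm v < d" for z v :: 'a
    proof -
      have "norm (bump e (z + v) - bump e z - bump_grad e z \<bullet> ((z + v) - z)) \<le> norm ((z + v) - z) * (\<eta> / A)"
      proof (rule differentiable_bound_linearization[where S = "{w. norm (w - z) < d}"
            and f' = "\<lambda>w v. bump_grad e w \<bullet> v"])
        show "z + t *\<^sub>R (z + v - z) \<in> {w. norm (w - z) < d}" if "t \<in> {0..1}" for t
          using that \<open>norm v < d\<close> mult_right_mono[of t 1 "norm v"] by auto
        show "(bump e has_derivative (\<bullet>) (bump_grad e w)) (at w within {w. norm (w - z) < d})" for w
          using bump_has_derivative by (rule has_derivative_at_withinI)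
        show "onorm ((\<bullet>) (bump_grad e w) - (\<bullet>) (bump_grad e z)) \<le> \<eta> / A" if "w \<in> {w. norm (w - z) < d}" for w
        proof (rule onorm_le)
          fix u
          have "norm (bump_grad e w - bump_grad e z) \<le> \<eta> / A"
            using d(2)[of "w - z" z] that by simp
          then show "norm (((\<bullet>) (bump_grad e w) - (\<bullet>) (bump_grad e z)) u) \<le> \<eta> / A * norm u"
            using order_trans[OF Cauchy_Schwarz_ineq2[of "bump_grad e w - bump_grad e z" u]
                mult_right_mono[OF _ norm_ge_zero], of "\<eta> / A"]
            by (simp add: inner_diff_left)
        qed
      qed (use d(1) in auto)
      then show ?thesis by simp
    qed
    have "norm ((LBINT y. f y * bump e (x' - y)) - (LBINT y. f y * bump e (x - y)) - L \<bullet> (x' - x))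
        \<le> \<eta> * norm (x' - x)" if x': "norm (x' - x) < d" for x'
    proof -
      have "(LBINT y. f y * bump e (x' - y)) - (LBINT y. f y * bump e (x - y)) - L \<bullet> (x' - x)
        = (LBINT y. f y * bump e (x' - y) - f y * bump e (x - y) - f y * (bump_grad e (x - y) \<bullet> (x' - x)))"
        using f by (simp add: Lv conv_integrable)
      also have "norm \<dots> \<le> (LBINT y. norm (x' - x) * (\<eta> / A) * \<bar>f y\<bar>)"
      proof (rule Bochner_Integration.integral_norm_bound_integral)
        fix y
        have "\<bar>f y * bump e (x' - y) - f y * bump e (x - y) - f y * (bump_grad e (x - y) \<bullet> (x' - x))\<bar>
          = \<bar>f y\<bar> * \<bar>bump e ((x - y) + (x' - x)) - bump e (x - y) - bump_grad e (x - y) \<bullet> (x' - x)\<bar>"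
        proof -
          have "f y * bump e (x' - y) - f y * bump e (x - y) - f y * (bump_grad e (x - y) \<bullet> (x' - x))
            = f y * (bump e (x' - y) - bump e (x - y) - bump_grad e (x - y) \<bullet> (x' - x))"
            by (simp add: right_diff_distrib)
          moreover have "(x - y) + (x' - x) = x' - y" by simp
          ultimately show ?thesis by (simp only: abs_mult)
        qed
        also have "\<dots> \<le> \<bar>f y\<bar> * (norm (x' - x) * (\<eta> / A))"
          by (intro mult_left_mono lin x') auto
        finally show "norm (f y * bump e (x' - y) - f y * bump e (x - y) - f y * (bump_grad e (x - y) \<bullet> (x' - x)))
            \<le> norm (x' - x) * (\<eta> / A) * \<bar>f y\<bar>" by (simp add: mult_ac)
      qed (use f in \<open>auto simp: Lv conv_integrable intro!: Bochner_Integration.integrable_diff\<close>)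
      also have "\<dots> = norm (x' - x) * \<eta> * ((LBINT y. \<bar>f y\<bar>) / A)" by simp
      also have "\<dots> \<le> norm (x' - x) * \<eta> * 1"
        using A \<open>0 < \<eta>\<close> by (intro mult_left_mono) (auto simp: A_def)
      finally show ?thesis by (simp add: mult.commute)
    qed
    then show "\<exists>d>0. \<forall>y. norm (y - x) < d \<longrightarrow>
        norm ((\<integral>ya. f ya * bump e (y - ya) \<partial>lborel) - (LBINT y. f y * bump e (x - y)) - L \<bullet> (y - x))
        \<le> \<eta> * norm (y - x)" using d(1) by blast
  qed
  from has_derivative_mult_left[OF this, of "inverse (LBINT z. bump e (z::'a))"]
  show ?thesis unfolding conv_def[abs_def] Lv divide_inverse .
qed

lemma continuous_conv: "integrable lborel f \<Longrightarrow> continuous_on S (conv e f)"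
  using conv_has_derivative by (meson continuous_at_imp_continuous_on has_derivative_continuous)

lemma borel_conv: "integrable lborel f \<Longrightarrow> conv e f \<in> borel_measurable borel"
  by (rule borel_measurable_continuous_onI) (rule continuous_conv)

lemma integral_lborel_reflect:
  fixes f :: "'a::euclidean_space \<Rightarrow> real"
  assumes [measurable]: "f \<in> borel_measurable borel"
  shows "(LBINT y. f (x - y)) = (LBINT z. f z)"
    and "(\<integral>\<^sup>+y. f (x - y) \<partial>lborel) = (\<integral>\<^sup>+z. f z \<partial>lborel)"
    and "integrable lborel (\<lambda>y. f (x - y)) \<longleftrightarrow> integrable lborel f"
proof -
  have "(lborel :: 'a measure) = distr lborel borel (\<lambda>y. x - y)"
    using lborel_affine[of "-1" x] by (simp add: density_1)
  note * = this
  show "(LBINT y. f (x - y)) = (LBINT z. f z)"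
    by (subst (2) *, subst integral_distr) auto
  show "(\<integral>\<^sup>+y. f (x - y) \<partial>lborel) = (\<integral>\<^sup>+z. f z \<partial>lborel)"
    by (subst (2) *, subst nn_integral_distr) auto
  show "integrable lborel (\<lambda>y. f (x - y)) \<longleftrightarrow> integrable lborel f"
    by (subst (2) *, subst integrable_distr_eq) auto
qed

lemma bump_shift:
  fixes x :: "'a::euclidean_space"
  shows "integrable lborel (\<lambda>y. bump e (x - y))" "(LBINT y. bump e (x - y)) = (LBINT z. bump e (z::'a))"
  using integral_lborel_reflect[of "bump e" x] bump_integrable[of e] by simp_all

text \<open>Jensen's inequality for the square, read off from the nonnegative integral of
  \<open>(f y - c)\<^sup>2\<close> against the kernel, with c the mean
  \<open>conv e f x\<close>.\<close>

lemma conv_square_le: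
  fixes f :: "'a::euclidean_space \<Rightarrow> real"
  assumes "0 < e" and f: "integrable lborel f" and f2: "integrable lborel (\<lambda>x. (f x)\<^sup>2)"
  shows "(conv e f x)\<^sup>2 \<le> conv e (\<lambda>x. (f x)\<^sup>2) x"
proof -
  define m where "m = (LBINT z. bump e (z::'a))"
  define c where "c = conv e f x"
  have m: "0 < m" using integral_bump_pos[OF \<open>0 < e\<close>] by (simp add: m_def)
  have "0 \<le> (LBINT y. (f y - c)\<^sup>2 * bump e (x - y))"
    by (intro Bochner_Integration.integral_nonneg) (simp add: bump_nonneg)
  also have "(\<lambda>y. (f y - c)\<^sup>2 * bump e (x - y)) =
      (\<lambda>y. (f y)\<^sup>2 * bump e (x - y) - 2 * c * (f y * bump e (x - y)) + c\<^sup>2 * bump e (x - y))"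
    by (auto simp: power2_eq_square algebra_simps)
  also have "(LBINT y. (f y)\<^sup>2 * bump e (x - y) - 2 * c * (f y * bump e (x - y)) + c\<^sup>2 * bump e (x - y))
    = (LBINT y. (f y)\<^sup>2 * bump e (x - y)) - 2 * c * (LBINT y. f y * bump e (x - y)) + c\<^sup>2 * m"
    using conv_integrable[OF f, of e x] conv_integrable[OF f2, of e x] bump_shift[of e x]
    by (simp add: m_def)
  also have "(LBINT y. (f y)\<^sup>2 * bump e (x - y)) = m * conv e (\<lambda>x. (f x)\<^sup>2) x"
    using m by (simp add: conv_def m_def)
  also have "(LBINT y. f y * bump e (x - y)) = m * c"
    using m by (simp add: conv_def m_def c_def)
  also have "m * conv e (\<lambda>x. (f x)\<^sup>2) x - 2 * c * (m * c) + c\<^sup>2 * m = m * (conv e (\<lambda>x. (f x)\<^sup>2) x - c\<^sup>2)"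
    by (simp add: power2_eq_square algebra_simps)
  finally show ?thesis using m by (simp add: c_def zero_le_mult_iff)
qed

text \<open>Tonelli: integrating first in x, every y contributes f y times the full mass of the
  kernel, which the normalisation divides out. Stated for nonnegative f because it is applied to
  squares.\<close>

lemma conv_nonneg_integral:
  fixes f :: "'a::euclidean_space \<Rightarrow> real"
  assumes "0 < e" and f: "integrable lborel f" and nn: "\<And>x. 0 \<le> f x"
  shows "integrable lborel (conv e f)" "(LBINT x. conv e f x) = (LBINT x. f x)"
proof -
  define m where "m = (LBINT z. bump e (z::'a))"
  have m: "0 < m" using integral_bump_pos[OF \<open>0 < e\<close>] by (simp add: m_def)
  have [measurable]: "f \<in> borel_measurable borel" using f by auto
  have conv0: "0 \<le> conv e f x" for x
    unfolding conv_def using m nn bump_nonneg[of e]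
    by (intro divide_nonneg_pos Bochner_Integration.integral_nonneg mult_nonneg_nonneg) (auto simp: m_def)
  have b: "(\<integral>\<^sup>+x. ennreal (bump e (x - y)) \<partial>lborel) = ennreal m" for y :: 'a
    by (subst bump_minus, subst integral_lborel_reflect(2))
       (auto simp: m_def bump_nonneg intro!: nn_integral_eq_integral bump_integrable)
  have "(\<integral>\<^sup>+x. ennreal (m * conv e f x) \<partial>lborel) = (\<integral>\<^sup>+x. \<integral>\<^sup>+y. ennreal (f y * bump e (x - y)) \<partial>lborel \<partial>lborel)"
  proof (rule nn_integral_cong)
    fix x
    have "(\<integral>\<^sup>+y. ennreal (f y * bump e (x - y)) \<partial>lborel) = ennreal (LBINT y. f y * bump e (x - y))"
      by (intro nn_integral_eq_integral conv_integrable[OF f] AE_I2 mult_nonneg_nonneg nn bump_nonneg)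
    then show "ennreal (m * conv e f x) = (\<integral>\<^sup>+y. ennreal (f y * bump e (x - y)) \<partial>lborel)"
      using m by (simp add: conv_def m_def)
  qed
  also have "\<dots> = (\<integral>\<^sup>+y. \<integral>\<^sup>+x. ennreal (f y * bump e (x - y)) \<partial>lborel \<partial>lborel)"
    by (rule lborel_pair.Fubini'[symmetric]) measurable
  also have "\<dots> = (\<integral>\<^sup>+y. ennreal (f y) * ennreal m \<partial>lborel)"
    by (simp add: ennreal_mult nn_integral_cmult b nn bump_nonneg)
  also have "\<dots> = ennreal m * ennreal (LBINT x. f x)"
    using f nn by (simp add: nn_integral_cmult nn_integral_eq_integral mult.commute[of _ "ennreal m"])
  finally have *: "(\<integral>\<^sup>+x. ennreal (m * conv e f x) \<partial>lborel) = ennreal (m * (LBINT x. f x))"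
    using m nn by (simp add: ennreal_mult)
  have "has_bochner_integral lborel (\<lambda>x. m * conv e f x) (m * (LBINT x. f x))"
    using m nn conv0 borel_conv[OF f, of e]
    by (intro has_bochner_integral_nn_integral *) (auto intro!: Bochner_Integration.integral_nonneg)
  then have "has_bochner_integral lborel (\<lambda>x. inverse m * (m * conv e f x)) (inverse m * (m * (LBINT x. f x)))"
    by (rule has_bochner_integral_mult_right)
  then have "has_bochner_integral lborel (conv e f) (LBINT x. f x)"
    using m by (simp add: mult.assoc[symmetric])
  then show "integrable lborel (conv e f)" "(LBINT x. conv e f x) = (LBINT x. f x)"
    by (auto simp: has_bochner_integral_iff)
qed

text \<open>Jensen pointwise, then conservation of mass for the convolved square.\<close>

lemma conv_L2_contraction:
  fixes f :: "'a::euclidean_space \<Rightarrow> real"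
  assumes "0 < e" and f: "integrable lborel f" and f2: "integrable lborel (\<lambda>x. (f x)\<^sup>2)"
  shows "integrable lborel (\<lambda>x. (conv e f x)\<^sup>2)" "(LBINT x. (conv e f x)\<^sup>2) \<le> (LBINT x. (f x)\<^sup>2)"
proof -
  note c = conv_nonneg_integral[OF \<open>0 < e\<close> f2]
  have [measurable]: "conv e f \<in> borel_measurable borel" by (rule borel_conv[OF f])
  have le: "(conv e f x)\<^sup>2 \<le> conv e (\<lambda>x. (f x)\<^sup>2) x" for x by (rule conv_square_le[OF assms])
  show i: "integrable lborel (\<lambda>x. (conv e f x)\<^sup>2)"
  proof (rule Bochner_Integration.integrable_bound[OF c(1)])
    show "AE x in lborel. norm ((conv e f x)\<^sup>2) \<le> norm (conv e (\<lambda>x. (f x)\<^sup>2) x)"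
      using le by (intro AE_I2) (simp, smt (verit))
  qed auto
  have "(LBINT x. (conv e f x)\<^sup>2) \<le> (LBINT x. conv e (\<lambda>x. (f x)\<^sup>2) x)"
    using le i c by (intro integral_mono) auto
  also have "\<dots> = (LBINT x. (f x)\<^sup>2)" using c by simp
  finally show "(LBINT x. (conv e f x)\<^sup>2) \<le> (LBINT x. (f x)\<^sup>2)" .
qed

lemma conv_diff:
  "integrable lborel f \<Longrightarrow> integrable lborel g \<Longrightarrow> conv e (\<lambda>x. f x - g x) x = conv e f x - conv e g x"
  by (simp add: conv_def conv_integrable left_diff_distrib diff_divide_distrib)

lemma conv_near_value:
  fixes w :: "'a::euclidean_space \<Rightarrow> real"
  assumes "0 < e" and w: "integrable lborel w" and near: "\<And>y. norm (x - y) < sqrt e \<Longrightarrow> \<bar>w y - a\<bar> \<le> \<eta>"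
  shows "\<bar>conv e w x - a\<bar> \<le> \<eta>"
proof -
  define m where "m = (LBINT z. bump e (z::'a))"
  have m: "0 < m" using integral_bump_pos[OF \<open>0 < e\<close>] by (simp add: m_def)
  have "norm (LBINT y. w y * bump e (x - y) - a * bump e (x - y)) \<le> (LBINT y. \<eta> * bump e (x - y))"
  proof (rule Bochner_Integration.integral_norm_bound_integral)
    fix y
    show "norm (w y * bump e (x - y) - a * bump e (x - y)) \<le> \<eta> * bump e (x - y)"
    proof (cases "norm (x - y) < sqrt e")
      case True
      have "norm (w y * bump e (x - y) - a * bump e (x - y)) = \<bar>w y - a\<bar> * bump e (x - y)"
        by (simp add: left_diff_distrib[symmetric] abs_mult abs_of_nonneg[OF bump_nonneg])
      then show ?thesis using near[OF True] by (simp add: mult_right_mono bump_nonneg)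
    qed (simp add: bump_eq_0)
  qed (intro Bochner_Integration.integrable_diff integrable_mult_right conv_integrable[OF w] bump_shift)+
  also have "\<dots> = \<eta> * m" by (simp add: bump_shift m_def)
  also have "(LBINT y. w y * bump e (x - y) - a * bump e (x - y)) = m * (conv e w x - a)"
    using conv_integrable[OF w, of e x] bump_shift[of e x] m by (simp add: conv_def m_def right_diff_distrib)
  finally show ?thesis using m by (simp add: abs_mult mult.commute)
qed

section \<open>Approximation in \<open>L\<^sup>2\<close>\<close>

lemma integrable_of_square_integrable:
  fixes f :: "'a::euclidean_space \<Rightarrow> real"
  assumes [measurable]: "f \<in> borel_measurable borel" "S \<in> sets borel"
    and f2: "integrable lborel (\<lambda>x. (f x)\<^sup>2)" and "bounded S" "\<And>x. x \<notin> S \<Longrightarrow> f x = 0"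
  shows "integrable lborel f"
proof (rule Bochner_Integration.integrable_bound)
  show "integrable lborel (\<lambda>x. (f x)\<^sup>2 + indicator S x)"
    using f2 emeasure_lborel_finite[OF \<open>bounded S\<close>] by auto
  have "\<bar>f x\<bar> \<le> (f x)\<^sup>2 + indicator S x" for x
  proof (cases "x \<in> S")
    case True
    have "0 \<le> (\<bar>f x\<bar> - 1)\<^sup>2" by simp
    then have "2 * \<bar>f x\<bar> \<le> (f x)\<^sup>2 + 1" by (simp add: power2_diff)
    with True show ?thesis by simp
  qed (simp add: assms)
  then show "AE x in lborel. norm (f x) \<le> norm ((f x)\<^sup>2 + indicator S x)" by (intro AE_I2) simp
qed auto

text \<open>f is split into a continuous function cut off outside a ball and a remainder that is
  small in L2. Contraction controls the mollified remainder, uniform continuity the continuous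
  part.\<close>

lemma conv_L2_converges:
  fixes f :: "'a::euclidean_space \<Rightarrow> real"
  assumes [measurable]: "f \<in> borel_measurable borel"
    and f0: "\<And>x. x \<notin> ball 0 1 \<Longrightarrow> f x = 0" and f2: "integrable lborel (\<lambda>x. (f x)\<^sup>2)" and \<epsilon>: "0 < \<epsilon>"
  shows "\<exists>\<delta>>0. \<forall>e. 0 < e \<and> e < \<delta> \<longrightarrow>
    (LBINT x. indicator (ball 0 1) x * (conv e f x - f x)\<^sup>2) < \<epsilon>"
proof -
  define V where "V = measure lborel (ball (0::'a) 1)"
  have V: "0 \<le> V" by (simp add: V_def)
  have fi: "integrable lborel f"
    by (rule integrable_of_square_integrable[OF _ _ f2, of "ball 0 1"]) (use f0 in auto)
  \<comment> \<open>Radius 2 leaves room: with kernel radius below 1, the mollification at a point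
    of the unit ball sees only points where \<open>W\<close> equals w.\<close>
  define S where "S = ball (0::'a) 2"
  have [measurable]: "S \<in> sets borel" by (simp add: S_def)
  \<comment> \<open>Squaring a sum of three errors costs a factor 3, so each square gets the budget
    \<epsilon> / 9.\<close>
  obtain w k where w: "continuous_on UNIV w" "\<And>x. \<bar>w x\<bar> \<le> k"
    "(LBINT x. indicator S x * (f x - w x)\<^sup>2) < \<epsilon> / 9"
    using continuous_dense_L2[of f S "\<epsilon> / 9"] f2 \<epsilon> by (auto simp: S_def)
  have [measurable]: "w \<in> borel_measurable borel" using w(1) by (rule borel_measurable_continuous_onI)
  define W where "W = (\<lambda>x. indicator S x * w x)"
  have [measurable]: "W \<in> borel_measurable borel" unfolding W_def by measurable
  have W: "bounded S" "\<And>x. x \<notin> S \<Longrightarrow> W x = 0" "\<And>x. \<bar>W x\<bar> \<le> \<bar>k\<bar>"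
    using order_trans[OF w(2) abs_ge_self] by (auto simp: W_def S_def indicator_def)
  have Wi: "integrable lborel W"
    by (rule integrable_bounded_support[of _ S "\<bar>k\<bar>"]) (use W in auto)
  have W2: "integrable lborel (\<lambda>x. (W x)\<^sup>2)"
    by (rule integrable_bounded_support[of _ S "k\<^sup>2"]) (use W in \<open>auto simp: abs_le_square_iff\<close>)
  define g where "g = (\<lambda>x. f x - W x)"
  have gi: "integrable lborel g" using fi Wi by (simp add: g_def)
  have g2: "integrable lborel (\<lambda>x. (g x)\<^sup>2)"
    unfolding g_def by (rule square_integrable_diff) (use f2 W2 in auto)
  have "(g x)\<^sup>2 = indicator S x * (f x - w x)\<^sup>2" for x
    using f0[of x] by (auto simp: g_def W_def S_def indicator_def)
  with w(3) have g9: "(LBINT x. (g x)\<^sup>2) < \<epsilon> / 9" by simp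
  \<comment> \<open>A pointwise error of this size contributes at most \<epsilon> / 9 over the unit
    ball, whose volume is V.\<close>
  define \<eta> where "\<eta> = sqrt (\<epsilon> / (9 * (V + 1)))"
  have \<eta>: "0 < \<eta>" using \<epsilon> V by (simp add: \<eta>_def)
  have "\<eta>\<^sup>2 = \<epsilon> / (9 * (V + 1))" using \<epsilon> V by (simp add: \<eta>_def)
  then have "\<eta>\<^sup>2 * (V + 1) = \<epsilon> / 9" using V by (simp only:) (simp add: divide_simps)
  then have \<eta>V: "\<eta>\<^sup>2 * V \<le> \<epsilon> / 9" by (simp add: distrib_left) (use zero_le_power2[of \<eta>] in linarith)
  have "uniformly_continuous_on (cball 0 2) w"
    using w(1) by (intro compact_uniformly_continuous) (auto intro: continuous_on_subset)
  then obtain d where d: "0 < d"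
    "\<And>x y. x \<in> cball 0 2 \<Longrightarrow> y \<in> cball 0 2 \<Longrightarrow> dist y x < d \<Longrightarrow> dist (w y) (w x) < \<eta>"
    using \<eta> unfolding uniformly_continuous_on_def by metis
  show ?thesis
  proof (intro exI[of _ "min (d\<^sup>2) 1"] conjI allI impI)
    show "0 < min (d\<^sup>2) 1" using d(1) by simp
    fix e assume "0 < e \<and> e < min (d\<^sup>2) 1"
    then have e: "0 < e" "sqrt e < d" "sqrt e < 1" using d(1) by (auto intro: real_less_lsqrt)
    have near: "\<bar>conv e W x - w x\<bar> \<le> \<eta>" if x: "x \<in> ball 0 1" for x
    proof (rule conv_near_value[OF e(1) Wi])
      fix y assume y: "norm (x - y) < sqrt e"
      moreover have "norm x < 1" using x by simp
      ultimately have "norm y < 2"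
        using e(3) norm_triangle_ineq2[of y x] norm_minus_commute[of x y] by linarith
      moreover have "norm (y - x) < d" using y e(2) by (simp add: norm_minus_commute)
      ultimately show "\<bar>W y - w x\<bar> \<le> \<eta>"
        using d(2)[of x y] x by (simp add: W_def S_def dist_norm)
    qed
    have le: "indicator (ball 0 1) x * (conv e f x - f x)\<^sup>2
        \<le> 3 * (conv e g x)\<^sup>2 + 3 * \<eta>\<^sup>2 * indicator (ball 0 1) x + 3 * (g x)\<^sup>2" for x
    proof (cases "x \<in> ball 0 1")
      case True
      define a where "a = conv e g x"
      define b where "b = conv e W x - w x"
      define c where "c = - g x"
      have "conv e f x - f x = a + b + c"
        using True conv_diff[OF fi Wi, of e x] by (simp add: a_def b_def c_def g_def W_def S_def)
      moreover have "b\<^sup>2 \<le> \<eta>\<^sup>2" using near[OF True] by (simp add: b_def abs_le_square_iff[symmetric])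
      moreover have "(a + b + c)\<^sup>2 \<le> 3 * a\<^sup>2 + 3 * b\<^sup>2 + 3 * c\<^sup>2"
        using sum_squares_bound[of a b] sum_squares_bound[of b c] sum_squares_bound[of a c]
        by (simp add: power2_eq_square algebra_simps)
      ultimately show ?thesis using True by (simp add: a_def c_def)
    qed simp
    have "(LBINT x. indicator (ball 0 1) x * (conv e f x - f x)\<^sup>2)
        \<le> (LBINT x. 3 * (conv e g x)\<^sup>2 + 3 * \<eta>\<^sup>2 * indicator (ball 0 1) x + 3 * (g x)\<^sup>2)"
      using conv_L2_contraction(1)[OF e(1) gi g2] g2 le emeasure_lborel_finite[of "ball (0::'a) 1"]
      by (intro integral_mono') (auto intro!: Bochner_Integration.integrable_add integrable_real_indicator)
    also have "\<dots> = 3 * (LBINT x. (conv e g x)\<^sup>2) + 3 * \<eta>\<^sup>2 * V + 3 * (LBINT x. (g x)\<^sup>2)"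
      using conv_L2_contraction(1)[OF e(1) gi g2] g2 emeasure_lborel_finite[of "ball (0::'a) 1"]
      by (subst Bochner_Integration.integral_add Bochner_Integration.integral_add)+ (auto simp: V_def)
    also have "\<dots> < \<epsilon>"
      using conv_L2_contraction(2)[OF e(1) gi g2] g9 \<eta>V by linarith
    finally show "(LBINT x. indicator (ball 0 1) x * (conv e f x - f x)\<^sup>2) < \<epsilon>" .
  qed
qed

section \<open>Convergence in L2 and its stability rules\<close>

lemma Cauchy_Schwarz_integral:
  fixes f g :: "'b \<Rightarrow> real"
  assumes [measurable]: "f \<in> borel_measurable M" "g \<in> borel_measurable M"
    and f: "integrable M (\<lambda>x. (f x)\<^sup>2)" and g: "integrable M (\<lambda>x. (g x)\<^sup>2)"
  shows "\<bar>\<integral>x. f x * g x \<partial>M\<bar> \<le> sqrt (\<integral>x. (f x)\<^sup>2 \<partial>M) * sqrt (\<integral>x. (g x)\<^sup>2 \<partial>M)"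
proof -
  define A where "A = (\<integral>x. (f x)\<^sup>2 \<partial>M)"
  define B where "B = (\<integral>x. (g x)\<^sup>2 \<partial>M)"
  define P where "P = (\<integral>x. f x * g x \<partial>M)"
  have fg: "integrable M (\<lambda>x. f x * g x)" by (rule square_integrable_mult) (use f g in auto)
  have q: "0 \<le> t\<^sup>2 * A + 2 * t * P + B" for t
  proof -
    have "0 \<le> (\<integral>x. (t * f x + g x)\<^sup>2 \<partial>M)" by simp
    also have "(\<lambda>x. (t * f x + g x)\<^sup>2) = (\<lambda>x. t\<^sup>2 * (f x)\<^sup>2 + 2 * t * (f x * g x) + (g x)\<^sup>2)"
      by (auto simp: power2_eq_square algebra_simps)
    also have "(\<integral>x. t\<^sup>2 * (f x)\<^sup>2 + 2 * t * (f x * g x) + (g x)\<^sup>2 \<partial>M) = t\<^sup>2 * A + 2 * t * P + B"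
      using f g fg by (simp add: A_def B_def P_def)
    finally show ?thesis .
  qed
  have AB: "0 \<le> A" "0 \<le> B" by (simp_all add: A_def B_def)
  have "P\<^sup>2 \<le> A * B"
  proof (cases "A = 0")
    case True
    have "P = 0"
    proof (rule ccontr)
      assume "P \<noteq> 0"
      \<comment> \<open>With A = 0 the polynomial is affine in t; the chosen argument gives it the
        value -1.\<close>
      then show False using q[of "- (B + 1) / (2 * P)"] True AB(2) by (simp add: field_simps)
    qed
    then show ?thesis using True by simp
  next
    case False
    with AB have "0 < A" by simp
    \<comment> \<open>The argument is the minimiser of the quadratic polynomial.\<close>
    then show ?thesis using q[of "- P / A"] by (simp add: field_simps power2_eq_square)
  qed
  then have "sqrt (P\<^sup>2) \<le> sqrt (A * B)" by (rule real_sqrt_le_mono)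
  then show ?thesis by (simp add: real_sqrt_mult A_def B_def P_def)
qed

text \<open>Measurability and square integrability are bundled with the convergence, so that the
  stability rules compose without further side conditions on the sequences.\<close>

definition l2lim :: "'b measure \<Rightarrow> (nat \<Rightarrow> 'b \<Rightarrow> real) \<Rightarrow> ('b \<Rightarrow> real) \<Rightarrow> bool" where
  "l2lim M F f \<longleftrightarrow>
    (\<forall>n. F n \<in> borel_measurable M \<and> integrable M (\<lambda>x. (F n x)\<^sup>2)) \<and>
    f \<in> borel_measurable M \<and> integrable M (\<lambda>x. (f x)\<^sup>2) \<and>
    (\<lambda>n. \<integral>x. (F n x - f x)\<^sup>2 \<partial>M) \<longlonglongrightarrow> 0"

lemma l2limD:
  assumes "l2lim M F f"
  shows "F n \<in> borel_measurable M" "integrable M (\<lambda>x. (F n x)\<^sup>2)" "f \<in> borel_measurable M"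
    "integrable M (\<lambda>x. (f x)\<^sup>2)" "(\<lambda>n. \<integral>x. (F n x - f x)\<^sup>2 \<partial>M) \<longlonglongrightarrow> 0"
  using assms by (auto simp: l2lim_def)

lemma l2lim_const:
  "f \<in> borel_measurable M \<Longrightarrow> integrable M (\<lambda>x. (f x)\<^sup>2) \<Longrightarrow> l2lim M (\<lambda>n. f) f"
  by (simp add: l2lim_def)

lemma l2lim_add:
  assumes F: "l2lim M F f" and G: "l2lim M G g"
  shows "l2lim M (\<lambda>n x. F n x + G n x) (\<lambda>x. f x + g x)"
proof -
  note [measurable] = l2limD(1,3)[OF F] l2limD(1,3)[OF G]
  note F' = l2limD[OF F] and G' = l2limD[OF G]
  have dF: "integrable M (\<lambda>x. (F n x - f x)\<^sup>2)" for n by (rule square_integrable_diff) (use F' in auto)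
  have dG: "integrable M (\<lambda>x. (G n x - g x)\<^sup>2)" for n by (rule square_integrable_diff) (use G' in auto)
  have "(\<lambda>n. \<integral>x. (F n x + G n x - (f x + g x))\<^sup>2 \<partial>M) \<longlonglongrightarrow> 0"
  proof (rule tendsto_sandwich[OF _ _ tendsto_const])
    show "(\<lambda>n. 2 * (\<integral>x. (F n x - f x)\<^sup>2 \<partial>M) + 2 * (\<integral>x. (G n x - g x)\<^sup>2 \<partial>M)) \<longlonglongrightarrow> 0"
      using tendsto_add[OF tendsto_mult_right_zero[OF F'(5), of 2] tendsto_mult_right_zero[OF G'(5), of 2]] by simp
    have "(\<integral>x. (F n x + G n x - (f x + g x))\<^sup>2 \<partial>M) \<le> (\<integral>x. 2 * (F n x - f x)\<^sup>2 + 2 * (G n x - g x)\<^sup>2 \<partial>M)" for n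
    proof (rule integral_mono')
      have "(a + b)\<^sup>2 \<le> 2 * a\<^sup>2 + 2 * b\<^sup>2" for a b :: real
        using sum_squares_bound[of a b] by (simp add: power2_sum)
      from this[of "F n x - f x" "G n x - g x" for x]
      show "(F n x + G n x - (f x + g x))\<^sup>2 \<le> 2 * (F n x - f x)\<^sup>2 + 2 * (G n x - g x)\<^sup>2" for x
        by (simp add: algebra_simps)
    qed (use dF dG in auto)
    then show "\<forall>\<^sub>F n in sequentially. (\<integral>x. (F n x + G n x - (f x + g x))\<^sup>2 \<partial>M)
        \<le> 2 * (\<integral>x. (F n x - f x)\<^sup>2 \<partial>M) + 2 * (\<integral>x. (G n x - g x)\<^sup>2 \<partial>M)"
      using dF dG by simp
  qed auto
  then show ?thesis
    unfolding l2lim_def using F' G' by (auto intro!: square_integrable_add)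
qed

lemma l2lim_mult:
  assumes F: "l2lim M F f" and [measurable]: "a \<in> borel_measurable M" and a: "\<And>x. x \<in> space M \<Longrightarrow> \<bar>a x\<bar> \<le> C"
  shows "l2lim M (\<lambda>n x. a x * F n x) (\<lambda>x. a x * f x)"
proof -
  note [measurable] = l2limD(1,3)[OF F]
  note F' = l2limD[OF F]
  have dF: "integrable M (\<lambda>x. (F n x - f x)\<^sup>2)" for n by (rule square_integrable_diff) (use F' in auto)
  have le: "(a x * t)\<^sup>2 \<le> C\<^sup>2 * t\<^sup>2" if "x \<in> space M" for x t
    using a[OF that] by (auto simp: power_mult_distrib abs_le_square_iff[symmetric] intro!: mult_right_mono)
  have bd: "integrable M (\<lambda>x. (a x * h x)\<^sup>2)" if "integrable M (\<lambda>x. (h x)\<^sup>2)" and [measurable]: "h \<in> borel_measurable M" for h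
  proof (rule Bochner_Integration.integrable_bound)
    show "integrable M (\<lambda>x. C\<^sup>2 * (h x)\<^sup>2)" using that by simp
  qed (use le in auto)
  have "(\<lambda>n. \<integral>x. (a x * F n x - a x * f x)\<^sup>2 \<partial>M) \<longlonglongrightarrow> 0"
  proof (rule tendsto_sandwich[OF _ _ tendsto_const])
    show "(\<lambda>n. C\<^sup>2 * (\<integral>x. (F n x - f x)\<^sup>2 \<partial>M)) \<longlonglongrightarrow> 0"
      by (rule tendsto_mult_right_zero[OF F'(5)])
    have "(\<integral>x. (a x * F n x - a x * f x)\<^sup>2 \<partial>M) \<le> (\<integral>x. C\<^sup>2 * (F n x - f x)\<^sup>2 \<partial>M)" for n
      by (rule integral_mono') (use dF le in \<open>auto simp: right_diff_distrib[symmetric]\<close>)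
    then show "\<forall>\<^sub>F n in sequentially. (\<integral>x. (a x * F n x - a x * f x)\<^sup>2 \<partial>M) \<le> C\<^sup>2 * (\<integral>x. (F n x - f x)\<^sup>2 \<partial>M)"
      by simp
  qed auto
  then show ?thesis
    unfolding l2lim_def using F' by (auto intro!: bd)
qed

lemma l2lim_sum:
  assumes "finite I" "\<And>i. i \<in> I \<Longrightarrow> l2lim M (F i) (f i)"
  shows "l2lim M (\<lambda>n x. \<Sum>i\<in>I. F i n x) (\<lambda>x. \<Sum>i\<in>I. f i x)"
  using assms by induction (auto intro: l2lim_add l2lim_const)

text \<open>The difference of the products is (F - f)(G - g) + f (G - g) + g (F - f), and
  Cauchy-Schwarz makes each term vanish in the limit. This is how identities bilinear in a function
  and its gradient pass from C1 functions to Sobolev functions.\<close>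

lemma l2lim_integral_mult:
  assumes F: "l2lim M F f" and G: "l2lim M G g"
  shows "(\<lambda>n. \<integral>x. F n x * G n x \<partial>M) \<longlonglongrightarrow> (\<integral>x. f x * g x \<partial>M)"
proof -
  note [measurable] = l2limD(1,3)[OF F] l2limD(1,3)[OF G]
  note F' = l2limD[OF F] and G' = l2limD[OF G]
  have dF: "integrable M (\<lambda>x. (F n x - f x)\<^sup>2)" for n by (rule square_integrable_diff) (use F' in auto)
  have dG: "integrable M (\<lambda>x. (G n x - g x)\<^sup>2)" for n by (rule square_integrable_diff) (use G' in auto)
  define a where "a = (\<lambda>n. sqrt (\<integral>x. (F n x - f x)\<^sup>2 \<partial>M))"
  define b where "b = (\<lambda>n. sqrt (\<integral>x. (G n x - g x)\<^sup>2 \<partial>M))"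
  have a0: "a \<longlonglongrightarrow> 0" and b0: "b \<longlonglongrightarrow> 0"
    using tendsto_real_sqrt[OF F'(5)] tendsto_real_sqrt[OF G'(5)] by (simp_all add: a_def b_def)
  have "(\<lambda>n. (\<integral>x. F n x * G n x \<partial>M) - (\<integral>x. f x * g x \<partial>M)) \<longlonglongrightarrow> 0"
  proof (rule Lim_null_comparison)
    show "(\<lambda>n. a n * b n + sqrt (\<integral>x. (f x)\<^sup>2 \<partial>M) * b n + sqrt (\<integral>x. (g x)\<^sup>2 \<partial>M) * a n) \<longlonglongrightarrow> 0"
      using tendsto_add[OF tendsto_add[OF tendsto_mult[OF a0 b0] tendsto_mult_right_zero[OF b0, of "sqrt (\<integral>x. (f x)\<^sup>2 \<partial>M)"]]
          tendsto_mult_right_zero[OF a0, of "sqrt (\<integral>x. (g x)\<^sup>2 \<partial>M)"]] by simp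
    show "\<forall>\<^sub>F n in sequentially. norm ((\<integral>x. F n x * G n x \<partial>M) - (\<integral>x. f x * g x \<partial>M))
      \<le> a n * b n + sqrt (\<integral>x. (f x)\<^sup>2 \<partial>M) * b n + sqrt (\<integral>x. (g x)\<^sup>2 \<partial>M) * a n"
    proof (rule always_eventually, rule allI)
      fix n
      have i: "integrable M (\<lambda>x. F n x * G n x)" "integrable M (\<lambda>x. f x * g x)"
        "integrable M (\<lambda>x. (F n x - f x) * (G n x - g x))" "integrable M (\<lambda>x. f x * (G n x - g x))"
        "integrable M (\<lambda>x. g x * (F n x - f x))"
        by (rule square_integrable_mult; use F' G' dF dG in auto)+
      have "(\<integral>x. F n x * G n x \<partial>M) - (\<integral>x. f x * g x \<partial>M) = (\<integral>x. F n x * G n x - f x * g x \<partial>M)"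
        using i by simp
      also have "(\<lambda>x. F n x * G n x - f x * g x) =
          (\<lambda>x. (F n x - f x) * (G n x - g x) + f x * (G n x - g x) + g x * (F n x - f x))"
        by (auto simp: algebra_simps)
      also have "(\<integral>x. (F n x - f x) * (G n x - g x) + f x * (G n x - g x) + g x * (F n x - f x) \<partial>M)
        = (\<integral>x. (F n x - f x) * (G n x - g x) \<partial>M) + (\<integral>x. f x * (G n x - g x) \<partial>M) + (\<integral>x. g x * (F n x - f x) \<partial>M)"
        using i by (subst Bochner_Integration.integral_add Bochner_Integration.integral_add)+ auto
      finally have eq: "(\<integral>x. F n x * G n x \<partial>M) - (\<integral>x. f x * g x \<partial>M) = \<dots>" .
      have "\<bar>\<integral>x. (F n x - f x) * (G n x - g x) \<partial>M\<bar> \<le> a n * b n"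
        unfolding a_def b_def by (rule Cauchy_Schwarz_integral) (use dF dG in auto)
      moreover have "\<bar>\<integral>x. f x * (G n x - g x) \<partial>M\<bar> \<le> sqrt (\<integral>x. (f x)\<^sup>2 \<partial>M) * b n"
        unfolding b_def by (rule Cauchy_Schwarz_integral) (use F' dG in auto)
      moreover have "\<bar>\<integral>x. g x * (F n x - f x) \<partial>M\<bar> \<le> sqrt (\<integral>x. (g x)\<^sup>2 \<partial>M) * a n"
        unfolding a_def by (rule Cauchy_Schwarz_integral) (use G' dF in auto)
      ultimately show "norm ((\<integral>x. F n x * G n x \<partial>M) - (\<integral>x. f x * g x \<partial>M))
        \<le> a n * b n + sqrt (\<integral>x. (f x)\<^sup>2 \<partial>M) * b n + sqrt (\<integral>x. (g x)\<^sup>2 \<partial>M) * a n"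
        unfolding eq real_norm_def by linarith
    qed
  qed
  then show ?thesis by (simp add: LIM_zero_iff)
qed

text \<open>Derivatives are taken in a full neighbourhood even at points of the bounding sphere, and
  the gradient is continuous on the closed ball, hence bounded. Gradients converge component by
  component since \<open>l2lim\<close> is about real functions.\<close>

definition C1_approx :: "real \<Rightarrow> ('a::euclidean_space \<Rightarrow> real) \<Rightarrow> ('a \<Rightarrow> 'a) \<Rightarrow>
    (nat \<Rightarrow> 'a \<Rightarrow> real) \<Rightarrow> (nat \<Rightarrow> 'a \<Rightarrow> 'a) \<Rightarrow> bool" where
  "C1_approx s p g \<phi> \<gamma> \<longleftrightarrow>
     (\<forall>n. \<forall>x\<in>cball 0 s. (\<phi> n has_derivative (\<lambda>v. \<gamma> n x \<bullet> v)) (at x)) \<and>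
     (\<forall>n. continuous_on (cball 0 s) (\<gamma> n)) \<and>
     l2lim lborel (\<lambda>n x. indicator (ball 0 s) x * \<phi> n x) (\<lambda>x. indicator (ball 0 s) x * p x) \<and>
     (\<forall>b\<in>Basis. l2lim lborel (\<lambda>n x. indicator (ball 0 s) x * (\<gamma> n x \<bullet> b))
        (\<lambda>x. indicator (ball 0 s) x * (g x \<bullet> b)))"

lemma C1_approxD:
  assumes "C1_approx s p g \<phi> \<gamma>"
  shows "x \<in> cball 0 s \<Longrightarrow> (\<phi> n has_derivative (\<lambda>v. \<gamma> n x \<bullet> v)) (at x)"
    "continuous_on (cball 0 s) (\<gamma> n)"
    "l2lim lborel (\<lambda>n x. indicator (ball 0 s) x * \<phi> n x) (\<lambda>x. indicator (ball 0 s) x * p x)"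
    "b \<in> Basis \<Longrightarrow> l2lim lborel (\<lambda>n x. indicator (ball 0 s) x * (\<gamma> n x \<bullet> b))
      (\<lambda>x. indicator (ball 0 s) x * (g x \<bullet> b))"
  using assms by (auto simp: C1_approx_def)

text \<open>Membership in \<open>W\<^sup>1\<^sup>,\<^sup>2\<close> of every smaller ball, phrased as approximability by functions of class
  \<open>C\<^sup>1\<close>, so that classical calculus passes to the limit.\<close>
definition W1 :: "('a::euclidean_space \<Rightarrow> real) \<Rightarrow> ('a \<Rightarrow> 'a) \<Rightarrow> bool" where
  "W1 p g \<longleftrightarrow> (\<forall>s. 0 < s \<and> s < 1 \<longrightarrow> (\<exists>\<phi> \<gamma>. C1_approx s p g \<phi> \<gamma>))"

text \<open>Mollification commutes with weak differentiation: the kernel translated to x is an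
  admissible test function once its radius is below 1 - s, and inserting it into the weak identity
  shows that the partial derivatives of the mollified \<open>U\<close> are the mollified components
  of g.\<close>

lemma weak_gradient_W1:
  fixes g :: "'a::euclidean_space \<Rightarrow> 'a"
  assumes [measurable]: "U \<in> borel_measurable borel" "g \<in> borel_measurable borel"
    and U0: "\<And>x. x \<notin> ball 0 1 \<Longrightarrow> U x = 0" and g0: "\<And>x. x \<notin> ball 0 1 \<Longrightarrow> g x = 0"
    and U2: "integrable lborel (\<lambda>x. (U x)\<^sup>2)"
    and g2: "\<And>b. b \<in> Basis \<Longrightarrow> integrable lborel (\<lambda>x. (g x \<bullet> b)\<^sup>2)"
    and weak: "\<And>\<phi> b. \<phi> \<in> test_functions \<Longrightarrow> b \<in> Basis \<Longrightarrow>
      (LBINT x. U x * frechet_derivative \<phi> (at x) b) = - (LBINT x. (g x \<bullet> b) * \<phi> x)"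
  shows "W1 U g"
  unfolding W1_def
proof (intro allI impI)
  fix s :: real assume s: "0 < s \<and> s < 1"
  have gb0: "g x \<bullet> b = 0" if "x \<notin> ball 0 1" for x b using g0[OF that] by simp
  have Ui: "integrable lborel U"
    by (rule integrable_of_square_integrable[OF _ _ U2, of "ball 0 1"]) (use U0 in auto)
  have gi: "integrable lborel (\<lambda>x. g x \<bullet> b)" if "b \<in> Basis" for b
    by (rule integrable_of_square_integrable[OF _ _ g2[OF that], of "ball 0 1"]) (use gb0 in auto)
  \<comment> \<open>Squared because the kernel has radius sqrt e; n + 2 keeps that radius strictly
    below 1 - s already for n = 0.\<close>
  define e where "e = (\<lambda>n. ((1 - s) / real (n + 2))\<^sup>2)"
  have e: "0 < e n" "sqrt (e n) < 1 - s" for n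
  proof -
    show "0 < e n" using s by (simp add: e_def)
    have "sqrt (e n) = (1 - s) / real (n + 2)" using s by (simp add: e_def)
    also have "\<dots> < (1 - s) / 1" using s by (intro divide_strict_left_mono) auto
    finally show "sqrt (e n) < 1 - s" by simp
  qed
  have "(\<lambda>n. (1 - s) / real (n + 2)) \<longlonglongrightarrow> 0"
    using LIMSEQ_ignore_initial_segment[OF lim_const_over_n[of "1 - s"], of 2] by simp
  then have e0: "e \<longlonglongrightarrow> 0" unfolding e_def by (rule tendsto_null_power) simp
  define \<phi> where "\<phi> = (\<lambda>n. conv (e n) U)"
  define \<gamma> where "\<gamma> = (\<lambda>n x. \<Sum>b\<in>Basis. conv (e n) (\<lambda>y. g y \<bullet> b) x *\<^sub>R b)"
  have \<gamma>b: "\<gamma> n x \<bullet> b = conv (e n) (\<lambda>y. g y \<bullet> b) x" if "b \<in> Basis" for n x b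
    using that by (simp add: \<gamma>_def inner_sum_left_Basis)
  have der: "(\<phi> n has_derivative (\<lambda>v. \<gamma> n x \<bullet> v)) (at x)" if x: "x \<in> cball 0 s" for n x
  proof -
    define D where "D = (\<lambda>v. (LBINT y. U y * (bump_grad (e n) (x - y) \<bullet> v)) / (LBINT z. bump (e n) (z::'a)))"
    have D: "(\<phi> n has_derivative D) (at x)" unfolding \<phi>_def D_def by (rule conv_has_derivative[OF Ui])
    have tf: "(\<lambda>y. bump (e n) (x - y)) \<in> test_functions"
      using x s e[of n] by (intro bump_test_function) auto
    \<comment> \<open>Two signs cancel: the one in the weak identity and the one from
      differentiating x - y in y.\<close>
    have Db: "D b = \<gamma> n x \<bullet> b" if b: "b \<in> Basis" for b
      using weak[OF tf b] by (simp add: D_def \<gamma>b[OF b] conv_def bump_translate_derivative)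
    have "D v = \<gamma> n x \<bullet> v" for v
    proof -
      interpret D: linear D using has_derivative_linear[OF D] .
      have "D v = D (\<Sum>b\<in>Basis. (v \<bullet> b) *\<^sub>R b)" by (simp add: euclidean_representation)
      also have "\<dots> = (\<Sum>b\<in>Basis. (v \<bullet> b) * (\<gamma> n x \<bullet> b))" by (simp add: D.sum D.scale Db)
      also have "\<dots> = \<gamma> n x \<bullet> v" by (subst (3) euclidean_inner) (simp add: mult.commute)
      finally show ?thesis .
    qed
    then have "D = (\<lambda>v. \<gamma> n x \<bullet> v)" by auto
    with D show ?thesis by simp
  qed
  have cont: "continuous_on S (\<gamma> n)" for n S
    unfolding \<gamma>_def by (intro continuous_intros continuous_conv gi)
  have lim: "l2lim lborel (\<lambda>n x. indicator (ball 0 s) x * conv (e n) f x) (\<lambda>x. indicator (ball 0 s) x * f x)"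
    if [measurable]: "f \<in> borel_measurable borel" and f0: "\<And>x. x \<notin> ball 0 1 \<Longrightarrow> f x = 0"
      and f2: "integrable lborel (\<lambda>x. (f x)\<^sup>2)" for f :: "'a \<Rightarrow> real"
  proof -
    have fi: "integrable lborel f"
      by (rule integrable_of_square_integrable[OF _ _ f2, of "ball 0 1"]) (use f0 in auto)
    have [measurable]: "conv (e n) f \<in> borel_measurable borel" for n by (rule borel_conv[OF fi])
    have ind: "integrable lborel (\<lambda>x. (indicator (ball 0 r) x * h x)\<^sup>2)"
      if "integrable lborel (\<lambda>x. (h x)\<^sup>2)" and [measurable]: "h \<in> borel_measurable borel" for h :: "'a \<Rightarrow> real" and r
      by (rule Bochner_Integration.integrable_bound[OF that(1)]) (auto simp: indicator_def)
    have dif: "integrable lborel (\<lambda>x. (conv (e n) f x - f x)\<^sup>2)" for n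
      by (rule square_integrable_diff) (use conv_L2_contraction(1)[OF e(1) fi f2] f2 in auto)
    have "(\<lambda>n. LBINT x. indicator (ball 0 1) x * (conv (e n) f x - f x)\<^sup>2) \<longlonglongrightarrow> 0"
    proof (rule order_tendstoI)
      fix a :: real assume "a < 0"
      then show "\<forall>\<^sub>F n in sequentially. a < (LBINT x. indicator (ball 0 1) x * (conv (e n) f x - f x)\<^sup>2)"
        by (intro always_eventually allI less_le_trans[OF _ Bochner_Integration.integral_nonneg]) auto
    next
      fix a :: real assume "0 < a"
      from conv_L2_converges[OF _ f0 f2 this] obtain \<delta> where "0 < \<delta>" and \<delta>: "\<And>e. 0 < e \<and> e < \<delta> \<Longrightarrow>
        (LBINT x. indicator (ball 0 1) x * (conv e f x - f x)\<^sup>2) < a" by auto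
      from order_tendstoD(2)[OF e0 \<open>0 < \<delta>\<close>]
      show "\<forall>\<^sub>F n in sequentially. (LBINT x. indicator (ball 0 1) x * (conv (e n) f x - f x)\<^sup>2) < a"
        by eventually_elim (use \<delta> e(1) in auto)
    qed
    then have "(\<lambda>n. LBINT x. (indicator (ball 0 s) x * conv (e n) f x - indicator (ball 0 s) x * f x)\<^sup>2) \<longlonglongrightarrow> 0"
    proof (rule tendsto_sandwich[OF _ _ tendsto_const, rotated 2])
      have "(LBINT x. (indicator (ball 0 s) x * conv (e n) f x - indicator (ball 0 s) x * f x)\<^sup>2)
        \<le> (LBINT x. indicator (ball 0 1) x * (conv (e n) f x - f x)\<^sup>2)" for n
      proof (rule integral_mono')
        show "integrable lborel (\<lambda>x. indicator (ball 0 1) x * (conv (e n) f x - f x)\<^sup>2)"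
          by (rule back_subst[of "integrable lborel", OF ind[OF dif]]) (auto simp: indicator_def)
      qed (use s in \<open>auto simp: indicator_def\<close>)
      then show "\<forall>\<^sub>F n in sequentially. (LBINT x. (indicator (ball 0 s) x * conv (e n) f x - indicator (ball 0 s) x * f x)\<^sup>2)
        \<le> (LBINT x. indicator (ball 0 1) x * (conv (e n) f x - f x)\<^sup>2)" by simp
    qed auto
    moreover have "(\<lambda>x. indicator (ball 0 s) x * h x) \<in> borel_measurable lborel"
      if "h \<in> borel_measurable borel" for h :: "'a \<Rightarrow> real"
      using that by (intro borel_measurable_times borel_measurable_indicator) auto
    ultimately show ?thesis
      unfolding l2lim_def using ind[OF f2] ind[OF conv_L2_contraction(1)[OF e(1) fi f2]] by auto
  qed
  show "\<exists>\<phi> \<gamma>. C1_approx s U g \<phi> \<gamma>"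
    unfolding C1_approx_def
  proof (intro exI conjI allI ballI)
    show "l2lim lborel (\<lambda>n x. indicator (ball 0 s) x * \<phi> n x) (\<lambda>x. indicator (ball 0 s) x * U x)"
      unfolding \<phi>_def by (rule lim) (use U0 U2 in auto)
    show "l2lim lborel (\<lambda>n x. indicator (ball 0 s) x * (\<gamma> n x \<bullet> b)) (\<lambda>x. indicator (ball 0 s) x * (g x \<bullet> b))"
      if "b \<in> Basis" for b
      unfolding \<gamma>b[OF that] by (rule lim) (use gb0 g2[OF that] in auto)
  qed (use der cont in auto)
qed

section \<open>Radial integration by parts\<close>

lemma integral_lborel_dilation:
  fixes F :: "'a::euclidean_space \<Rightarrow> real"
  assumes [measurable]: "F \<in> borel_measurable borel" and t: "0 < t"
  shows "t ^ DIM('a) * (LBINT x. F (t *\<^sub>R x)) = (LBINT x. F x)"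
    and "integrable lborel F \<Longrightarrow> integrable lborel (\<lambda>x. F (t *\<^sub>R x))"
proof -
  have *: "(lborel :: 'a measure) = density (distr lborel borel (\<lambda>x. t *\<^sub>R x)) (\<lambda>_. ennreal (t ^ DIM('a)))"
    using lborel_affine[of t 0] t by simp
  have "(LBINT x. F x) = (\<integral>x. t ^ DIM('a) *\<^sub>R F x \<partial>distr lborel borel (\<lambda>x. t *\<^sub>R x))"
    by (subst *, subst integral_density) (use t in auto)
  also have "\<dots> = (LBINT x. t ^ DIM('a) *\<^sub>R F (t *\<^sub>R x))"
    by (subst integral_distr) auto
  finally show "t ^ DIM('a) * (LBINT x. F (t *\<^sub>R x)) = (LBINT x. F x)" by simp
  assume "integrable lborel F"
  then have "integrable (distr lborel borel (\<lambda>x::'a. t *\<^sub>R x)) (\<lambda>x. t ^ DIM('a) *\<^sub>R F x)"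
    by (subst (asm) *, subst (asm) integrable_density) (use t in auto)
  then have "integrable lborel (\<lambda>x. t ^ DIM('a) * F (t *\<^sub>R x))"
    by (subst (asm) integrable_distr_eq) auto
  then show "integrable lborel (\<lambda>x. F (t *\<^sub>R x))" using t by simp
qed

text \<open>The chord of the convex function \<open>(1 + h) ^ n\<close> over [0, 1]; it bounds the
  growth of the Jacobian factor of a dilation linearly in h.\<close>

lemma power_one_plus_le:
  assumes "0 \<le> h" "h \<le> (1::real)"
  shows "(1 + h) ^ n \<le> 1 + h * (2 ^ n - 1)"
proof (induction n)
  case (Suc n)
  have "(1 + h) ^ Suc n \<le> (1 + h) * (1 + h * (2 ^ n - 1))"
    using mult_left_mono[OF Suc, of "1 + h"] assms by simp
  moreover have "h * (h * (2 ^ n - 1)) \<le> 1 * (h * (2 ^ n - 1))"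
    using assms by (intro mult_right_mono mult_nonneg_nonneg) auto
  ultimately show ?case by (simp add: algebra_simps)
qed simp

text \<open>Differentiate the constant function \<open>t \<mapsto> \<integral> t\<^sup>N F (t x) dx\<close> at \<open>t = 1\<close>; the radial derivative
  \<open>F' x\<close> stands for the derivative of \<open>t \<mapsto> F (t x)\<close>.\<close>
lemma integral_radial_divergence:
  fixes F F' :: "'a::euclidean_space \<Rightarrow> real"
  assumes [measurable]: "F \<in> borel_measurable borel" "F' \<in> borel_measurable borel"
    and zero: "\<And>x. s \<le> norm x \<Longrightarrow> F x = 0"
    and bounds: "\<And>x. \<bar>F x\<bar> \<le> C" "\<And>x. \<bar>F' x\<bar> \<le> C"
    and deriv: "\<And>x. x \<noteq> 0 \<Longrightarrow> ((\<lambda>t. F (t *\<^sub>R x)) has_real_derivative F' x) (at 1)"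
  shows "(LBINT x. real DIM('a) * F x + F' x) = 0"
proof -
  define h where "h = (\<lambda>n. 1 / real (Suc n))"
  have h: "0 < h n" "h n \<le> 1" for n by (simp_all add: h_def)
  have h_lim: "filterlim h (at 0) sequentially"
    unfolding filterlim_at using h(1) lim_1_over_n[THEN LIMSEQ_Suc] by (auto simp: h_def)
  define Q where "Q = (\<lambda>n x. ((1 + h n) ^ DIM('a) * F ((1 + h n) *\<^sub>R x) - F x) / h n)"
  have C: "0 \<le> C" using bounds(1)[of 0] by linarith
  have Fi: "integrable lborel F"
    by (rule integrable_bounded_support[of _ "cball 0 \<bar>s\<bar>" C]) (use zero bounds in auto)
  \<comment> \<open>By the change of variables every difference quotient already has integral
    0.\<close>
  have Q0: "(LBINT x. Q n x) = 0" for n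
  proof -
    have t: "0 < 1 + h n" using h(1)[of n] by simp
    show ?thesis
      using integral_lborel_dilation[OF _ t, of F] Fi by (simp add: Q_def)
  qed
  have "(\<lambda>n. LBINT x. Q n x) \<longlonglongrightarrow> (LBINT x. real DIM('a) * F x + F' x)"
  proof (rule integral_dominated_convergence[where w = "\<lambda>x. indicator (cball 0 \<bar>s\<bar>) x * (2 ^ DIM('a) * C + C)"])
    have ae: "AE x::'a in lborel. x \<noteq> 0" by (rule AE_lborel_singleton)
    show "AE x in lborel. (\<lambda>n. Q n x) \<longlonglongrightarrow> real DIM('a) * F x + F' x"
      using ae
    proof eventually_elim
      fix x :: 'a assume x: "x \<noteq> 0"
      have "((\<lambda>t. t ^ DIM('a) * F (t *\<^sub>R x)) has_real_derivative (real DIM('a) * F x + F' x)) (at 1)"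
        by (rule derivative_eq_intros deriv[OF x] refl | simp)+
      then have "((\<lambda>h. ((1 + h) ^ DIM('a) * F ((1 + h) *\<^sub>R x) - F x) / h) \<longlongrightarrow> real DIM('a) * F x + F' x) (at 0)"
        by (simp add: DERIV_def)
      from filterlim_compose[OF this h_lim] show "(\<lambda>n. Q n x) \<longlonglongrightarrow> real DIM('a) * F x + F' x"
        by (simp add: Q_def)
    qed
    show "AE x in lborel. norm (Q n x) \<le> indicator (cball 0 \<bar>s\<bar>) x * (2 ^ DIM('a) * C + C)" for n
      using ae
    proof eventually_elim
      fix x :: 'a assume x: "x \<noteq> 0"
      show "norm (Q n x) \<le> indicator (cball 0 \<bar>s\<bar>) x * (2 ^ DIM('a) * C + C)"
      proof (cases "x \<in> cball 0 \<bar>s\<bar>")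
        case False
        then have "s \<le> norm x" by simp
        moreover from this have "s \<le> norm ((1 + h n) *\<^sub>R x)"
          using h(1)[of n] mult_right_mono[of 1 "1 + h n" "norm x"] by simp
        ultimately show ?thesis using zero C by (auto simp: Q_def indicator_def)
      next
        case True
        define t where "t = 1 + h n"
        have t: "1 < t" using h(1)[of n] by (simp add: t_def)
        \<comment> \<open>\<open>deriv\<close> speaks of the parameter value 1 only. Applied at
          \<open>\<tau> x\<close> and with the parameter rescaled it gives the factor
          \<open>1 / \<tau>\<close>, and so the derivative on the whole range of the mean value
          theorem.\<close>
        have d: "((\<lambda>t. F (t *\<^sub>R x)) has_real_derivative F' (\<tau> *\<^sub>R x) / \<tau>) (at \<tau>)" if "1 \<le> \<tau>" for \<tau>
        proof -
          have "((\<lambda>t. F (t *\<^sub>R \<tau> *\<^sub>R x)) has_real_derivative F' (\<tau> *\<^sub>R x)) (at (\<tau> / \<tau>))"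
            using deriv[of "\<tau> *\<^sub>R x"] x that by simp
          from DERIV_chain2[OF this DERIV_cdivide[OF DERIV_ident]]
          show ?thesis using that by simp
        qed
        obtain z where z: "1 < z" "F (t *\<^sub>R x) - F (1 *\<^sub>R x) = (t - 1) * (F' (z *\<^sub>R x) / z)"
          using MVT2[OF t, of "\<lambda>t. F (t *\<^sub>R x)" "\<lambda>\<tau>. F' (\<tau> *\<^sub>R x) / \<tau>"] d by auto
        have "\<bar>F' (z *\<^sub>R x) / z\<bar> \<le> C"
        proof -
          have "\<bar>F' (z *\<^sub>R x)\<bar> / z \<le> C / 1" using z(1) bounds(2) C by (intro frac_le) auto
          then show ?thesis using z(1) by simp
        qed
        then have "\<bar>F (t *\<^sub>R x) - F x\<bar> \<le> h n * C"
          using mult_left_mono[of "\<bar>F' (z *\<^sub>R x) / z\<bar>" C "h n"] h(1)[of n]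
          unfolding z(2)[unfolded scaleR_one] by (simp add: t_def abs_mult)
        moreover have "\<bar>(t ^ DIM('a) - 1) * F (t *\<^sub>R x)\<bar> \<le> (h n * 2 ^ DIM('a)) * C"
          unfolding abs_mult
        proof (rule mult_mono)
          have "1 \<le> t ^ DIM('a)" using t by (intro one_le_power) simp
          then show "\<bar>t ^ DIM('a) - 1\<bar> \<le> h n * 2 ^ DIM('a)"
            using power_one_plus_le[of "h n" "DIM('a)"] h[of n] by (simp add: t_def right_diff_distrib)
        qed (use bounds h(1)[of n] in auto)
        moreover have "h n * Q n x = (t ^ DIM('a) - 1) * F (t *\<^sub>R x) + (F (t *\<^sub>R x) - F x)"
        proof -
          have "h n * Q n x = t ^ DIM('a) * F (t *\<^sub>R x) - F x" using h(1)[of n] by (simp add: Q_def t_def)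
          then show ?thesis by (simp add: left_diff_distrib)
        qed
        ultimately have "\<bar>h n * Q n x\<bar> \<le> h n * (2 ^ DIM('a) * C + C)"
          by (simp add: algebra_simps abs_le_iff)
        then show ?thesis using True h(1)[of n] by (simp add: abs_mult)
      qed
    qed
    show "integrable lborel (\<lambda>x::'a. indicator (cball 0 \<bar>s\<bar>) x * (2 ^ DIM('a) * C + C))"
      using emeasure_lborel_finite[of "cball (0::'a) \<bar>s\<bar>"] by auto
  qed (auto simp: Q_def)
  then show ?thesis by (simp add: Q0 LIMSEQ_const_iff)
qed

lemma continuous_on_cball_bounded:
  fixes f :: "'a::euclidean_space \<Rightarrow> 'b::real_normed_vector"
  assumes "continuous_on (cball 0 s) f"
  obtains B where "\<And>x. x \<in> cball 0 s \<Longrightarrow> norm (f x) \<le> B"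
proof -
  have "bounded (f ` cball 0 s)"
    by (intro compact_imp_bounded compact_continuous_image assms compact_cball)
  then obtain B where "\<forall>y\<in>f ` cball 0 s. norm y \<le> B" unfolding bounded_iff by blast
  then show ?thesis using that by blast
qed

text \<open>The radial divergence identity for the field
  \<open>\<phi>\<^sup>2 \<kappa> (norm x) x\<close>. As \<open>\<kappa>\<close> vanishes from s0 < s
  on, no boundary term arises. Differentiability is asked for r > 0, and of the derivative only
  \<open>r * \<kappa>' r\<close> has to be bounded, because one intended \<open>\<kappa>\<close>
  contains \<open>rad r / r\<close>, whose value at 0 is set by division by zero.\<close>

lemma C1_radial_ibp:
  fixes \<phi> :: "'a::euclidean_space \<Rightarrow> real" and \<gamma> :: "'a \<Rightarrow> 'a" and \<kappa> \<kappa>' :: "real \<Rightarrow> real"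
  assumes der: "\<And>x. x \<in> cball 0 s \<Longrightarrow> (\<phi> has_derivative (\<lambda>v. \<gamma> x \<bullet> v)) (at x)"
    and cont: "continuous_on (cball 0 s) \<gamma>" and s: "0 < s0" "s0 < s"
    and [measurable]: "\<kappa> \<in> borel_measurable borel" "\<kappa>' \<in> borel_measurable borel"
    and \<kappa>: "\<And>r. 0 < r \<Longrightarrow> (\<kappa> has_real_derivative \<kappa>' r) (at r)"
    and \<kappa>0: "\<And>r. s0 \<le> r \<Longrightarrow> \<kappa> r = 0 \<and> \<kappa>' r = 0"
    and bounds: "\<And>r. \<bar>\<kappa> r\<bar> \<le> C" "\<And>r. 0 \<le> r \<Longrightarrow> \<bar>r * \<kappa>' r\<bar> \<le> C"
  shows "(LBINT x. indicator (ball 0 s) x * ((\<phi> x)\<^sup>2 * (real DIM('a) * \<kappa> (norm x) + norm x * \<kappa>' (norm x))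
     + 2 * \<kappa> (norm x) * (\<phi> x * (\<gamma> x \<bullet> x)))) = 0"
proof -
  have cont\<phi>: "continuous_on (cball 0 s) \<phi>"
    by (intro continuous_at_imp_continuous_on ballI has_derivative_continuous[OF der])
  have [measurable]: "(\<lambda>x. indicator (ball 0 s) x *\<^sub>R \<phi> x) \<in> borel_measurable borel"
    "(\<lambda>x. indicator (ball 0 s) x *\<^sub>R \<gamma> x) \<in> borel_measurable borel"
    by (intro borel_measurable_continuous_on_indicator continuous_on_subset[OF cont\<phi>] continuous_on_subset[OF cont]; auto)+
  obtain B where B: "\<And>x. x \<in> cball 0 s \<Longrightarrow> \<bar>\<phi> x\<bar> \<le> B"
    using continuous_on_cball_bounded[OF cont\<phi>] by auto
  obtain D where D: "\<And>x. x \<in> cball 0 s \<Longrightarrow> norm (\<gamma> x) \<le> D"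
    using continuous_on_cball_bounded[OF cont] by auto
  have C: "0 \<le> C" using bounds(1)[of 0] by linarith
  have BD: "0 \<le> B" "0 \<le> D" using B[of 0] D[of 0] s by (auto intro: order_trans[OF norm_ge_zero] order_trans[OF abs_ge_zero])
  define F where "F = (\<lambda>x. (indicator (ball 0 s) x *\<^sub>R \<phi> x)\<^sup>2 * \<kappa> (norm x))"
  define F' where "F' = (\<lambda>x. (indicator (ball 0 s) x *\<^sub>R \<phi> x)\<^sup>2 * (norm x * \<kappa>' (norm x))
     + 2 * \<kappa> (norm x) * ((indicator (ball 0 s) x *\<^sub>R \<phi> x) * ((indicator (ball 0 s) x *\<^sub>R \<gamma> x) \<bullet> x)))"
  define K where "K = B\<^sup>2 * C + 2 * C * (B * (D * s))"
  have K: "0 \<le> B\<^sup>2 * C" "0 \<le> 2 * C * (B * (D * s))" using C BD s by auto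
  have "(LBINT x. real DIM('a) * F x + F' x) = 0"
  proof (rule integral_radial_divergence[where C = K and s = s0])
    show "F \<in> borel_measurable borel" "F' \<in> borel_measurable borel"
      unfolding F_def F'_def by measurable
    show "F x = 0" if "s0 \<le> norm x" for x using \<kappa>0[OF that] by (simp add: F_def)
    have \<phi>2: "(\<phi> x)\<^sup>2 \<le> B\<^sup>2" if "x \<in> cball 0 s" for x using B[OF that] by (simp add: abs_le_square_iff[symmetric])
    show "\<bar>F x\<bar> \<le> K" for x
    proof (cases "x \<in> ball 0 s")
      case True
      then have "\<bar>(\<phi> x)\<^sup>2 * \<kappa> (norm x)\<bar> \<le> B\<^sup>2 * C"
        unfolding abs_mult using \<phi>2[of x] bounds(1)[of "norm x"] by (intro mult_mono) auto
      moreover have "F x = (\<phi> x)\<^sup>2 * \<kappa> (norm x)" using True by (simp add: F_def)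
      ultimately show ?thesis using K(2) unfolding K_def by linarith
    qed (use K in \<open>simp add: F_def K_def\<close>)
    show "\<bar>F' x\<bar> \<le> K" for x
    proof (cases "x \<in> ball 0 s")
      case True
      then have x: "x \<in> cball 0 s" "norm x \<le> s" by auto
      have "\<bar>(\<phi> x)\<^sup>2 * (norm x * \<kappa>' (norm x))\<bar> \<le> B\<^sup>2 * C"
        unfolding abs_mult[of "(\<phi> x)\<^sup>2"] using \<phi>2[OF x(1)] bounds(2)[of "norm x"] by (intro mult_mono) auto
      moreover have "\<bar>\<gamma> x \<bullet> x\<bar> \<le> D * s"
        using Cauchy_Schwarz_ineq2[of "\<gamma> x" x] mult_mono[OF D[OF x(1)] x(2)] BD by auto
      then have "\<bar>2 * \<kappa> (norm x) * (\<phi> x * (\<gamma> x \<bullet> x))\<bar> \<le> 2 * C * (B * (D * s))"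
        unfolding abs_mult using B[OF x(1)] bounds(1)[of "norm x"] BD C s by (intro mult_mono) auto
      ultimately show ?thesis using True by (simp add: F'_def K_def)
    qed (use K in \<open>simp add: F'_def K_def\<close>)
    show "((\<lambda>t. F (t *\<^sub>R x)) has_real_derivative F' x) (at 1)" if x: "x \<noteq> 0" for x
    proof (cases "norm x < s")
      case True
      have d\<phi>: "((\<lambda>t. \<phi> (t *\<^sub>R x)) has_real_derivative \<gamma> x \<bullet> x) (at 1)"
      proof -
        have "((\<lambda>t. t *\<^sub>R x) has_derivative (\<lambda>h. h *\<^sub>R x)) (at 1)" by (auto intro!: derivative_eq_intros)
        moreover have "(\<phi> has_derivative (\<lambda>v. \<gamma> x \<bullet> v)) (at (1 *\<^sub>R x))" using der[of x] True by simp
        ultimately have "((\<lambda>t. \<phi> (t *\<^sub>R x)) has_derivative (\<lambda>h. \<gamma> x \<bullet> h *\<^sub>R x)) (at 1)"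
          by (rule has_derivative_compose)
        then show ?thesis by (rule has_derivative_imp_has_field_derivative) (simp add: mult.commute)
      qed
      have d\<kappa>: "((\<lambda>t. \<kappa> (t * norm x)) has_real_derivative \<kappa>' (norm x) * norm x) (at 1)"
      proof -
        have "(\<kappa> has_real_derivative \<kappa>' (norm x)) (at (1 * norm x))" using \<kappa>[of "norm x"] x by simp
        from DERIV_chain2[OF this DERIV_cmult_right[OF DERIV_ident]] show ?thesis by simp
      qed
      have "((\<lambda>t. (\<phi> (t *\<^sub>R x))\<^sup>2 * \<kappa> (t * norm x)) has_real_derivative F' x) (at 1)"
        using True by (auto intro!: derivative_eq_intros d\<phi> d\<kappa> simp: F'_def algebra_simps power2_eq_square)
      then show ?thesis
      proof (rule has_field_derivative_transform_within_open[where S = "{0<..<s / norm x}"])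
        show "1 \<in> {0<..<s / norm x}" using True x by simp
        fix t assume "t \<in> {0<..<s / norm x}"
        then have t: "0 < t" "t * norm x < s" using x by (auto simp: pos_less_divide_eq)
        then show "(\<phi> (t *\<^sub>R x))\<^sup>2 * \<kappa> (t * norm x) = F (t *\<^sub>R x)" by (simp add: F_def)
      qed simp
    next
      case False
      \<comment> \<open>Here \<open>norm x \<ge> s\<close>, so the indicator makes
        \<open>F' x\<close> zero, and the gap between s0 and s makes \<open>F\<close> vanish along
        the ray near the parameter value 1.\<close>
      have "((\<lambda>t. 0) has_real_derivative F' x) (at 1)" using False by (simp add: F'_def)
      then show ?thesis
      proof (rule has_field_derivative_transform_within_open[where S = "{s0 / norm x<..}"])
        show "1 \<in> {s0 / norm x<..}" using False x s by simp
        fix t assume "t \<in> {s0 / norm x<..}"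
        then have t: "s0 < t * norm x" using x by (auto simp: pos_divide_less_eq)
        then have "0 < t * norm x" using s by linarith
        then have "0 < t" by (rule zero_less_mult_pos2) (use x in simp)
        then show "0 = F (t *\<^sub>R x)" using t \<kappa>0[of "t * norm x"] by (simp add: F_def)
      qed simp
    qed
  qed
  moreover have "real DIM('a) * F x + F' x = indicator (ball 0 s) x * ((\<phi> x)\<^sup>2 * (real DIM('a) * \<kappa> (norm x) + norm x * \<kappa>' (norm x))
     + 2 * \<kappa> (norm x) * (\<phi> x * (\<gamma> x \<bullet> x)))" for x
    by (simp add: F_def F'_def indicator_def algebra_simps)
  ultimately show ?thesis by simp
qed

text \<open>Limit of the C1 identity. Both integrands are products of two factors converging in L2:
  the function itself, and either a bounded multiple of it or a sum of bounded multiples of the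
  gradient components.\<close>

lemma W1_radial_ibp:
  fixes p :: "'a::euclidean_space \<Rightarrow> real" and g :: "'a \<Rightarrow> 'a" and \<kappa> \<kappa>' :: "real \<Rightarrow> real"
  assumes W: "W1 p g" and s0: "0 < s0" "s0 < 1"
    and [measurable]: "\<kappa> \<in> borel_measurable borel" "\<kappa>' \<in> borel_measurable borel"
    and \<kappa>: "\<And>r. 0 < r \<Longrightarrow> (\<kappa> has_real_derivative \<kappa>' r) (at r)"
    and \<kappa>0: "\<And>r. s0 \<le> r \<Longrightarrow> \<kappa> r = 0 \<and> \<kappa>' r = 0"
    and bounds: "\<And>r. \<bar>\<kappa> r\<bar> \<le> C" "\<And>r. 0 \<le> r \<Longrightarrow> \<bar>r * \<kappa>' r\<bar> \<le> C"
  shows "integrable lborel (\<lambda>x. (p x)\<^sup>2 * (real DIM('a) * \<kappa> (norm x) + norm x * \<kappa>' (norm x)))"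
    and "integrable lborel (\<lambda>x. 2 * \<kappa> (norm x) * (p x * (g x \<bullet> x)))"
    and "(LBINT x. (p x)\<^sup>2 * (real DIM('a) * \<kappa> (norm x) + norm x * \<kappa>' (norm x)))
      + (LBINT x. 2 * \<kappa> (norm x) * (p x * (g x \<bullet> x))) = 0"
proof -
  \<comment> \<open>Strictly between s0 and 1: \<open>\<kappa>\<close> vanishes outside
    \<open>ball 0 s\<close>, so the indicators of the approximation disappear from the
    result.\<close>
  define s where "s = (s0 + 1) / 2"
  have s: "0 < s" "s < 1" "s0 < s" using s0 by (auto simp: s_def)
  obtain \<phi> \<gamma> where approx: "C1_approx s p g \<phi> \<gamma>"
    using W s(1,2) unfolding W1_def by blast
  note der = C1_approxD(1)[OF approx] and cont = C1_approxD(2)[OF approx]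
    and lim\<phi> = C1_approxD(3)[OF approx] and lim\<gamma> = C1_approxD(4)[OF approx]
  define a where "a = (\<lambda>x::'a. real DIM('a) * \<kappa> (norm x) + norm x * \<kappa>' (norm x))"
  have [measurable]: "a \<in> borel_measurable borel" unfolding a_def by measurable
  have ab: "\<bar>a x\<bar> \<le> real DIM('a) * C + C" for x
  proof -
    have "\<bar>real DIM('a) * \<kappa> (norm x)\<bar> \<le> real DIM('a) * C"
      unfolding abs_mult using bounds(1) by (intro mult_mono) auto
    moreover have "\<bar>norm x * \<kappa>' (norm x)\<bar> \<le> C" using bounds(2) by simp
    ultimately show ?thesis unfolding a_def by linarith
  qed
  have cb: "\<bar>2 * \<kappa> (norm x) * (x \<bullet> b)\<bar> \<le> 2 * C" if "b \<in> Basis" for x b :: 'a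
  proof (cases "norm x \<le> 1")
    case True
    then have "\<bar>x \<bullet> b\<bar> \<le> 1" using Basis_le_norm[OF that, of x] by linarith
    then have "\<bar>2 * \<kappa> (norm x)\<bar> * \<bar>x \<bullet> b\<bar> \<le> 2 * C * 1"
      using bounds(1)[of "norm x"] by (intro mult_mono) auto
    then show ?thesis by (simp add: abs_mult)
  next
    case False
    then show ?thesis using \<kappa>0[of "norm x"] s0 bounds(1)[of 0] by simp
  qed
  define P where "P = (\<lambda>n x. indicator (ball 0 s) x * \<phi> n x)"
  define A where "A = (\<lambda>n x. a x * (indicator (ball 0 s) x * \<phi> n x))"
  define B where "B = (\<lambda>n x. \<Sum>b\<in>Basis. (2 * \<kappa> (norm x) * (x \<bullet> b)) * (indicator (ball 0 s) x * (\<gamma> n x \<bullet> b)))"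
  define P0 where "P0 = (\<lambda>x. indicator (ball 0 s) x * p x)"
  define A0 where "A0 = (\<lambda>x. a x * (indicator (ball 0 s) x * p x))"
  define B0 where "B0 = (\<lambda>x. \<Sum>b\<in>Basis. (2 * \<kappa> (norm x) * (x \<bullet> b)) * (indicator (ball 0 s) x * (g x \<bullet> b)))"
  have lP: "l2lim lborel P P0" unfolding P_def P0_def by (rule lim\<phi>)
  have lA: "l2lim lborel A A0"
    unfolding A_def A0_def by (rule l2lim_mult[OF lim\<phi>]) (use ab in auto)
  have lB: "l2lim lborel B B0"
    unfolding B_def B0_def by (intro l2lim_sum finite_Basis l2lim_mult[OF lim\<gamma>]) (use cb in auto)
  have B_eq: "(\<Sum>b\<in>Basis. (2 * \<kappa> (norm x) * (x \<bullet> b)) * (indicator (ball 0 s) x * (v \<bullet> b)))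
      = indicator (ball 0 s) x * (2 * \<kappa> (norm x) * (v \<bullet> x))" for x v :: 'a
    by (subst euclidean_inner[of v x]) (simp add: sum_distrib_left mult_ac)
  have zero: "(LBINT x. P n x * A n x) + (LBINT x. P n x * B n x) = 0" for n
  proof -
    have i: "integrable lborel (\<lambda>x. P n x * A n x)" "integrable lborel (\<lambda>x. P n x * B n x)"
      by (rule square_integrable_mult; use l2limD[OF lP] l2limD[OF lA] l2limD[OF lB] in auto)+
    have "P n x * A n x + P n x * B n x = indicator (ball 0 s) x * ((\<phi> n x)\<^sup>2 * (real DIM('a) * \<kappa> (norm x) + norm x * \<kappa>' (norm x))
     + 2 * \<kappa> (norm x) * (\<phi> n x * (\<gamma> n x \<bullet> x)))" for x
      unfolding P_def A_def B_def B_eq a_def by (simp add: indicator_def power2_eq_square algebra_simps)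
    then have "(LBINT x. P n x * A n x + P n x * B n x) = 0"
      using C1_radial_ibp[OF der cont s0(1) s(3) _ _ \<kappa> \<kappa>0 bounds] by simp
    then show ?thesis using i by simp
  qed
  have "(\<lambda>n. (LBINT x. P n x * A n x) + (LBINT x. P n x * B n x)) \<longlonglongrightarrow>
      (LBINT x. P0 x * A0 x) + (LBINT x. P0 x * B0 x)"
    by (intro tendsto_add l2lim_integral_mult lP lA lB)
  then have main: "(LBINT x. P0 x * A0 x) + (LBINT x. P0 x * B0 x) = 0"
    by (simp add: zero LIMSEQ_const_iff)
  have k0: "\<kappa> (norm x) = 0" "\<kappa>' (norm x) = 0" if "x \<notin> ball 0 s" for x :: 'a
    using \<kappa>0[of "norm x"] that s by auto
  have PA: "P0 x * A0 x = (p x)\<^sup>2 * (real DIM('a) * \<kappa> (norm x) + norm x * \<kappa>' (norm x))" for x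
    using k0[of x] by (cases "x \<in> ball 0 s") (auto simp: P0_def A0_def a_def power2_eq_square)
  have PB: "P0 x * B0 x = 2 * \<kappa> (norm x) * (p x * (g x \<bullet> x))" for x
    unfolding B0_def B_eq using k0[of x] by (cases "x \<in> ball 0 s") (auto simp: P0_def)
  have "integrable lborel (\<lambda>x. P0 x * A0 x)" "integrable lborel (\<lambda>x. P0 x * B0 x)"
    by (rule square_integrable_mult; use l2limD[OF lP] l2limD[OF lA] l2limD[OF lB] in auto)+
  then show "integrable lborel (\<lambda>x. (p x)\<^sup>2 * (real DIM('a) * \<kappa> (norm x) + norm x * \<kappa>' (norm x)))"
    "integrable lborel (\<lambda>x. 2 * \<kappa> (norm x) * (p x * (g x \<bullet> x)))"
    by (simp_all add: PA PB)
  show "(LBINT x. (p x)\<^sup>2 * (real DIM('a) * \<kappa> (norm x) + norm x * \<kappa>' (norm x)))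
      + (LBINT x. 2 * \<kappa> (norm x) * (p x * (g x \<bullet> x))) = 0"
    using main by (simp add: PA PB)
qed

text \<open>Product rule for the approximating functions. Since only balls of radius s < 1 matter, m
  and its gradient are bounded there by compactness; at the unit sphere they may blow up, as the
  reciprocal of the Gaussian does.\<close>

lemma W1_mult:
  fixes p m :: "'a::euclidean_space \<Rightarrow> real" and g m' :: "'a \<Rightarrow> 'a"
  assumes W: "W1 p g"
    and m: "\<And>x. x \<in> ball 0 1 \<Longrightarrow> (m has_derivative (\<lambda>v. m' x \<bullet> v)) (at x)"
    and m': "continuous_on (ball 0 1) m'"
  shows "W1 (\<lambda>x. m x * p x) (\<lambda>x. m x *\<^sub>R g x + p x *\<^sub>R m' x)"
  unfolding W1_def
proof (intro allI impI)
  fix s :: real assume s: "0 < s \<and> s < 1"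
  obtain \<phi> \<gamma> where approx: "C1_approx s p g \<phi> \<gamma>"
    using W s unfolding W1_def by blast
  note der = C1_approxD(1)[OF approx] and cont = C1_approxD(2)[OF approx]
    and lim\<phi> = C1_approxD(3)[OF approx] and lim\<gamma> = C1_approxD(4)[OF approx]
  have sub: "cball 0 s \<subseteq> ball (0::'a) 1" using s by auto
  have cm: "continuous_on (cball 0 s) m"
    using sub by (intro continuous_at_imp_continuous_on ballI has_derivative_continuous[OF m]) auto
  have cm': "continuous_on (cball 0 s) m'" using m' sub by (rule continuous_on_subset)
  obtain B where B: "\<And>x. x \<in> cball 0 s \<Longrightarrow> \<bar>m x\<bar> \<le> B"
    using continuous_on_cball_bounded[OF cm] by auto
  obtain D where D: "\<And>x. x \<in> cball 0 s \<Longrightarrow> norm (m' x) \<le> D"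
    using continuous_on_cball_bounded[OF cm'] by auto
  have meas: "(\<lambda>x. indicator (ball 0 s) x *\<^sub>R m x) \<in> borel_measurable borel"
    "(\<lambda>x. indicator (ball 0 s) x *\<^sub>R m' x) \<in> borel_measurable borel"
    by (intro borel_measurable_continuous_on_indicator continuous_on_subset[OF cm] continuous_on_subset[OF cm']; auto)+
  have l1: "l2lim lborel (\<lambda>n x. (indicator (ball 0 s) x *\<^sub>R m x) * (F n x)) (\<lambda>x. (indicator (ball 0 s) x *\<^sub>R m x) * f x)"
    if "l2lim lborel F f" for F f
  proof (rule l2lim_mult[OF that, where C = "\<bar>B\<bar>"])
    fix x show "\<bar>indicator (ball 0 s) x *\<^sub>R m x\<bar> \<le> \<bar>B\<bar>"
      using B[of x] by (cases "x \<in> ball 0 s") auto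
  qed (use meas in simp)
  have l2: "l2lim lborel (\<lambda>n x. ((indicator (ball 0 s) x *\<^sub>R m' x) \<bullet> b) * (F n x)) (\<lambda>x. ((indicator (ball 0 s) x *\<^sub>R m' x) \<bullet> b) * f x)"
    if "l2lim lborel F f" "b \<in> Basis" for F f b
  proof (rule l2lim_mult[OF that(1), where C = "\<bar>D\<bar>"])
    fix x show "\<bar>(indicator (ball 0 s) x *\<^sub>R m' x) \<bullet> b\<bar> \<le> \<bar>D\<bar>"
      using D[of x] Basis_le_norm[OF that(2), of "m' x"] by (cases "x \<in> ball 0 s") auto
  next
    show "(\<lambda>x. (indicator (ball 0 s) x *\<^sub>R m' x) \<bullet> b) \<in> borel_measurable lborel"
      using meas(2) by (intro borel_measurable_inner) auto
  qed
  show "\<exists>\<phi> \<gamma>. C1_approx s (\<lambda>x. m x * p x) (\<lambda>x. m x *\<^sub>R g x + p x *\<^sub>R m' x) \<phi> \<gamma>"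
    unfolding C1_approx_def
  proof (intro exI conjI allI ballI)
    fix n
    have c\<phi>: "continuous_on (cball 0 s) (\<phi> n)"
      by (intro continuous_at_imp_continuous_on ballI has_derivative_continuous[OF der])
    show "((\<lambda>x. m x * \<phi> n x) has_derivative (\<lambda>v. (m x *\<^sub>R \<gamma> n x + \<phi> n x *\<^sub>R m' x) \<bullet> v)) (at x)"
      if "x \<in> cball 0 s" for x
      using has_derivative_mult[OF m der[OF that, of n]] that sub
      by (auto simp: inner_add_left mult.commute)
    show "continuous_on (cball 0 s) (\<lambda>x. m x *\<^sub>R \<gamma> n x + \<phi> n x *\<^sub>R m' x)"
      by (intro continuous_intros cm cm' cont c\<phi>)
  next
    show "l2lim lborel (\<lambda>n x. indicator (ball 0 s) x * (m x * \<phi> n x)) (\<lambda>x. indicator (ball 0 s) x * (m x * p x))"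
      by (rule back_subst[of "\<lambda>F. l2lim lborel F _", OF back_subst[of "l2lim lborel _", OF l1[OF lim\<phi>]]])
         (auto simp: indicator_def fun_eq_iff)
    fix b :: 'a assume b: "b \<in> Basis"
    show "l2lim lborel (\<lambda>n x. indicator (ball 0 s) x * ((m x *\<^sub>R \<gamma> n x + \<phi> n x *\<^sub>R m' x) \<bullet> b))
        (\<lambda>x. indicator (ball 0 s) x * ((m x *\<^sub>R g x + p x *\<^sub>R m' x) \<bullet> b))"
      by (rule back_subst[of "\<lambda>F. l2lim lborel F _",
            OF back_subst[of "l2lim lborel _", OF l2lim_add[OF l1[OF lim\<gamma>[OF b]] l2[OF lim\<phi> b]]]])
         (auto simp: indicator_def fun_eq_iff inner_add_left)
  qed
qed

text \<open>Used for the quotient of \<open>U\<close> by the Gaussian minus a constant; a constant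
  is square integrable on every ball, which is all that the local notion asks for.\<close>

lemma W1_diff_const:
  fixes p :: "'a::euclidean_space \<Rightarrow> real"
  assumes W: "W1 p g"
  shows "W1 (\<lambda>x. p x - c) g"
  unfolding W1_def
proof (intro allI impI)
  fix s :: real assume s: "0 < s \<and> s < 1"
  obtain \<phi> \<gamma> where approx: "C1_approx s p g \<phi> \<gamma>"
    using W s unfolding W1_def by blast
  note der = C1_approxD(1)[OF approx] and cont = C1_approxD(2)[OF approx]
    and lim\<phi> = C1_approxD(3)[OF approx] and lim\<gamma> = C1_approxD(4)[OF approx]
  have "l2lim lborel (\<lambda>n x. - c * indicator (ball 0 s) x) (\<lambda>x::'a. - c * indicator (ball 0 s) x)"
  proof (rule l2lim_const)
    show "(\<lambda>x::'a. - c * indicator (ball 0 s) x) \<in> borel_measurable lborel"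
      by (intro borel_measurable_times borel_measurable_indicator) auto
    then show "integrable lborel (\<lambda>x::'a. (- c * indicator (ball 0 s) x)\<^sup>2)"
      by (intro integrable_bounded_support[of _ "ball 0 s" "c\<^sup>2"] borel_measurable_power) auto
  qed
  note lim = l2lim_add[OF lim\<phi> this]
  show "\<exists>\<phi> \<gamma>. C1_approx s (\<lambda>x. p x - c) g \<phi> \<gamma>"
    unfolding C1_approx_def
  proof (intro exI conjI allI ballI)
    show "((\<lambda>x. \<phi> n x - c) has_derivative (\<lambda>v. \<gamma> n x \<bullet> v)) (at x)" if "x \<in> cball 0 s" for n x
      using has_derivative_diff[OF der[OF that] has_derivative_const] by simp
    show "l2lim lborel (\<lambda>n x. indicator (ball 0 s) x * (\<phi> n x - c)) (\<lambda>x. indicator (ball 0 s) x * (p x - c))"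
      by (rule back_subst[of "\<lambda>F. l2lim lborel F _", OF back_subst[of "l2lim lborel _", OF lim]])
         (auto simp: fun_eq_iff algebra_simps)
  qed (use cont lim\<gamma> in auto)
qed

section \<open>A weighted Poincare inequality\<close>

lemma nn_integral_lborel_affine_le:
  fixes \<Phi> :: "'a::euclidean_space \<Rightarrow> ennreal"
  assumes [measurable]: "\<Phi> \<in> borel_measurable borel" and c: "1 / 2 \<le> c"
  shows "(\<integral>\<^sup>+x. \<Phi> (a + c *\<^sub>R x) \<partial>lborel) \<le> ennreal (2 ^ DIM('a)) * (\<integral>\<^sup>+x. \<Phi> x \<partial>lborel)"
proof -
  let ?I = "\<integral>\<^sup>+x. \<Phi> (a + c *\<^sub>R x) \<partial>lborel"
  have *: "(lborel :: 'a measure) = density (distr lborel borel (\<lambda>x. a + c *\<^sub>R x)) (\<lambda>_. ennreal (c ^ DIM('a)))"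
    using lborel_affine[of c a] c by simp
  have "(\<integral>\<^sup>+x. \<Phi> x \<partial>lborel) = ennreal (c ^ DIM('a)) * ?I"
    by (subst *, subst nn_integral_density) (auto simp: nn_integral_distr nn_integral_cmult)
  moreover have "?I \<le> ennreal (2 ^ DIM('a)) * (ennreal (c ^ DIM('a)) * ?I)"
  proof -
    have "(1 / 2) ^ DIM('a) \<le> c ^ DIM('a)" using c by (intro power_mono) auto
    then have "1 \<le> 2 ^ DIM('a) * c ^ DIM('a)" by (simp add: power_one_over field_simps)
    then have "ennreal 1 * ?I \<le> ennreal (2 ^ DIM('a) * c ^ DIM('a)) * ?I"
      by (intro mult_right_mono ennreal_leI) auto
    then show ?thesis using c by (simp add: ennreal_mult mult.assoc)
  qed
  ultimately show ?thesis by simp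
qed

text \<open>Fundamental theorem of calculus along the segment, then Cauchy-Schwarz against the
  indicator of [0, 1]; \<open>4 * R\<^sup>2\<close> is the square of the bound 2 R on the length of
  the segment.\<close>

lemma segment_square_le:
  fixes v :: "'a::euclidean_space \<Rightarrow> real" and \<gamma> :: "'a \<Rightarrow> 'a"
  assumes der: "\<And>x. x \<in> cball 0 s \<Longrightarrow> (v has_derivative (\<lambda>u. \<gamma> x \<bullet> u)) (at x)"
    and cont: "continuous_on (cball 0 s) \<gamma>" and R: "R \<le> s" and xy: "x \<in> ball 0 R" "y \<in> ball 0 R"
  shows "ennreal ((v x - v y)\<^sup>2)
    \<le> (\<integral>\<^sup>+t. indicator {0..1} t * ennreal (4 * R\<^sup>2 * (norm (\<gamma> ((1 - t) *\<^sub>R x + t *\<^sub>R y)))\<^sup>2) \<partial>lborel)"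
proof -
  define z where "z = (\<lambda>t. (1 - t) *\<^sub>R x + t *\<^sub>R y)"
  define q where "q = (\<lambda>t. \<gamma> (z t) \<bullet> (y - x))"
  have zR: "z t \<in> ball 0 R" if "0 \<le> t" "t \<le> 1" for t
    using convexD[OF convex_ball xy, of "1 - t" t] that by (simp add: z_def)
  have sub: "ball 0 R \<subseteq> cball (0::'a) s" using R by auto
  have dz: "(z has_derivative (\<lambda>h. h *\<^sub>R (y - x))) (at t)" for t
    unfolding z_def by (auto intro!: derivative_eq_intros simp: algebra_simps)
  have dq: "((\<lambda>t. v (z t)) has_real_derivative q t) (at t)" if "0 \<le> t" "t \<le> 1" for t
  proof -
    have "(v has_derivative (\<lambda>u. \<gamma> (z t) \<bullet> u)) (at (z t))" using der zR[OF that] sub by blast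
    from has_derivative_compose[OF dz this] show ?thesis
      by (rule has_derivative_imp_has_field_derivative) (simp add: q_def mult.commute)
  qed
  have cq: "isCont q t" if "0 \<le> t" "t \<le> 1" for t
  proof -
    have "continuous_on (ball 0 R) \<gamma>" using cont sub by (rule continuous_on_subset)
    then have "isCont \<gamma> (z t)" using zR[OF that] by (simp add: continuous_on_eq_continuous_at)
    moreover have "isCont z t" using dz by (rule has_derivative_continuous)
    ultimately have "isCont (\<lambda>t. \<gamma> (z t)) t" by (rule isCont_o2[rotated])
    then show ?thesis unfolding q_def by (intro continuous_intros)
  qed
  have ftc: "has_bochner_integral lborel (\<lambda>t. q t * indicator {0..1} t) (v (z 1) - v (z 0))"
    by (rule has_bochner_integral_FTC_Icc_real) (use dq cq in auto)
  have cq2: "continuous_on {0..1} q" using cq by (intro continuous_at_imp_continuous_on) auto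
  have meas: "(\<lambda>t. q t * indicator {0..1} t) \<in> borel_measurable lborel"
    using ftc by (auto simp: has_bochner_integral_iff)
  have "set_integrable lborel {0..1} (\<lambda>t. (q t)\<^sup>2)"
    by (intro borel_integrable_atLeastAtMost' continuous_intros cq2)
  then have q2: "integrable lborel (\<lambda>t. (q t * indicator {0..1} t)\<^sup>2)"
    unfolding set_integrable_def by (rule back_subst[of "integrable lborel"]) (auto simp: indicator_def)
  have i2: "integrable lborel (\<lambda>t::real. (indicator {0..1} t :: real)\<^sup>2)"
    by (rule integrable_bounded_support[of _ "{0..1}" 1]) (auto simp: indicator_def)
  have "(v x - v y)\<^sup>2 = (LBINT t. q t * indicator {0..1} t * indicator {0..1} t)\<^sup>2"
  proof -
    have "(\<lambda>t. q t * indicator {0..1} t * indicator {0..1} t) = (\<lambda>t. q t * indicator {0..1::real} t)"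
      by (auto simp: indicator_def)
    then show ?thesis using ftc by (simp add: has_bochner_integral_iff z_def power2_commute)
  qed
  also have "\<dots> \<le> (sqrt (LBINT t. (q t * indicator {0..1} t)\<^sup>2) * sqrt (LBINT t. (indicator {0..1::real} t)\<^sup>2))\<^sup>2"
    using Cauchy_Schwarz_integral[OF meas _ q2 i2] by (intro abs_le_square_iff[THEN iffD1]) auto
  also have "(\<lambda>t::real. (indicator {0..1} t :: real)\<^sup>2) = indicator {0..1}" by (auto simp: indicator_def)
  also have "(sqrt (LBINT t. (q t * indicator {0..1} t)\<^sup>2) * sqrt (LBINT t. indicator {0..1::real} t))\<^sup>2
      = (LBINT t. (q t * indicator {0..1} t)\<^sup>2)" by simp
  finally have "ennreal ((v x - v y)\<^sup>2) \<le> ennreal (LBINT t. (q t * indicator {0..1} t)\<^sup>2)" by (rule ennreal_leI)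
  also have "\<dots> = (\<integral>\<^sup>+t. ennreal ((q t * indicator {0..1} t)\<^sup>2) \<partial>lborel)"
    using q2 by (intro nn_integral_eq_integral[symmetric]) auto
  also have "\<dots> \<le> (\<integral>\<^sup>+t. indicator {0..1} t * ennreal (4 * R\<^sup>2 * (norm (\<gamma> ((1 - t) *\<^sub>R x + t *\<^sub>R y)))\<^sup>2) \<partial>lborel)"
  proof (rule nn_integral_mono)
    fix t :: real
    have "norm (y - x) \<le> 2 * R" using xy norm_triangle_ineq4[of y x] by simp
    then have "\<bar>q t\<bar> \<le> norm (\<gamma> (z t)) * (2 * R)"
      unfolding q_def by (intro order_trans[OF Cauchy_Schwarz_ineq2] mult_left_mono) auto
    then have "(q t)\<^sup>2 \<le> (norm (\<gamma> (z t)) * (2 * R))\<^sup>2" using power_mono[of "\<bar>q t\<bar>" _ 2] by simp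
    then show "ennreal ((q t * indicator {0..1} t)\<^sup>2)
        \<le> indicator {0..1} t * ennreal (4 * R\<^sup>2 * (norm (\<gamma> ((1 - t) *\<^sub>R x + t *\<^sub>R y)))\<^sup>2)"
      by (auto simp: indicator_def z_def power_mult_distrib mult_ac intro!: ennreal_leI)
  qed
  finally show ?thesis .
qed

text \<open>A radially decreasing weight is quasi-concave, so at each point of the segment from \<open>x\<close> to \<open>y\<close>
  it is at least \<open>f x * f y\<close>; each point is parametrised by the farther of its endpoints, which keeps the
  Jacobian above \<open>2\<^sup>-\<^sup>N\<close>.\<close>
lemma C1_double_integral_le:
  fixes v f :: "'a::euclidean_space \<Rightarrow> real" and \<gamma> :: "'a \<Rightarrow> 'a"
  assumes der: "\<And>x. x \<in> cball 0 s \<Longrightarrow> (v has_derivative (\<lambda>u. \<gamma> x \<bullet> u)) (at x)"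
    and cont: "continuous_on (cball 0 s) \<gamma>" and R: "0 < R" "R \<le> s"
    and [measurable]: "f \<in> borel_measurable borel"
    and f: "\<And>x. 0 \<le> f x" "\<And>x. f x \<le> 1" "\<And>x y. norm x \<le> norm y \<Longrightarrow> norm y < s \<Longrightarrow> f y \<le> f x"
  shows "(\<integral>\<^sup>+x. \<integral>\<^sup>+y. indicator (ball 0 R) x * indicator (ball 0 R) y * ennreal ((v x - v y)\<^sup>2 * f x * f y) \<partial>lborel \<partial>lborel)
    \<le> ennreal (4 * R\<^sup>2 * 2 ^ DIM('a)) * emeasure lborel (ball (0::'a) R)
        * (\<integral>\<^sup>+x. indicator (ball 0 R) x * ennreal (f x * (norm (\<gamma> x))\<^sup>2) \<partial>lborel)"
proof -
  let ?B = "ball (0::'a) R"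
  have [measurable]: "?B \<in> sets borel" by simp
  have sub: "?B \<subseteq> cball 0 s" using R by auto
  have mg: "(\<lambda>x. indicator ?B x *\<^sub>R \<gamma> x) \<in> borel_measurable borel"
    by (intro borel_measurable_continuous_on_indicator continuous_on_subset[OF cont sub]) auto
  define \<Phi> where "\<Phi> = (\<lambda>x. ennreal (f x * (norm (indicator ?B x *\<^sub>R \<gamma> x))\<^sup>2))"
  have [measurable]: "\<Phi> \<in> borel_measurable borel" unfolding \<Phi>_def using mg by measurable
  have \<Phi>_eq: "\<Phi> x = indicator ?B x * ennreal (f x * (norm (\<gamma> x))\<^sup>2)" for x
    by (auto simp: \<Phi>_def indicator_def)
  define I where "I = (\<integral>\<^sup>+x. \<Phi> x \<partial>lborel)"
  define k where "k = ennreal (4 * R\<^sup>2)"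
  define V where "V = emeasure lborel ?B"
  define H where "H = (\<lambda>t x y. indicator {0..1::real} t * (indicator ?B x * (indicator ?B y * \<Phi> ((1 - t) *\<^sub>R x + t *\<^sub>R y))))"
  \<comment> \<open>The weights move onto the segment: afterwards x and y occur only in their
    indicators and in the intermediate point.\<close>
  have pt: "indicator ?B x * indicator ?B y * ennreal ((v x - v y)\<^sup>2 * f x * f y) \<le> k * (\<integral>\<^sup>+t. H t x y \<partial>lborel)" for x y
  proof (cases "x \<in> ?B \<and> y \<in> ?B")
    case True
    then have xy: "x \<in> ?B" "y \<in> ?B" by auto
    have "ennreal ((v x - v y)\<^sup>2 * f x * f y) = ennreal (f x * f y) * ennreal ((v x - v y)\<^sup>2)"
      using f(1) by (simp add: ennreal_mult mult_ac)
    also have "\<dots> \<le> ennreal (f x * f y) * (\<integral>\<^sup>+t. indicator {0..1} t * ennreal (4 * R\<^sup>2 * (norm (\<gamma> ((1 - t) *\<^sub>R x + t *\<^sub>R y)))\<^sup>2) \<partial>lborel)"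
      by (intro mult_left_mono segment_square_le[OF der cont R(2) xy]) auto
    also have "\<dots> \<le> (\<integral>\<^sup>+t. ennreal (f x * f y) * (indicator {0..1} t * ennreal (4 * R\<^sup>2 * (norm (\<gamma> ((1 - t) *\<^sub>R x + t *\<^sub>R y)))\<^sup>2)) \<partial>lborel)"
    proof (rule eq_refl, rule nn_integral_cmult[symmetric])
      have "continuous_on {0..1} (\<lambda>t. \<gamma> ((1 - t) *\<^sub>R x + t *\<^sub>R y))"
      proof (rule continuous_on_compose2[OF cont])
        show "(\<lambda>t. (1 - t) *\<^sub>R x + t *\<^sub>R y) ` {0..1} \<subseteq> cball 0 s"
        proof
          fix w assume "w \<in> (\<lambda>t. (1 - t) *\<^sub>R x + t *\<^sub>R y) ` {0..1}"
          then obtain t where "w = (1 - t) *\<^sub>R x + t *\<^sub>R y" "0 \<le> t" "t \<le> 1" by auto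
          with convexD[OF convex_ball xy, of "1 - t" t] have "w \<in> ?B" by simp
          with sub show "w \<in> cball 0 s" by blast
        qed
      qed (intro continuous_intros)
      then have "(\<lambda>t. indicator {0..1} t *\<^sub>R \<gamma> ((1 - t) *\<^sub>R x + t *\<^sub>R y)) \<in> borel_measurable borel"
        by (intro borel_measurable_continuous_on_indicator) auto
      then have "(\<lambda>t. ennreal (4 * R\<^sup>2 * (norm (indicator {0..1} t *\<^sub>R \<gamma> ((1 - t) *\<^sub>R x + t *\<^sub>R y)))\<^sup>2)) \<in> borel_measurable lborel"
        by measurable
      then show "(\<lambda>t. indicator {0..1} t * ennreal (4 * R\<^sup>2 * (norm (\<gamma> ((1 - t) *\<^sub>R x + t *\<^sub>R y)))\<^sup>2)) \<in> borel_measurable lborel"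
        by (rule back_subst[of "\<lambda>g. g \<in> borel_measurable lborel"]) (auto simp: indicator_def)
    qed
    also have "\<dots> \<le> (\<integral>\<^sup>+t. k * H t x y \<partial>lborel)"
    proof (rule nn_integral_mono)
      fix t :: real
      show "ennreal (f x * f y) * (indicator {0..1} t * ennreal (4 * R\<^sup>2 * (norm (\<gamma> ((1 - t) *\<^sub>R x + t *\<^sub>R y)))\<^sup>2)) \<le> k * H t x y"
      proof (cases "t \<in> {0..1}")
        case t: True
        define z where "z = (1 - t) *\<^sub>R x + t *\<^sub>R y"
        have zB: "z \<in> ?B" using convexD[OF convex_ball xy, of "1 - t" t] t by (simp add: z_def)
        have "norm z \<le> (1 - t) * norm x + t * norm y"
          using norm_triangle_ineq[of "(1 - t) *\<^sub>R x" "t *\<^sub>R y"] t by (simp add: z_def)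
        also have "\<dots> \<le> (1 - t) * max (norm x) (norm y) + t * max (norm x) (norm y)"
          using t by (intro add_mono mult_left_mono) auto
        also have "\<dots> = max (norm x) (norm y)" by (simp add: algebra_simps)
        finally have nz: "norm z \<le> norm x \<or> norm z \<le> norm y" by auto
        have "f x * f y \<le> f z"
          using nz
        proof
          assume "norm z \<le> norm x"
          then have "f x * f y \<le> f z * 1" using f xy R by (intro mult_mono) auto
          then show ?thesis by simp
        next
          assume "norm z \<le> norm y"
          then have "f x * f y \<le> 1 * f z" using f xy R by (intro mult_mono) auto
          then show ?thesis by simp
        qed
        then have "ennreal (f x * f y) * ennreal (4 * R\<^sup>2 * (norm (\<gamma> z))\<^sup>2) \<le> ennreal (f z) * ennreal (4 * R\<^sup>2 * (norm (\<gamma> z))\<^sup>2)"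
          by (intro mult_right_mono ennreal_leI) auto
        also have "\<dots> = k * \<Phi> z" using zB f(1) by (simp add: \<Phi>_eq k_def ennreal_mult mult_ac)
        finally show ?thesis using t xy by (simp add: H_def z_def)
      qed simp
    qed
    also have "\<dots> = k * (\<integral>\<^sup>+t. H t x y \<partial>lborel)" unfolding H_def by (rule nn_integral_cmult) measurable
    finally show ?thesis using xy by simp
  qed auto
  have J: "(\<integral>\<^sup>+x. \<integral>\<^sup>+y. H t x y \<partial>lborel \<partial>lborel) \<le> indicator {0..1} t * (ennreal (2 ^ DIM('a)) * I * V)" for t
  proof (cases "t \<in> {0..1}")
    case t: True
    show ?thesis
    \<comment> \<open>For t \<le> 1/2 the intermediate point moves with x at rate 1 - t \<ge> 1/2,
      so the order is exchanged and x is substituted; otherwise y is substituted, at rate t.\<close>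
    proof (cases "t \<le> 1 / 2")
      case True
      have "(\<integral>\<^sup>+x. \<integral>\<^sup>+y. H t x y \<partial>lborel \<partial>lborel) = (\<integral>\<^sup>+y. \<integral>\<^sup>+x. H t x y \<partial>lborel \<partial>lborel)"
        unfolding H_def by (rule lborel_pair.Fubini') measurable
      also have "\<dots> \<le> (\<integral>\<^sup>+y. indicator ?B y * (ennreal (2 ^ DIM('a)) * I) \<partial>lborel)"
      proof (rule nn_integral_mono)
        fix y
        have "(\<integral>\<^sup>+x. H t x y \<partial>lborel) \<le> (\<integral>\<^sup>+x. indicator ?B y * \<Phi> (t *\<^sub>R y + (1 - t) *\<^sub>R x) \<partial>lborel)"
          by (intro nn_integral_mono) (auto simp: H_def indicator_def add.commute)
        also have "\<dots> = indicator ?B y * (\<integral>\<^sup>+x. \<Phi> (t *\<^sub>R y + (1 - t) *\<^sub>R x) \<partial>lborel)"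
          by (rule nn_integral_cmult) measurable
        also have "\<dots> \<le> indicator ?B y * (ennreal (2 ^ DIM('a)) * I)"
          unfolding I_def using True by (intro mult_left_mono nn_integral_lborel_affine_le) auto
        finally show "(\<integral>\<^sup>+x. H t x y \<partial>lborel) \<le> indicator ?B y * (ennreal (2 ^ DIM('a)) * I)" .
      qed
      also have "\<dots> = ennreal (2 ^ DIM('a)) * I * V"
        by (subst nn_integral_multc) (auto simp: V_def mult.commute)
      finally show ?thesis using t by simp
    next
      case False
      have "(\<integral>\<^sup>+x. \<integral>\<^sup>+y. H t x y \<partial>lborel \<partial>lborel) \<le> (\<integral>\<^sup>+x. indicator ?B x * (ennreal (2 ^ DIM('a)) * I) \<partial>lborel)"
      proof (rule nn_integral_mono)
        fix x
        have "(\<integral>\<^sup>+y. H t x y \<partial>lborel) \<le> (\<integral>\<^sup>+y. indicator ?B x * \<Phi> ((1 - t) *\<^sub>R x + t *\<^sub>R y) \<partial>lborel)"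
          by (intro nn_integral_mono) (auto simp: H_def indicator_def)
        also have "\<dots> = indicator ?B x * (\<integral>\<^sup>+y. \<Phi> ((1 - t) *\<^sub>R x + t *\<^sub>R y) \<partial>lborel)"
          by (rule nn_integral_cmult) measurable
        also have "\<dots> \<le> indicator ?B x * (ennreal (2 ^ DIM('a)) * I)"
          unfolding I_def using False by (intro mult_left_mono nn_integral_lborel_affine_le) auto
        finally show "(\<integral>\<^sup>+y. H t x y \<partial>lborel) \<le> indicator ?B x * (ennreal (2 ^ DIM('a)) * I)" .
      qed
      also have "\<dots> = ennreal (2 ^ DIM('a)) * I * V"
        by (subst nn_integral_multc) (auto simp: V_def mult.commute)
      finally show ?thesis using t by simp
    qed
  qed (simp add: H_def)
  have "(\<integral>\<^sup>+x. \<integral>\<^sup>+y. indicator ?B x * indicator ?B y * ennreal ((v x - v y)\<^sup>2 * f x * f y) \<partial>lborel \<partial>lborel)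
      \<le> (\<integral>\<^sup>+x. \<integral>\<^sup>+y. k * (\<integral>\<^sup>+t. H t x y \<partial>lborel) \<partial>lborel \<partial>lborel)"
    by (intro nn_integral_mono pt)
  also have "\<dots> = k * (\<integral>\<^sup>+x. \<integral>\<^sup>+y. \<integral>\<^sup>+t. H t x y \<partial>lborel \<partial>lborel \<partial>lborel)"
  proof -
    have "(\<integral>\<^sup>+y. k * (\<integral>\<^sup>+t. H t x y \<partial>lborel) \<partial>lborel) = k * (\<integral>\<^sup>+y. \<integral>\<^sup>+t. H t x y \<partial>lborel \<partial>lborel)" for x
      unfolding H_def by (rule nn_integral_cmult) measurable
    moreover have "(\<integral>\<^sup>+x. k * (\<integral>\<^sup>+y. \<integral>\<^sup>+t. H t x y \<partial>lborel \<partial>lborel) \<partial>lborel) = k * (\<integral>\<^sup>+x. \<integral>\<^sup>+y. \<integral>\<^sup>+t. H t x y \<partial>lborel \<partial>lborel \<partial>lborel)"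
      unfolding H_def by (rule nn_integral_cmult) measurable
    ultimately show ?thesis by simp
  qed
  also have "\<dots> \<le> k * (ennreal (2 ^ DIM('a)) * I * V)"
  proof (rule mult_left_mono)
    have "(\<integral>\<^sup>+x. \<integral>\<^sup>+y. \<integral>\<^sup>+t. H t x y \<partial>lborel \<partial>lborel \<partial>lborel) = (\<integral>\<^sup>+x. \<integral>\<^sup>+t. \<integral>\<^sup>+y. H t x y \<partial>lborel \<partial>lborel \<partial>lborel)"
      unfolding H_def by (intro nn_integral_cong lborel_pair.Fubini') measurable
    also have "\<dots> = (\<integral>\<^sup>+t. \<integral>\<^sup>+x. \<integral>\<^sup>+y. H t x y \<partial>lborel \<partial>lborel \<partial>lborel)"
      unfolding H_def by (rule lborel_pair.Fubini') measurable
    also have "\<dots> \<le> (\<integral>\<^sup>+t. indicator {0..1::real} t * (ennreal (2 ^ DIM('a)) * I * V) \<partial>lborel)"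
      by (intro nn_integral_mono J)
    also have "\<dots> = ennreal (2 ^ DIM('a)) * I * V" by (subst nn_integral_multc) auto
    finally show "(\<integral>\<^sup>+x. \<integral>\<^sup>+y. \<integral>\<^sup>+t. H t x y \<partial>lborel \<partial>lborel \<partial>lborel) \<le> ennreal (2 ^ DIM('a)) * I * V" .
  qed simp
  finally show ?thesis
    by (simp add: k_def V_def I_def \<Phi>_eq ennreal_mult mult_ac)
qed

text \<open>Symmetrisation: the double integral of \<open>f x * f y * (v x - v y)\<^sup>2\<close> is
  twice the left-hand side, which is the weighted variance times the square of the total weight.
  This form avoids dividing by the total weight.\<close>

lemma C1_weighted_poincare:
  fixes v f :: "'a::euclidean_space \<Rightarrow> real" and \<gamma> :: "'a \<Rightarrow> 'a"
  assumes der: "\<And>x. x \<in> cball 0 s \<Longrightarrow> (v has_derivative (\<lambda>u. \<gamma> x \<bullet> u)) (at x)"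
    and cont: "continuous_on (cball 0 s) \<gamma>" and R: "0 < R" "R \<le> s"
    and [measurable]: "f \<in> borel_measurable borel"
    and f: "\<And>x. 0 \<le> f x" "\<And>x. f x \<le> 1" "\<And>x y. norm x \<le> norm y \<Longrightarrow> norm y < s \<Longrightarrow> f y \<le> f x"
  shows "(LBINT x. indicator (ball 0 R) x * f x) * (LBINT x. indicator (ball 0 R) x * f x * (v x)\<^sup>2)
      - (LBINT x. indicator (ball 0 R) x * f x * v x)\<^sup>2
    \<le> 2 * R\<^sup>2 * 2 ^ DIM('a) * measure lborel (ball (0::'a) R)
        * (LBINT x. indicator (ball 0 R) x * f x * (norm (\<gamma> x))\<^sup>2)"
proof -
  let ?B = "ball (0::'a) R"
  have [measurable]: "?B \<in> sets borel" by simp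
  have sub: "?B \<subseteq> cball 0 s" using R by auto
  have contv: "continuous_on (cball 0 s) v"
    by (intro continuous_at_imp_continuous_on ballI has_derivative_continuous[OF der])
  define b where "b = (\<lambda>x. indicator ?B x * f x)"
  define w where "w = (\<lambda>x. indicator ?B x *\<^sub>R v x)"
  define G where "G = (\<lambda>x. indicator ?B x *\<^sub>R \<gamma> x)"
  have [measurable]: "b \<in> borel_measurable borel" unfolding b_def by measurable
  have [measurable]: "w \<in> borel_measurable borel" "G \<in> borel_measurable borel"
    unfolding w_def G_def
    by (intro borel_measurable_continuous_on_indicator continuous_on_subset[OF contv] continuous_on_subset[OF cont] sub; simp)+
  obtain C where C: "\<And>x. x \<in> cball 0 s \<Longrightarrow> \<bar>v x\<bar> \<le> C"
    using continuous_on_cball_bounded[OF contv] by auto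
  obtain D where D: "\<And>x. x \<in> cball 0 s \<Longrightarrow> norm (\<gamma> x) \<le> D"
    using continuous_on_cball_bounded[OF cont] by auto
  have b: "0 \<le> b x" "\<bar>b x\<bar> \<le> 1" for x using f(1,2)[of x] by (auto simp: b_def indicator_def)
  have w: "\<bar>w x\<bar> \<le> \<bar>C\<bar>" for x using C[of x] sub by (auto simp: w_def indicator_def)
  have G: "norm (G x) \<le> \<bar>D\<bar>" for x using D[of x] sub by (auto simp: G_def indicator_def)
  have bi: "integrable lborel (\<lambda>x. b x * h x)" if [measurable]: "h \<in> borel_measurable borel" and h: "\<And>x. \<bar>h x\<bar> \<le> K" for h K
  proof (rule integrable_bounded_support[of _ ?B K])
    show "\<bar>b x * h x\<bar> \<le> K" for x
      using mult_mono[OF b(2) h, of x x] by (simp add: abs_mult)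
    show "b x * h x = 0" if "x \<notin> ?B" for x using that by (simp add: b_def)
  qed auto
  have i0: "integrable lborel b" using bi[of "\<lambda>_. 1" 1] by simp
  have i1: "integrable lborel (\<lambda>x. b x * w x)" by (rule bi[OF _ w]) simp
  have w2: "\<bar>(w x)\<^sup>2\<bar> \<le> C\<^sup>2" for x using w[of x] by (simp add: abs_le_square_iff)
  have i2: "integrable lborel (\<lambda>x. b x * (w x)\<^sup>2)" by (rule bi[OF _ w2]) simp
  have G2: "\<bar>(norm (G x))\<^sup>2\<bar> \<le> D\<^sup>2" for x using power_mono[OF G[of x], of 2] by simp
  have i3: "integrable lborel (\<lambda>x. b x * (norm (G x))\<^sup>2)" by (rule bi[OF _ G2]) simp
  define m where "m = (LBINT x. b x)"
  define L where "L = (LBINT x. b x * w x)"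
  define P where "P = (LBINT x. b x * (w x)\<^sup>2)"
  define E where "E = (LBINT x. b x * (norm (G x))\<^sup>2)"
  \<comment> \<open>The inner integral is computed exactly; it is a quadratic polynomial in
    \<open>w x\<close> whose coefficients are the moments, and can be integrated once more.\<close>
  have inner: "(\<integral>\<^sup>+y. indicator ?B x * indicator ?B y * ennreal ((v x - v y)\<^sup>2 * f x * f y) \<partial>lborel)
      = ennreal (b x * ((w x)\<^sup>2 * m - 2 * w x * L + P))"
    and inner0: "0 \<le> b x * ((w x)\<^sup>2 * m - 2 * w x * L + P)" for x
  proof -
    have eq: "indicator ?B x * indicator ?B y * ennreal ((v x - v y)\<^sup>2 * f x * f y) = ennreal (b x * b y * (w x - w y)\<^sup>2)" for y
      by (auto simp: b_def w_def indicator_def mult_ac)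
    have expand: "(\<lambda>y. b x * b y * (w x - w y)\<^sup>2) = (\<lambda>y. b x * ((w x)\<^sup>2 * b y - 2 * w x * (b y * w y) + b y * (w y)\<^sup>2))"
      by (auto simp: power2_eq_square algebra_simps)
    have int: "integrable lborel (\<lambda>y. b x * b y * (w x - w y)\<^sup>2)"
      unfolding expand using i0 i1 i2 by (intro integrable_mult_right Bochner_Integration.integrable_add Bochner_Integration.integrable_diff)
    have val: "(LBINT y. b x * b y * (w x - w y)\<^sup>2) = b x * ((w x)\<^sup>2 * m - 2 * w x * L + P)"
      unfolding expand using i0 i1 i2 by (simp add: m_def L_def P_def)
    show "(\<integral>\<^sup>+y. indicator ?B x * indicator ?B y * ennreal ((v x - v y)\<^sup>2 * f x * f y) \<partial>lborel)
      = ennreal (b x * ((w x)\<^sup>2 * m - 2 * w x * L + P))"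
      unfolding eq val[symmetric] by (intro nn_integral_eq_integral int AE_I2 mult_nonneg_nonneg b) simp
    show "0 \<le> b x * ((w x)\<^sup>2 * m - 2 * w x * L + P)"
      unfolding val[symmetric] by (intro Bochner_Integration.integral_nonneg mult_nonneg_nonneg b) simp
  qed
  have outer: "(\<lambda>x. b x * ((w x)\<^sup>2 * m - 2 * w x * L + P)) = (\<lambda>x. m * (b x * (w x)\<^sup>2) - 2 * L * (b x * w x) + P * b x)"
    by (auto simp: algebra_simps)
  have int: "integrable lborel (\<lambda>x. b x * ((w x)\<^sup>2 * m - 2 * w x * L + P))"
    unfolding outer using i0 i1 i2 by (intro integrable_mult_right Bochner_Integration.integrable_add Bochner_Integration.integrable_diff)
  have val: "(LBINT x. b x * ((w x)\<^sup>2 * m - 2 * w x * L + P)) = 2 * (m * P - L\<^sup>2)"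
    unfolding outer using i0 i1 i2
    by (simp add: m_def[symmetric] L_def[symmetric] P_def[symmetric] power2_eq_square[of L])
  have "ennreal (2 * (m * P - L\<^sup>2)) = (\<integral>\<^sup>+x. \<integral>\<^sup>+y. indicator ?B x * indicator ?B y * ennreal ((v x - v y)\<^sup>2 * f x * f y) \<partial>lborel \<partial>lborel)"
    unfolding inner val[symmetric] by (intro nn_integral_eq_integral[symmetric] int AE_I2 inner0)
  also have "\<dots> \<le> ennreal (4 * R\<^sup>2 * 2 ^ DIM('a)) * emeasure lborel ?B
        * (\<integral>\<^sup>+x. indicator ?B x * ennreal (f x * (norm (\<gamma> x))\<^sup>2) \<partial>lborel)"
    by (rule C1_double_integral_le[OF der cont R _ f]) auto
  also have "(\<integral>\<^sup>+x. indicator ?B x * ennreal (f x * (norm (\<gamma> x))\<^sup>2) \<partial>lborel) = ennreal E"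
  proof -
    have eq: "indicator ?B x * ennreal (f x * (norm (\<gamma> x))\<^sup>2) = ennreal (b x * (norm (G x))\<^sup>2)" for x
      by (auto simp: b_def G_def indicator_def)
    show ?thesis unfolding eq E_def by (intro nn_integral_eq_integral i3 AE_I2 mult_nonneg_nonneg b) simp
  qed
  also have "emeasure lborel ?B = ennreal (measure lborel ?B)"
    using emeasure_lborel_finite[of ?B] by (intro emeasure_eq_ennreal_measure) auto
  also have "ennreal (4 * R\<^sup>2 * 2 ^ DIM('a)) * ennreal (measure lborel ?B) * ennreal E
      = ennreal (4 * R\<^sup>2 * 2 ^ DIM('a) * measure lborel ?B * E)"
    by (simp add: ennreal_mult'' ennreal_mult E_def b mult_nonneg_nonneg)
  finally have "2 * (m * P - L\<^sup>2) \<le> 4 * R\<^sup>2 * 2 ^ DIM('a) * measure lborel ?B * E"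
    by (subst (asm) ennreal_le_iff) (auto simp: E_def b)
  then have main: "m * P - L\<^sup>2 \<le> 2 * R\<^sup>2 * 2 ^ DIM('a) * measure lborel ?B * E" by simp
  have e: "indicator ?B x * f x * (v x)\<^sup>2 = b x * (w x)\<^sup>2" "indicator ?B x * f x * v x = b x * w x"
    "indicator ?B x * f x * (norm (\<gamma> x))\<^sup>2 = b x * (norm (G x))\<^sup>2" "indicator ?B x * f x = b x" for x
    by (auto simp: b_def w_def G_def indicator_def)
  show ?thesis
    unfolding e(1-3) unfolding e(4) m_def[symmetric] L_def[symmetric] P_def[symmetric] E_def[symmetric] by (rule main)
qed

text \<open>Each integral converges along the approximation because f is bounded; the gradient term
  is split into components for this.\<close>

lemma W1_weighted_poincare:
  fixes v f :: "'a::euclidean_space \<Rightarrow> real" and g :: "'a \<Rightarrow> 'a"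
  assumes W: "W1 v g" and R: "0 < R" "R < 1" and [measurable]: "f \<in> borel_measurable borel"
    and f: "\<And>x. 0 \<le> f x" "\<And>x. f x \<le> 1" "\<And>x y. norm x \<le> norm y \<Longrightarrow> norm y < 1 \<Longrightarrow> f y \<le> f x"
  shows "(LBINT x. indicator (ball 0 R) x * f x) * (LBINT x. indicator (ball 0 R) x * f x * (v x)\<^sup>2)
      - (LBINT x. indicator (ball 0 R) x * f x * v x)\<^sup>2
    \<le> 2 * R\<^sup>2 * 2 ^ DIM('a) * measure lborel (ball (0::'a) R)
        * (LBINT x. indicator (ball 0 R) x * f x * (norm (g x))\<^sup>2)"
proof -
  let ?B = "ball (0::'a) R"
  obtain \<phi> \<gamma> where approx: "C1_approx R v g \<phi> \<gamma>"
    using W R unfolding W1_def by blast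
  note der = C1_approxD(1)[OF approx] and cont = C1_approxD(2)[OF approx]
    and lim\<phi> = C1_approxD(3)[OF approx] and lim\<gamma> = C1_approxD(4)[OF approx]
  have f1: "\<bar>f x\<bar> \<le> 1" for x using f by simp
  have fl: "l2lim lborel (\<lambda>n x. f x * F n x) (\<lambda>x. f x * F0 x)" if "l2lim lborel F F0" for F F0
    by (rule l2lim_mult[OF that _ f1]) simp
  have [measurable]: "?B \<in> sets borel" by simp
  have "(\<lambda>x. indicator ?B x * f x) \<in> borel_measurable lborel"
    by measurable
  then have fc: "l2lim lborel (\<lambda>n x. indicator ?B x * f x) (\<lambda>x. indicator ?B x * f x)"
    by (intro l2lim_const integrable_bounded_support[of _ ?B 1])
       (auto simp: f power_le_one)
  define b where "b = (LBINT x. indicator ?B x * f x)"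
  have L0: "(\<lambda>n. LBINT x. indicator ?B x * f x * (\<phi> n x)\<^sup>2) \<longlonglongrightarrow> (LBINT x. indicator ?B x * f x * (v x)\<^sup>2)"
  proof -
    have eq: "indicator ?B x * f x * t\<^sup>2 = indicator ?B x * t * (f x * (indicator ?B x * t))" for x t
      by (auto simp: indicator_def power2_eq_square)
    show ?thesis unfolding eq by (rule l2lim_integral_mult[OF lim\<phi> fl[OF lim\<phi>]])
  qed
  have L1: "(\<lambda>n. LBINT x. indicator ?B x * f x * \<phi> n x) \<longlonglongrightarrow> (LBINT x. indicator ?B x * f x * v x)"
  proof -
    have eq: "indicator ?B x * f x * t = indicator ?B x * t * (indicator ?B x * f x)" for x t
      by (auto simp: indicator_def)
    show ?thesis unfolding eq by (rule l2lim_integral_mult[OF lim\<phi> fc])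
  qed
  have L2: "(\<lambda>n. LBINT x. indicator ?B x * f x * (norm (\<gamma> n x))\<^sup>2) \<longlonglongrightarrow> (LBINT x. indicator ?B x * f x * (norm (g x))\<^sup>2)"
  proof -
    define F where "F = (\<lambda>b n x. indicator ?B x * (\<gamma> n x \<bullet> b))"
    define F0 where "F0 = (\<lambda>b x. indicator ?B x * (g x \<bullet> b))"
    have F: "l2lim lborel (F b) (F0 b)" if "b \<in> Basis" for b
      using lim\<gamma>[OF that] by (simp add: F_def F0_def)
    have i: "integrable lborel (\<lambda>x. F b n x * (f x * F b n x))" "integrable lborel (\<lambda>x. F0 b x * (f x * F0 b x))"
      if "b \<in> Basis" for b n
      using l2limD[OF F[OF that]] l2limD[OF fl[OF F[OF that]]] by (auto intro!: square_integrable_mult)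
    have sq: "indicator ?B x * f x * (norm u)\<^sup>2 = (\<Sum>b\<in>Basis. indicator ?B x * (u \<bullet> b) * (f x * (indicator ?B x * (u \<bullet> b))))" for x u
      by (subst power2_norm_eq_inner, subst euclidean_inner) (auto simp: indicator_def sum_distrib_left mult_ac)
    have "(\<lambda>n. \<Sum>b\<in>Basis. LBINT x. F b n x * (f x * F b n x)) \<longlonglongrightarrow> (\<Sum>b\<in>Basis. LBINT x. F0 b x * (f x * F0 b x))"
      by (intro tendsto_sum l2lim_integral_mult F fl)
    then show ?thesis
      unfolding sq F_def[symmetric] F0_def[symmetric] using i by (simp add: F_def F0_def)
  qed
  have "(\<lambda>n. b * (LBINT x. indicator ?B x * f x * (\<phi> n x)\<^sup>2) - (LBINT x. indicator ?B x * f x * \<phi> n x)\<^sup>2)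
      \<longlonglongrightarrow> b * (LBINT x. indicator ?B x * f x * (v x)\<^sup>2) - (LBINT x. indicator ?B x * f x * v x)\<^sup>2"
    by (intro tendsto_diff tendsto_mult tendsto_power tendsto_const L0 L1)
  moreover have "(\<lambda>n. 2 * R\<^sup>2 * 2 ^ DIM('a) * measure lborel ?B * (LBINT x. indicator ?B x * f x * (norm (\<gamma> n x))\<^sup>2))
      \<longlonglongrightarrow> 2 * R\<^sup>2 * 2 ^ DIM('a) * measure lborel ?B * (LBINT x. indicator ?B x * f x * (norm (g x))\<^sup>2)"
    by (intro tendsto_mult tendsto_const L2)
  moreover have "b * (LBINT x. indicator ?B x * f x * (\<phi> n x)\<^sup>2) - (LBINT x. indicator ?B x * f x * \<phi> n x)\<^sup>2
      \<le> 2 * R\<^sup>2 * 2 ^ DIM('a) * measure lborel ?B * (LBINT x. indicator ?B x * f x * (norm (\<gamma> n x))\<^sup>2)" for n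
    unfolding b_def using R by (intro C1_weighted_poincare[OF der cont R(1) _ _ f]) auto
  ultimately show ?thesis unfolding b_def by (blast intro: LIMSEQ_le)
qed

section \<open>Radial functions on the Poincare ball\<close>

definition rad :: "real \<Rightarrow> real" where
  "rad r = ln ((1 + r) / (1 - r))"

text \<open>The conformal factor of the metric at Euclidean radius r. It is also the derivative of
  \<open>rad\<close>, the distance being its integral along a ray.\<close>

definition wt :: "real \<Rightarrow> real" where
  "wt r = 2 / (1 - r\<^sup>2)"

lemma rho_rad: "rho x = rad (norm x)"
  by (simp add: rho_def rad_def)

lemma borel_rad [measurable]: "rad \<in> borel_measurable borel"
  unfolding rad_def by measurable

lemma borel_wt [measurable]: "wt \<in> borel_measurable borel"
  unfolding wt_def by measurable

lemma borel_rho [measurable]: "rho \<in> borel_measurable borel"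
  unfolding rho_rad[abs_def] by measurable

lemma one_minus_square_pos: "0 \<le> r \<Longrightarrow> r < 1 \<Longrightarrow> 0 < 1 - (r::real)\<^sup>2"
  by (simp add: power_less_one_iff)

lemma wt_ge_2: "0 \<le> r \<Longrightarrow> r < 1 \<Longrightarrow> 2 \<le> wt r"
  using one_minus_square_pos[of r] by (simp add: wt_def pos_le_divide_eq)

lemma wt_mono: "0 \<le> r \<Longrightarrow> r \<le> s \<Longrightarrow> s < 1 \<Longrightarrow> wt r \<le> wt s"
  using one_minus_square_pos[of r] one_minus_square_pos[of s] power_mono[of r s 2]
  unfolding wt_def by (intro divide_left_mono mult_pos_pos) auto

text \<open>Inside the ball \<open>wt\<close> is at least 1, so integrability with the hyperbolic
  weights yields integrability for Lebesgue measure.\<close>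

lemma integrable_of_weighted:
  fixes f h :: "'a::euclidean_space \<Rightarrow> real"
  assumes i: "integrable lborel (\<lambda>x. wt (norm x) ^ k * h x)" and f: "f \<in> borel_measurable borel"
    and le: "\<And>x. x \<in> ball 0 1 \<Longrightarrow> \<bar>f x\<bar> \<le> h x" and zero: "\<And>x. x \<notin> ball 0 1 \<Longrightarrow> f x = 0"
  shows "integrable lborel f"
proof (rule Bochner_Integration.integrable_bound[OF i])
  show "AE x in lborel. norm (f x) \<le> norm (wt (norm x) ^ k * h x)"
  proof (rule AE_I2)
    fix x :: 'a
    show "norm (f x) \<le> norm (wt (norm x) ^ k * h x)"
    proof (cases "x \<in> ball 0 1")
      case True
      have "1 \<le> wt (norm x) ^ k" using wt_ge_2[of "norm x"] True by (intro one_le_power) auto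
      then have "\<bar>f x\<bar> \<le> wt (norm x) ^ k * h x"
        using le[OF True] mult_mono[of 1 "wt (norm x) ^ k" "\<bar>f x\<bar>" "h x"] by simp
      then show ?thesis by simp
    qed (simp add: zero)
  qed
qed (use f in simp)

lemma rad_has_derivative:
  assumes "0 \<le> r" "r < 1"
  shows "(rad has_real_derivative wt r) (at r)"
proof -
  have "(rad has_real_derivative ((1 * (1 - r) - (1 + r) * (0 - 1)) / ((1 - r) * (1 - r))) / ((1 + r) / (1 - r))) (at r)"
    unfolding rad_def using assms by (auto intro!: derivative_eq_intros simp: mult_ac)
  moreover have "((1 * (1 - r) - (1 + r) * (0 - 1)) / ((1 - r) * (1 - r))) / ((1 + r) / (1 - r)) = 2 / ((1 - r) * (1 + r))"
  proof -
    have num: "1 * (1 - r) - (1 + r) * (0 - 1) = 2" by (simp add: algebra_simps)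
    have eq: "c / (p * p) / (q / p) = c / (p * q)" if "p \<noteq> 0" for c p q :: real using that by simp
    show ?thesis unfolding num by (rule eq) (use assms in simp)
  qed
  moreover have "(1 - r) * (1 + r) = 1 - r\<^sup>2" by (simp add: power2_eq_square algebra_simps)
  ultimately show ?thesis by (simp add: wt_def)
qed

lemma rad_0 [simp]: "rad 0 = 0"
  by (simp add: rad_def)

text \<open>Mean value theorem on [0, r]: the slope \<open>wt\<close> increases from its value 2 at
  the origin. The parameter s allows one slope bound for all r up to s.\<close>

lemma rad_bounds:
  assumes "0 \<le> r" "r \<le> s" "s < 1"
  shows "2 * r \<le> rad r" "rad r \<le> wt s * r"
proof -
  have "\<exists>z. 0 < z \<and> z < r \<and> rad r - rad 0 = (r - 0) * wt z" if "0 < r"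
    using MVT2[OF that, of rad wt] rad_has_derivative assms by auto
  then have "2 * r \<le> rad r \<and> rad r \<le> wt s * r"
  proof (cases "r = 0")
    case False
    then obtain z where z: "0 < z" "z < r" "rad r = r * wt z" using assms \<open>0 < r \<Longrightarrow> _\<close> by auto
    have "2 \<le> wt z" "wt z \<le> wt s" using z assms by (auto intro: wt_ge_2 wt_mono)
    then show ?thesis using z assms by (simp add: mult.commute mult_right_mono)
  qed simp
  then show "2 * r \<le> rad r" "rad r \<le> wt s * r" by auto
qed

lemma rad_nonneg: "0 \<le> r \<Longrightarrow> r < 1 \<Longrightarrow> 0 \<le> rad r"
  using rad_bounds(1)[of r r] by simp

lemma exp_rad: "0 \<le> r \<Longrightarrow> r < 1 \<Longrightarrow> exp (rad r) = (1 + r) / (1 - r)"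
  by (simp add: rad_def)

lemma rad_mono: "0 \<le> r \<Longrightarrow> r \<le> s \<Longrightarrow> s < 1 \<Longrightarrow> rad r \<le> rad s"
  unfolding rad_def by (subst ln_le_cancel_iff) (auto simp: divide_simps algebra_simps)

text \<open>The threshold is tanh (k / 2), the Euclidean radius of the hyperbolic ball of radius
  k.\<close>

lemma rad_ge:
  assumes "(exp k - 1) / (exp k + 1) \<le> r" "r < 1"
  shows "k \<le> rad r"
proof -
  have "exp k - 1 \<le> r * (exp k + 1)" using assms(1) by (simp add: pos_divide_le_eq add_pos_pos)
  then have "exp k * (1 - r) \<le> 1 + r" by (simp add: algebra_simps)
  then have "exp k \<le> (1 + r) / (1 - r)" using assms(2) by (simp add: pos_le_divide_eq)
  then have "ln (exp k) \<le> rad r"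
    unfolding rad_def by (intro ln_mono) auto
  then show ?thesis by simp
qed

lemma tanh_half_rad:
  assumes "0 \<le> r" "r < 1"
  shows "tanh (rad r / 2) = r"
proof -
  have "exp (- 2 * (rad r / 2)) = (1 - r) / (1 + r)"
    using assms by (simp add: exp_minus exp_rad)
  then have "tanh (rad r / 2) = (1 - (1 - r) / (1 + r)) / (1 + (1 - r) / (1 + r))"
    by (simp only: tanh_real_altdef)
  also have "1 - (1 - r) / (1 + r) = 2 * r / (1 + r)" using assms by (simp add: divide_simps)
  also have "1 + (1 - r) / (1 + r) = 2 / (1 + r)" using assms by (simp add: divide_simps)
  finally show ?thesis using assms by simp
qed

text \<open>The hyperbolic cotangent of \<open>rad r\<close> is
  \<open>(1 + r\<^sup>2) / (2 r)\<close>, so the fraction is \<open>rad r\<close> times this, minus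
  1; the -1 reduces the leading N to 1.\<close>

lemma hyperbolic_weight:
  assumes "0 < r" "r < 1"
  shows "N + (N - 1) * ((rad r * cosh (rad r) - sinh (rad r)) / sinh (rad r))
    = 1 + (N - 1) * (rad r / r * ((1 + r\<^sup>2) / 2))"
proof -
  have p: "0 < (1 + r) / (1 - r)" using assms by simp
  have q: "0 < 1 - r\<^sup>2" using assms by (intro one_minus_square_pos) auto
  have e: "(1 - r) * (1 + r) = 1 - r\<^sup>2" by (simp add: power2_eq_square algebra_simps)
  have c: "cosh (rad r) = (1 + r\<^sup>2) / (1 - r\<^sup>2)"
  proof -
    have "cosh (rad r) = ((1 + r) / (1 - r) + (1 - r) / (1 + r)) / 2"
      unfolding rad_def using cosh_ln_real[OF p] by simp
    also have "\<dots> = (1 + r\<^sup>2) / ((1 - r) * (1 + r))"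
      using assms by (simp add: divide_simps) (simp add: power2_eq_square algebra_simps)
    finally show ?thesis unfolding e .
  qed
  have s: "sinh (rad r) = 2 * r / (1 - r\<^sup>2)"
  proof -
    have "sinh (rad r) = ((1 + r) / (1 - r) - (1 - r) / (1 + r)) / 2"
      unfolding rad_def using sinh_ln_real[OF p] by simp
    also have "\<dots> = 2 * r / ((1 - r) * (1 + r))"
      using assms by (simp add: divide_simps) (simp add: power2_eq_square algebra_simps)
    finally show ?thesis unfolding e .
  qed
  have "(rad r * cosh (rad r) - sinh (rad r)) / sinh (rad r) = rad r / r * ((1 + r\<^sup>2) / 2) - 1"
    unfolding c s using assms q by (simp add: divide_simps) 
  then show ?thesis by (simp only:) (simp add: algebra_simps)
qed

section \<open>Cutoffs exhausting hyperbolic space\<close>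

definition cutoff :: "real \<Rightarrow> real" where
  "cutoff t = (max 0 (1 - t\<^sup>2))\<^sup>2"

definition cutoff' :: "real \<Rightarrow> real" where
  "cutoff' t = - 4 * t * max 0 (1 - t\<^sup>2)"

lemma borel_cutoff [measurable]: "cutoff \<in> borel_measurable borel" "cutoff' \<in> borel_measurable borel"
  unfolding cutoff_def cutoff'_def by measurable

lemma cutoff_bounds: "0 \<le> cutoff t" "cutoff t \<le> 1"
  unfolding cutoff_def by (auto intro!: power_le_one)

lemma cutoff_eq_0: "1 \<le> \<bar>t\<bar> \<Longrightarrow> cutoff t = 0" "1 \<le> \<bar>t\<bar> \<Longrightarrow> cutoff' t = 0"
  using abs_le_square_iff[of 1 t] by (auto simp: cutoff_def cutoff'_def)

text \<open>At t = \<rho> / k the product is \<rho> times the \<rho>-derivative of the cutoff;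
  dominated convergence needs it bounded independently of k.\<close>

lemma cutoff'_bounds: "t * cutoff' t \<le> 0" "\<bar>t * cutoff' t\<bar> \<le> 4"
proof -
  have *: "t * cutoff' t = - 4 * (t\<^sup>2 * max 0 (1 - t\<^sup>2))" by (simp add: cutoff'_def power2_eq_square)
  have "t\<^sup>2 * max 0 (1 - t\<^sup>2) \<le> 1 * 1" if "t\<^sup>2 \<le> 1" using that by (intro mult_mono) auto
  then have "0 \<le> t\<^sup>2 * max 0 (1 - t\<^sup>2)" "t\<^sup>2 * max 0 (1 - t\<^sup>2) \<le> 1"
    by (auto simp: max_def)
  then show "t * cutoff' t \<le> 0" "\<bar>t * cutoff' t\<bar> \<le> 4" unfolding * by linarith+
qed

text \<open>Squaring the positive part removes the corner: \<open>(max 0 y)\<^sup>2\<close> has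
  derivative \<open>2 * max 0 y\<close> also at 0.\<close>

lemma cutoff_has_derivative: "(cutoff has_real_derivative cutoff' t) (at t)"
proof -
  have sq: "((\<lambda>y. (max 0 y)\<^sup>2) has_real_derivative 2 * max 0 y) (at y)" for y :: real
  proof (cases y "0::real" rule: linorder_cases)
    case less
    have "((\<lambda>_. 0) has_real_derivative 2 * max 0 y) (at y)" using less by simp
    then show ?thesis
      by (rule has_field_derivative_transform_within_open[where S = "{..<0}"]) (use less in auto)
  next
    case equal
    have "((\<lambda>h::real. (max 0 h)\<^sup>2 / h) \<longlongrightarrow> 0) (at 0)"
    proof (rule Lim_null_comparison)
      show "\<forall>\<^sub>F h in at (0::real). norm ((max 0 h)\<^sup>2 / h) \<le> norm h"
        by (auto simp: eventually_at_filter max_def power2_eq_square)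
      show "((\<lambda>h::real. norm h) \<longlongrightarrow> 0) (at 0)" by (intro tendsto_norm_zero tendsto_ident_at)
    qed
    then show ?thesis using equal by (simp add: DERIV_def)
  next
    case greater
    have "((\<lambda>y. y\<^sup>2) has_real_derivative 2 * max 0 y) (at y)"
      using greater by (auto intro!: derivative_eq_intros)
    then show ?thesis
      by (rule has_field_derivative_transform_within_open[where S = "{0<..}"]) (use greater in auto)
  qed
  have "((\<lambda>t. 1 - t\<^sup>2) has_real_derivative - 2 * t) (at t)" by (auto intro!: derivative_eq_intros)
  from DERIV_chain2[OF sq this] show ?thesis
    by (simp add: cutoff_def[abs_def] cutoff'_def mult_ac)
qed

lemma cutoff_limits:
  "(\<lambda>n. cutoff (c / real (Suc n))) \<longlonglongrightarrow> 1"
  "(\<lambda>n. c / real (Suc n) * cutoff' (c / real (Suc n))) \<longlonglongrightarrow> 0"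
proof -
  have lim: "(\<lambda>n. c / real (Suc n)) \<longlonglongrightarrow> 0" using lim_const_over_n[THEN LIMSEQ_Suc] by auto
  have "isCont cutoff 0" by (rule DERIV_isCont[OF cutoff_has_derivative])
  from isCont_tendsto_compose[OF this lim] show "(\<lambda>n. cutoff (c / real (Suc n))) \<longlonglongrightarrow> 1"
    by (simp add: cutoff_def)
  have "isCont cutoff' 0" unfolding cutoff'_def by (intro continuous_intros)
  from tendsto_mult[OF lim isCont_tendsto_compose[OF this lim]]
  show "(\<lambda>n. c / real (Suc n) * cutoff' (c / real (Suc n))) \<longlonglongrightarrow> 0" by simp
qed

text \<open>The radial identity for the field \<open>a (norm x) * cutoff (\<rho> / k) * x\<close>,
  with \<open>wt\<close> entering as the derivative of \<open>rad\<close>. The coefficient a may be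
  unbounded at the unit sphere, so its bounds are asked for on each [0, s] separately.\<close>

lemma W1_cutoff_ibp:
  fixes p :: "'a::euclidean_space \<Rightarrow> real" and g :: "'a \<Rightarrow> 'a" and a a' :: "real \<Rightarrow> real"
  assumes W: "W1 p g" and k: "0 < k"
    and [measurable]: "a \<in> borel_measurable borel" "a' \<in> borel_measurable borel"
    and a: "\<And>r. 0 < r \<Longrightarrow> r < 1 \<Longrightarrow> (a has_real_derivative a' r) (at r)"
    and bounds: "\<And>s. 0 < s \<Longrightarrow> s < 1 \<Longrightarrow> \<exists>C. \<forall>r. 0 \<le> r \<and> r \<le> s \<longrightarrow> \<bar>a r\<bar> \<le> C \<and> \<bar>r * a' r\<bar> \<le> C"
  defines "A \<equiv> \<lambda>x. indicator (ball 0 1) x * ((p x)\<^sup>2 * ((real DIM('a) * a (norm x) + norm x * a' (norm x)) * cutoff (rho x / k)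
      + a (norm x) * norm x * wt (norm x) * cutoff' (rho x / k) / k))"
    and "B \<equiv> \<lambda>x. indicator (ball 0 1) x * (2 * a (norm x) * cutoff (rho x / k) * (p x * (g x \<bullet> x)))"
  shows "integrable lborel A" "integrable lborel B" "(LBINT x. A x) + (LBINT x. B x) = 0"
proof -
  \<comment> \<open>The Euclidean radius of the hyperbolic ball of radius k, beyond which the cutoff
    is 0.\<close>
  define s0 where "s0 = (exp k - 1) / (exp k + 1)"
  have s0: "0 < s0" "s0 < 1" using k by (auto simp: s0_def add_pos_pos)
  define \<kappa> where "\<kappa> = (\<lambda>r. if 0 \<le> r \<and> r < 1 then a r * cutoff (rad r / k) else 0)"
  define \<kappa>' where "\<kappa>' = (\<lambda>r. if 0 \<le> r \<and> r < 1 then a' r * cutoff (rad r / k) + a r * (cutoff' (rad r / k) * (wt r / k)) else 0)"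
  have m [measurable]: "\<kappa> \<in> borel_measurable borel" "\<kappa>' \<in> borel_measurable borel"
    unfolding \<kappa>_def \<kappa>'_def by measurable
  have far: "1 \<le> \<bar>rad r / k\<bar>" if "s0 \<le> r" "r < 1" for r
  proof -
    have "k \<le> rad r" using rad_ge that by (simp add: s0_def)
    then show ?thesis using k by simp
  qed
  have \<kappa>0: "\<kappa> r = 0 \<and> \<kappa>' r = 0" if "s0 \<le> r" for r
    using far[OF that] cutoff_eq_0 by (simp add: \<kappa>_def \<kappa>'_def)
  have d: "(\<kappa> has_real_derivative \<kappa>' r) (at r)" if r: "0 < r" for r
  proof (cases "r < 1")
    case True
    have "((\<lambda>r. cutoff (rad r / k)) has_real_derivative cutoff' (rad r / k) * (wt r / k)) (at r)"
      using DERIV_chain2[OF cutoff_has_derivative DERIV_cdivide[OF rad_has_derivative]] r True by simp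
    from DERIV_mult[OF a[OF r True] this]
    have "((\<lambda>r. a r * cutoff (rad r / k)) has_real_derivative \<kappa>' r) (at r)"
      using r True by (simp add: \<kappa>'_def mult.commute)
    then show ?thesis
      by (rule has_field_derivative_transform_within_open[where S = "{0<..<1}"]) (use r True in \<open>auto simp: \<kappa>_def\<close>)
  next
    case False
    have "((\<lambda>_. 0) has_real_derivative \<kappa>' r) (at r)" using False by (simp add: \<kappa>'_def)
    then show ?thesis
      by (rule has_field_derivative_transform_within_open[where S = "{s0<..}"]) (use \<kappa>0 s0 False in auto)
  qed
  obtain C where C: "\<And>r. 0 \<le> r \<Longrightarrow> r \<le> s0 \<Longrightarrow> \<bar>a r\<bar> \<le> C \<and> \<bar>r * a' r\<bar> \<le> C"
    using bounds[OF s0] by auto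
  have C0: "0 \<le> C" using C[of 0] s0 by auto
  \<comment> \<open>The second summand bounds the term with the differentiated cutoff: 4 for
    \<open>r * cutoff'\<close>, and \<open>wt s0 / k\<close> for the derivative of
    \<open>rad r / k\<close>.\<close>
  define D where "D = C + C * (4 * (wt s0 / k))"
  have W0: "2 \<le> wt s0" using s0 by (intro wt_ge_2) auto
  have D: "C \<le> D" "0 \<le> D" using C0 W0 k by (auto simp: D_def)
  have b1: "\<bar>\<kappa> r\<bar> \<le> D" for r
  proof (cases "0 \<le> r \<and> r \<le> s0")
    case True
    have "\<bar>a r\<bar> * \<bar>cutoff (rad r / k)\<bar> \<le> C * 1"
      using C[of r] True cutoff_bounds by (intro mult_mono) auto
    then show ?thesis using True s0 D by (auto simp: \<kappa>_def abs_mult)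
  next
    case False
    then show ?thesis using \<kappa>0[of r] D by (cases "0 \<le> r") (auto simp: \<kappa>_def)
  qed
  have b2: "\<bar>r * \<kappa>' r\<bar> \<le> D" if r: "0 \<le> r" for r
  proof (cases "r \<le> s0")
    case True
    have "\<bar>r * a' r\<bar> * \<bar>cutoff (rad r / k)\<bar> \<le> C * 1"
      using C[of r] r True cutoff_bounds by (intro mult_mono) auto
    moreover have "\<bar>a r\<bar> * (\<bar>r * cutoff' (rad r / k)\<bar> * (wt r / k)) \<le> C * (4 * (wt s0 / k))"
    proof (intro mult_mono)
      have "\<bar>cutoff' (rad r / k)\<bar> \<le> 4"
      proof (cases "1 \<le> \<bar>rad r / k\<bar>")
        case False
        have "\<bar>rad r / k\<bar> * max 0 (1 - (rad r / k)\<^sup>2) \<le> 1 * 1"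
          using False by (intro mult_mono) auto
        then show ?thesis by (simp add: cutoff'_def abs_mult)
      qed (simp add: cutoff_eq_0)
      then have "r * \<bar>cutoff' (rad r / k)\<bar> \<le> 1 * 4" using r True s0 by (intro mult_mono) auto
      then show "\<bar>r * cutoff' (rad r / k)\<bar> \<le> 4" using r by (simp add: abs_mult)
      show "wt r / k \<le> wt s0 / k" using k r True s0 by (intro divide_right_mono wt_mono) auto
      show "0 \<le> wt r / k" using k wt_ge_2[of r] r True s0 by simp
      show "0 \<le> \<bar>r * cutoff' (rad r / k)\<bar> * (wt r / k)" using k wt_ge_2[of r] r True s0 by simp
    qed (use C[of r] r True C0 in auto)
    moreover have "r * \<kappa>' r = (r * a' r) * cutoff (rad r / k) + a r * ((r * cutoff' (rad r / k)) * (wt r / k))"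
      using r True s0 by (simp add: \<kappa>'_def algebra_simps)
    moreover have "\<bar>(r * a' r) * cutoff (rad r / k)\<bar> = \<bar>r * a' r\<bar> * \<bar>cutoff (rad r / k)\<bar>" by (simp add: abs_mult)
    moreover have "\<bar>a r * ((r * cutoff' (rad r / k)) * (wt r / k))\<bar> = \<bar>a r\<bar> * (\<bar>r * cutoff' (rad r / k)\<bar> * (wt r / k))"
      using k wt_ge_2[of r] r True s0 by (simp add: abs_mult)
    ultimately show ?thesis
      using abs_triangle_ineq[of "(r * a' r) * cutoff (rad r / k)" "a r * ((r * cutoff' (rad r / k)) * (wt r / k))"]
      unfolding D_def by (simp only:)
  next
    case False
    then show ?thesis using \<kappa>0[of r] D by simp
  qed
  note ibp = W1_radial_ibp[OF W s0 m d \<kappa>0 b1 b2]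
  have eqA: "(p x)\<^sup>2 * (real DIM('a) * \<kappa> (norm x) + norm x * \<kappa>' (norm x)) = A x" for x
    by (simp add: A_def \<kappa>_def \<kappa>'_def rho_rad indicator_def algebra_simps)
  have eqB: "2 * \<kappa> (norm x) * (p x * (g x \<bullet> x)) = B x" for x
    by (simp add: B_def \<kappa>_def rho_rad indicator_def)
  show "integrable lborel A" "integrable lborel B" "(LBINT x. A x) + (LBINT x. B x) = 0"
    using ibp unfolding eqA eqB by auto
qed

section \<open>The deficit in Euclidean terms\<close>

text \<open>The locale fixes a Borel representative of a function and of its Euclidean weak gradient, both extended by
  zero. In Lebesgue terms the hyperbolic volume has density \<open>wt\<^sup>N\<close> and the Dirichlet energy \<open>wt\<^sup>N\<^sup>-\<^sup>2\<close>.\<close>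
locale finite_energy =
  fixes U :: "'a::euclidean_space \<Rightarrow> real" and g :: "'a \<Rightarrow> 'a"
  assumes dim: "2 \<le> DIM('a)"
    and borel_U [measurable]: "U \<in> borel_measurable borel"
    and borel_g [measurable]: "g \<in> borel_measurable borel"
    and U_outside: "\<And>x. x \<notin> ball 0 1 \<Longrightarrow> U x = 0"
    and g_outside: "\<And>x. x \<notin> ball 0 1 \<Longrightarrow> g x = 0"
    and W1: "W1 U g"
    and int_U: "integrable lborel (\<lambda>x. wt (norm x) ^ DIM('a) * (U x)\<^sup>2)"
    and int_rho: "integrable lborel (\<lambda>x. wt (norm x) ^ DIM('a) * ((rho x)\<^sup>2 * (U x)\<^sup>2))"
    and int_g: "integrable lborel (\<lambda>x. wt (norm x) ^ (DIM('a) - 2) * (norm (g x))\<^sup>2)"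
begin

text \<open>The hyperbolic Laplacian of \<open>\<rho>\<^sup>2 / 2\<close>. In the ball it equals the
  weight in \<open>heis_term\<close> by \<open>hyperbolic_weight\<close>, except at the origin,
  where division by zero makes it 1.\<close>

definition theta :: "'a \<Rightarrow> real" where
  "theta x = 1 + (real DIM('a) - 1) * (rho x / norm x * ((1 + (norm x)\<^sup>2) / 2))"

lemma borel_theta [measurable]: "theta \<in> borel_measurable borel"
  unfolding theta_def by measurable

definition energy :: real where
  "energy = (LBINT x. wt (norm x) ^ (DIM('a) - 2) * (norm (g x))\<^sup>2)"

definition moment :: real where
  "moment = (LBINT x. wt (norm x) ^ DIM('a) * ((rho x)\<^sup>2 * (U x)\<^sup>2))"

definition heis :: real where
  "heis = (LBINT x. wt (norm x) ^ DIM('a) * (theta x * (U x)\<^sup>2))"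

lemma wt_power_Suc: "wt r ^ DIM('a) = wt r * wt r ^ (DIM('a) - 1)" "wt r ^ DIM('a) = (wt r)\<^sup>2 * wt r ^ (DIM('a) - 2)"
  "wt r ^ (DIM('a) - 1) = wt r * wt r ^ (DIM('a) - 2)"
proof -
  define n where "n = DIM('a) - 2"
  have "DIM('a) = Suc (Suc n)" using dim by (simp add: n_def)
  then show "wt r ^ DIM('a) = wt r * wt r ^ (DIM('a) - 1)" "wt r ^ DIM('a) = (wt r)\<^sup>2 * wt r ^ (DIM('a) - 2)"
    "wt r ^ (DIM('a) - 1) = wt r * wt r ^ (DIM('a) - 2)"
    by (simp_all add: power2_eq_square mult.assoc)
qed

lemma wt_pos: "x \<in> ball 0 1 \<Longrightarrow> 1 \<le> wt (norm x)" "x \<in> ball 0 1 \<Longrightarrow> 0 < wt (norm x)"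
  using wt_ge_2[of "norm x"] by auto

text \<open>The quotient is at most 8/3 near the origin, and for \<open>norm x > 1 / 2\<close> it is
  at most \<open>2 \<rho> \<le> 1 + \<rho>\<^sup>2\<close>. Hence the Heisenberg weight is
  controlled by the integrals of \<open>U\<^sup>2\<close> and
  \<open>\<rho>\<^sup>2 U\<^sup>2\<close>.\<close>

lemma rho_bound:
  fixes x :: 'a
  assumes "x \<in> ball 0 1"
  shows "0 \<le> rho x / norm x" "rho x / norm x * ((1 + (norm x)\<^sup>2) / 2) \<le> 3 + (rho x)\<^sup>2"
proof -
  define r where "r = norm x"
  have r: "0 \<le> r" "r < 1" using assms by (auto simp: r_def)
  have q0: "0 \<le> rad r / r" using rad_nonneg[OF r] r by simp
  have q1: "rad r / r \<le> 3 + (rad r)\<^sup>2"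
  proof (cases "r \<le> 1 / 2")
    case True
    have "rad r \<le> wt (1 / 2) * r" using rad_bounds(2)[of r "1 / 2"] r True by simp
    also have "wt (1 / 2) = 8 / 3" by (simp add: wt_def power2_eq_square)
    finally have "rad r / r \<le> 3" using r by (cases "r = 0") (auto simp: divide_le_eq)
    then show ?thesis using zero_le_power2[of "rad r"] by linarith
  next
    case False
    have "rad r / r \<le> rad r / (1 / 2)" using False rad_nonneg[OF r] by (intro divide_left_mono) auto
    moreover have "2 * rad r \<le> 1 + (rad r)\<^sup>2" using sum_squares_bound[of 1 "rad r"] by simp
    ultimately show ?thesis by simp
  qed
  have "r\<^sup>2 \<le> 1" using r by (simp add: power_le_one)
  then have "rad r / r * ((1 + r\<^sup>2) / 2) \<le> rad r / r * 1" using q0 by (intro mult_left_mono) auto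
  with q0 q1 show "0 \<le> rho x / norm x" "rho x / norm x * ((1 + (norm x)\<^sup>2) / 2) \<le> 3 + (rho x)\<^sup>2"
    by (simp_all add: rho_rad r_def)
qed

lemma theta_bounds:
  assumes "x \<in> ball 0 1"
  shows "1 \<le> theta x" "theta x \<le> real DIM('a) * (3 + (rho x)\<^sup>2)"
proof -
  define q where "q = rho x / norm x * ((1 + (norm x)\<^sup>2) / 2)"
  have q: "0 \<le> q" "q \<le> 3 + (rho x)\<^sup>2"
    unfolding q_def by (intro mult_nonneg_nonneg rho_bound[OF assms]; simp)+
  have th: "theta x = 1 + (real DIM('a) - 1) * q" by (simp add: theta_def q_def)
  have N: "0 \<le> real DIM('a) - 1" using dim by simp
  then show "1 \<le> theta x" using q(1) unfolding th by simp
  have "(real DIM('a) - 1) * q \<le> (real DIM('a) - 1) * (3 + (rho x)\<^sup>2)" using N q(2) by (intro mult_left_mono) auto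
  then show "theta x \<le> real DIM('a) * (3 + (rho x)\<^sup>2)"
  proof -
    have "real DIM('a) * (3 + (rho x)\<^sup>2) = (real DIM('a) - 1) * (3 + (rho x)\<^sup>2) + (3 + (rho x)\<^sup>2)"
      by (simp add: left_diff_distrib)
    with \<open>(real DIM('a) - 1) * q \<le> _\<close> show ?thesis
      unfolding th using zero_le_power2[of "rho x"] by linarith
  qed
qed

lemma int_theta: "integrable lborel (\<lambda>x. wt (norm x) ^ DIM('a) * (theta x * (U x)\<^sup>2))"
proof (rule Bochner_Integration.integrable_bound)
  show "integrable lborel (\<lambda>x. 3 * real DIM('a) * (wt (norm x) ^ DIM('a) * (U x)\<^sup>2)
      + real DIM('a) * (wt (norm x) ^ DIM('a) * ((rho x)\<^sup>2 * (U x)\<^sup>2)))"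
    using int_U int_rho by simp
  show "AE x in lborel. norm (wt (norm x) ^ DIM('a) * (theta x * (U x)\<^sup>2))
    \<le> norm (3 * real DIM('a) * (wt (norm x) ^ DIM('a) * (U x)\<^sup>2)
      + real DIM('a) * (wt (norm x) ^ DIM('a) * ((rho x)\<^sup>2 * (U x)\<^sup>2)))"
  proof (rule AE_I2)
    fix x :: 'a
    show "norm (wt (norm x) ^ DIM('a) * (theta x * (U x)\<^sup>2))
    \<le> norm (3 * real DIM('a) * (wt (norm x) ^ DIM('a) * (U x)\<^sup>2)
      + real DIM('a) * (wt (norm x) ^ DIM('a) * ((rho x)\<^sup>2 * (U x)\<^sup>2)))"
    proof (cases "x \<in> ball 0 1")
      case True
      define c where "c = wt (norm x) ^ DIM('a) * (U x)\<^sup>2"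
      have c: "0 \<le> c" using wt_pos(2)[OF True] by (simp add: c_def)
      have "c * theta x \<le> c * (real DIM('a) * (3 + (rho x)\<^sup>2))"
        using c theta_bounds(2)[OF True] by (rule mult_left_mono[rotated])
      moreover have "0 \<le> c * theta x" using c theta_bounds(1)[OF True] by simp
      moreover have eq: "wt (norm x) ^ DIM('a) * (theta x * (U x)\<^sup>2) = c * theta x"
        "3 * real DIM('a) * (wt (norm x) ^ DIM('a) * (U x)\<^sup>2)
          + real DIM('a) * (wt (norm x) ^ DIM('a) * ((rho x)\<^sup>2 * (U x)\<^sup>2)) = c * (real DIM('a) * (3 + (rho x)\<^sup>2))"
        by (simp_all add: c_def algebra_simps)
      ultimately show ?thesis unfolding eq by simp
    qed (simp add: U_outside)
  qed
qed measurable

text \<open>The Lebesgue density of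
  \<open>u \<rho> \<langle>\<nabla>u, \<nabla>\<rho>\<rangle> dV\<close>: the volume contributes N
  powers of \<open>wt\<close>, the inverse metric -2, and the Euclidean gradient of \<rho>, which is
  \<open>wt (norm x) *\<^sub>R sgn x\<close>, one more.\<close>

definition cross :: "'a \<Rightarrow> real" where
  "cross x = wt (norm x) ^ (DIM('a) - 1) * (rho x * U x * (g x \<bullet> sgn x))"

lemma borel_cross [measurable]: "cross \<in> borel_measurable borel"
  unfolding cross_def sgn_div_norm by measurable

lemma int_cross: "integrable lborel cross"
proof -
  have le: "\<bar>2 * cross x\<bar>
    \<le> wt (norm x) ^ DIM('a) * ((rho x)\<^sup>2 * (U x)\<^sup>2) + wt (norm x) ^ (DIM('a) - 2) * (norm (g x))\<^sup>2" for x
  proof (cases "x \<in> ball 0 1")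
    case True
    define c where "c = wt (norm x) ^ (DIM('a) - 2)"
    \<comment> \<open>One factor \<open>wt\<close> goes to \<open>rho x * U x\<close>, so that the
      two squares in the arithmetic-geometric mean inequality are the densities of moment and
      energy.\<close>
    define s where "s = wt (norm x) * \<bar>rho x * U x\<bar>"
    have c: "0 \<le> c" using wt_pos(2)[OF True] by (simp add: c_def)
    have "norm (sgn x) \<le> 1" by (simp add: norm_sgn)
    then have "\<bar>g x \<bullet> sgn x\<bar> \<le> norm (g x) * 1"
      by (intro order_trans[OF Cauchy_Schwarz_ineq2] mult_left_mono) auto
    then have "2 * c * (s * \<bar>g x \<bullet> sgn x\<bar>) \<le> 2 * c * (s * norm (g x))"
      using c wt_pos(2)[OF True] by (intro mult_left_mono) (auto simp: s_def)
    also have "\<dots> = c * (2 * s * norm (g x))" by simp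
    also have "\<dots> \<le> c * (s\<^sup>2 + (norm (g x))\<^sup>2)" using c by (intro mult_left_mono sum_squares_bound)
    finally have "2 * c * (s * \<bar>g x \<bullet> sgn x\<bar>) \<le> c * (s\<^sup>2 + (norm (g x))\<^sup>2)" .
    moreover have "\<bar>2 * cross x\<bar> = 2 * c * (s * \<bar>g x \<bullet> sgn x\<bar>)"
      using wt_pos(2)[OF True] unfolding cross_def wt_power_Suc(3) by (simp add: c_def s_def abs_mult)
    moreover have "wt (norm x) ^ DIM('a) * ((rho x)\<^sup>2 * (U x)\<^sup>2) = c * s\<^sup>2"
      unfolding wt_power_Suc(2) by (simp add: c_def s_def power_mult_distrib)
    ultimately show ?thesis by (simp add: c_def distrib_left)
  qed (simp add: cross_def U_outside g_outside)
  have "integrable lborel (\<lambda>x. 2 * cross x)"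
  proof (rule Bochner_Integration.integrable_bound)
    show "integrable lborel (\<lambda>x. wt (norm x) ^ DIM('a) * ((rho x)\<^sup>2 * (U x)\<^sup>2) + wt (norm x) ^ (DIM('a) - 2) * (norm (g x))\<^sup>2)"
      using int_rho int_g by simp
  next
    show "AE x in lborel. norm (2 * cross x)
      \<le> norm (wt (norm x) ^ DIM('a) * ((rho x)\<^sup>2 * (U x)\<^sup>2) + wt (norm x) ^ (DIM('a) - 2) * (norm (g x))\<^sup>2)"
      using order_trans[OF le abs_ge_self] by (intro AE_I2) (simp only: real_norm_def)
  qed measurable
  then show "integrable lborel cross" by simp
qed

text \<open>Integrates \<open>u\<^sup>2 div (\<rho> \<nabla>\<rho>) + 2 u \<rho> \<langle>\<nabla>u, \<nabla>\<rho>\<rangle>\<close>; no boundary term survives because \<open>\<rho>\<close> times the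
  gradient of the cutoff stays bounded.\<close>
lemma heis_eq: "heis = - 2 * (LBINT x. cross x)"
proof -
  define n where "n = DIM('a) - 1"
  have n: "DIM('a) = Suc n" using dim by (simp add: n_def)
  \<comment> \<open>The coefficient of x in \<rho> \<nabla>\<rho> times the volume density; the
    exponent is N - 1 because the hyperbolic gradient of \<rho> carries one inverse power of
    \<open>wt\<close>.\<close>
  define a where "a = (\<lambda>r. rad r / r * wt r ^ n)"
  define a' where "a' = (\<lambda>r. (wt r * r - rad r) / (r * r) * wt r ^ n + rad r / r * (real n * r * wt r ^ Suc n))"
  have meas [measurable]: "a \<in> borel_measurable borel" "a' \<in> borel_measurable borel"
    unfolding a_def a'_def by measurable
  have dwt: "(wt has_real_derivative r * (wt r)\<^sup>2) (at r)" if "0 < r" "r < 1" for r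
  proof -
    have "1 - r\<^sup>2 \<noteq> 0" using one_minus_square_pos[of r] that by simp
    then show ?thesis unfolding wt_def by (auto intro!: derivative_eq_intros simp: power2_eq_square)
  qed
  have dwtn: "((\<lambda>r. wt r ^ n) has_real_derivative real n * r * wt r ^ Suc n) (at r)" if "0 < r" "r < 1" for r
    by (rule DERIV_cong[OF DERIV_power[OF dwt[OF that]]]) (cases n; simp add: power2_eq_square mult_ac)
  have da: "(a has_real_derivative a' r) (at r)" if r: "0 < r" "r < 1" for r
  proof -
    have "((\<lambda>r. rad r / r) has_real_derivative (wt r * r - rad r) / (r * r)) (at r)"
      using DERIV_divide[OF rad_has_derivative DERIV_ident] r by simp
    from DERIV_mult[OF this dwtn[OF r]] show ?thesis unfolding a_def a'_def by (simp add: mult.commute)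
  qed
  have q: "0 \<le> rad r / r" "rad r / r \<le> wt s" if "0 \<le> r" "r \<le> s" "s < 1" for r s
    using that rad_bounds[OF that] wt_ge_2[of s] by (auto simp: divide_le_eq)
  \<comment> \<open>At r = 0 the left side is 0, whereas the general expression would be
    \<open>wt 0 ^ Suc n\<close>, as \<open>rad 0 / 0\<close> is 0.\<close>
  have ra': "r * a' r = (if r = 0 then 0 else (wt r - rad r / r) * wt r ^ n + rad r / r * (real n * r\<^sup>2 * wt r ^ Suc n))" for r
    by (simp add: a'_def divide_simps power2_eq_square)
  have bounds: "\<exists>C. \<forall>r. 0 \<le> r \<and> r \<le> s \<longrightarrow> \<bar>a r\<bar> \<le> C \<and> \<bar>r * a' r\<bar> \<le> C" if s: "0 < s" "s < 1" for s
  proof -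
    define W where "W = wt s"
    have W: "2 \<le> W" using wt_ge_2[of s] s by (simp add: W_def)
    define C where "C = W * W ^ n + W * (real n * 1 * W ^ Suc n)"
    have C1: "0 \<le> W * (real n * 1 * W ^ Suc n)" "0 \<le> W * W ^ n" using W by auto
    have "\<bar>a r\<bar> \<le> C \<and> \<bar>r * a' r\<bar> \<le> C" if r: "0 \<le> r" "r \<le> s" for r
    proof -
      have w: "2 \<le> wt r" "wt r \<le> W" using r s wt_ge_2[of r] wt_mono[of r s] by (auto simp: W_def)
      have wn: "0 \<le> wt r ^ k" "wt r ^ k \<le> W ^ k" for k using w by (auto intro: power_mono)
      note q' = q[OF r s(2), folded W_def]
      have "\<bar>a r\<bar> = rad r / r * wt r ^ n" unfolding a_def using q' wn by (intro abs_of_nonneg mult_nonneg_nonneg) auto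
      also have "\<dots> \<le> W * W ^ n" using q' wn W by (intro mult_mono) auto
      finally have A: "\<bar>a r\<bar> \<le> C" using C1 unfolding C_def by linarith
      have "\<bar>(wt r - rad r / r) * wt r ^ n\<bar> \<le> W * W ^ n"
        unfolding abs_mult using q' w wn[of n] q(2)[of r r] r s by (intro mult_mono) auto
      moreover have "\<bar>rad r / r * (real n * r\<^sup>2 * wt r ^ Suc n)\<bar> \<le> W * (real n * 1 * W ^ Suc n)"
        unfolding abs_mult using q' w wn(1)[of n] wn(2)[of "Suc n"] r s W
        by (intro mult_mono) (auto simp: power_le_one abs_mult[symmetric] mult_mono)
      ultimately have "\<bar>(wt r - rad r / r) * wt r ^ n + rad r / r * (real n * r\<^sup>2 * wt r ^ Suc n)\<bar> \<le> C"
        unfolding C_def by (intro order_trans[OF abs_triangle_ineq] add_mono)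
      moreover have "0 \<le> C" using C1 by (simp add: C_def)
      ultimately have "\<bar>r * a' r\<bar> \<le> C" unfolding ra' by (split if_split, intro conjI impI) (simp_all only: abs_zero)
      with A show ?thesis ..
    qed
    then show ?thesis by blast
  qed
  \<comment> \<open>Hyperbolic radius k + 1, so that k = 0 causes no division by zero.\<close>
  define c where "c = (\<lambda>k (x::'a). cutoff (rho x / real (Suc k)))"
  define c' where "c' = (\<lambda>k (x::'a). rho x / real (Suc k) * cutoff' (rho x / real (Suc k)))"
  define A where "A = (\<lambda>k x. wt (norm x) ^ DIM('a) * (U x)\<^sup>2 * (theta x * c k x + c' k x))"
  define B where "B = (\<lambda>k x. 2 * cross x * c k x)"
  \<comment> \<open>Only almost everywhere: at the origin \<open>a\<close> is 0 by convention while
    \<open>theta\<close> is 1.\<close>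
  have eqA: "AE x in lborel. indicator (ball 0 1) x * ((U x)\<^sup>2 * ((real DIM('a) * a (norm x) + norm x * a' (norm x)) * cutoff (rho x / real (Suc k))
      + a (norm x) * norm x * wt (norm x) * cutoff' (rho x / real (Suc k)) / real (Suc k))) = A k x" for k
    using AE_lborel_singleton[of "0::'a"]
  proof eventually_elim
    fix x :: 'a assume x: "x \<noteq> 0"
    show "indicator (ball 0 1) x * ((U x)\<^sup>2 * ((real DIM('a) * a (norm x) + norm x * a' (norm x)) * cutoff (rho x / real (Suc k))
      + a (norm x) * norm x * wt (norm x) * cutoff' (rho x / real (Suc k)) / real (Suc k))) = A k x"
    proof (cases "x \<in> ball 0 1")
      case True
      define r where "r = norm x"
      define q where "q = rad r / r"
      have r: "0 < r" "r < 1" using x True by (auto simp: r_def)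
      have cancel: "c / d * d = c" if "d \<noteq> 0" for c d :: real using that by simp
      \<comment> \<open>This relation turns \<open>1 + r\<^sup>2 * wt r\<close> into
        \<open>wt r * ((1 + r\<^sup>2) / 2)\<close>, which makes \<open>theta\<close>
        appear.\<close>
      have w: "wt r * (1 - r\<^sup>2) = 2"
        unfolding wt_def by (rule cancel) (use one_minus_square_pos[of r] r in simp)
      have "a r = q * wt r ^ n" by (simp add: a_def q_def)
      moreover have "r * a' r = (wt r - q) * wt r ^ n + q * (real n * r\<^sup>2 * (wt r * wt r ^ n))"
        using r unfolding ra' by (simp add: q_def)
      ultimately have "real DIM('a) * a r + r * a' r = wt r ^ n * (wt r + real n * q * (1 + r\<^sup>2 * wt r))"
        by (simp only: n) (simp add: algebra_simps)
      also have "1 + r\<^sup>2 * wt r = wt r * ((1 + r\<^sup>2) / 2)" using w by (simp add: algebra_simps)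
      also have "wt r ^ n * (wt r + real n * q * (wt r * ((1 + r\<^sup>2) / 2))) = wt r ^ DIM('a) * (1 + real n * (q * ((1 + r\<^sup>2) / 2)))"
        by (simp add: n algebra_simps)
      also have "1 + real n * (q * ((1 + r\<^sup>2) / 2)) = theta x"
        by (simp add: theta_def n rho_rad r_def q_def)
      finally have 1: "real DIM('a) * a r + r * a' r = wt r ^ DIM('a) * theta x" .
      have 2: "a r * r * wt r = wt r ^ DIM('a) * rad r" using r by (simp add: a_def n)
      have "(real DIM('a) * a r + r * a' r) * cutoff (rho x / real (Suc k)) + a r * r * wt r * cutoff' (rho x / real (Suc k)) / real (Suc k)
        = wt r ^ DIM('a) * (theta x * c k x + c' k x)"
        unfolding 1 2 by (simp add: c_def c'_def rho_rad r_def distrib_left)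
      then show ?thesis using True by (simp add: A_def r_def mult_ac)
    qed (simp add: A_def U_outside)
  qed
  have eqB: "indicator (ball 0 1) x * (2 * a (norm x) * cutoff (rho x / real (Suc k)) * (U x * (g x \<bullet> x))) = B k x" for k x
  proof (cases "x \<in> ball 0 1 \<and> x \<noteq> 0")
    case True
    then show ?thesis by (simp add: B_def cross_def c_def a_def n rho_rad sgn_div_norm divide_inverse)
  next
    case False
    then show ?thesis by (auto simp: B_def cross_def U_outside)
  qed
  have "(LBINT x. A k x) + (LBINT x. B k x) = 0" for k
  proof -
    have "(LBINT x. A k x) = (LBINT x. indicator (ball 0 1) x * ((U x)\<^sup>2 * ((real DIM('a) * a (norm x) + norm x * a' (norm x)) * cutoff (rho x / real (Suc k))
      + a (norm x) * norm x * wt (norm x) * cutoff' (rho x / real (Suc k)) / real (Suc k))))"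
    proof (rule integral_cong_AE)
      have [measurable]: "ball (0::'a) 1 \<in> sets borel" by simp
      show "A k \<in> borel_measurable lborel" unfolding A_def c_def c'_def by measurable
      show "(\<lambda>x. indicator (ball 0 1) x * ((U x)\<^sup>2 * ((real DIM('a) * a (norm x) + norm x * a' (norm x)) * cutoff (rho x / real (Suc k))
        + a (norm x) * norm x * wt (norm x) * cutoff' (rho x / real (Suc k)) / real (Suc k)))) \<in> borel_measurable lborel"
        by measurable
    qed (use eqA[of k] in \<open>eventually_elim; simp\<close>)
    moreover have k: "0 < real (Suc k)" by simp
    note W1_cutoff_ibp(3)[OF W1 k meas da bounds, unfolded eqB]
    ultimately show ?thesis by (simp only:)
  qed
  moreover have "(\<lambda>k. (LBINT x. A k x) + (LBINT x. B k x)) \<longlonglongrightarrow>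
    heis + (LBINT x. 2 * cross x)"
  proof (rule tendsto_add)
    show "(\<lambda>k. LBINT x. A k x) \<longlonglongrightarrow> heis" unfolding heis_def
    proof (rule integral_dominated_convergence[where w = "\<lambda>x. wt (norm x) ^ DIM('a) * (theta x * (U x)\<^sup>2) + 4 * (wt (norm x) ^ DIM('a) * (U x)\<^sup>2)"])
      show "AE x in lborel. (\<lambda>k. A k x) \<longlonglongrightarrow> wt (norm x) ^ DIM('a) * (theta x * (U x)\<^sup>2)"
      proof (rule AE_I2)
        fix x :: 'a
        have "(\<lambda>k. wt (norm x) ^ DIM('a) * (U x)\<^sup>2 * (theta x * c k x + c' k x)) \<longlonglongrightarrow> wt (norm x) ^ DIM('a) * (U x)\<^sup>2 * (theta x * 1 + 0)"
          unfolding c_def c'_def by (intro tendsto_intros cutoff_limits)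
        then show "(\<lambda>k. A k x) \<longlonglongrightarrow> wt (norm x) ^ DIM('a) * (theta x * (U x)\<^sup>2)" by (simp add: A_def mult_ac)
      qed
      show "AE x in lborel. norm (A k x) \<le> wt (norm x) ^ DIM('a) * (theta x * (U x)\<^sup>2) + 4 * (wt (norm x) ^ DIM('a) * (U x)\<^sup>2)" for k
      proof (rule AE_I2)
        fix x :: 'a
        show "norm (A k x) \<le> wt (norm x) ^ DIM('a) * (theta x * (U x)\<^sup>2) + 4 * (wt (norm x) ^ DIM('a) * (U x)\<^sup>2)"
        proof (cases "x \<in> ball 0 1")
          case True
          define d where "d = wt (norm x) ^ DIM('a) * (U x)\<^sup>2"
          have d: "0 \<le> d" using wt_pos(2)[OF True] by (simp add: d_def)
          have "\<bar>theta x * c k x\<bar> \<le> theta x * 1"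
            unfolding abs_mult c_def using theta_bounds(1)[OF True] cutoff_bounds by (intro mult_mono) auto
          moreover have "\<bar>c' k x\<bar> \<le> 4" unfolding c'_def by (rule cutoff'_bounds)
          ultimately have "\<bar>theta x * c k x + c' k x\<bar> \<le> theta x + 4" by linarith
          then have "d * \<bar>theta x * c k x + c' k x\<bar> \<le> d * (theta x + 4)" using d by (rule mult_left_mono)
          then show ?thesis using d by (simp add: A_def d_def[symmetric] abs_mult) (simp add: d_def algebra_simps)
        qed (simp add: A_def U_outside)
      qed
      show "integrable lborel (\<lambda>x. wt (norm x) ^ DIM('a) * (theta x * (U x)\<^sup>2) + 4 * (wt (norm x) ^ DIM('a) * (U x)\<^sup>2))"
        using int_theta int_U by simp
    qed (unfold A_def c_def c'_def, measurable)
    show "(\<lambda>k. LBINT x. B k x) \<longlonglongrightarrow> (LBINT x. 2 * cross x)"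
    proof (rule integral_dominated_convergence[where w = "\<lambda>x. \<bar>2 * cross x\<bar>"])
      show "AE x in lborel. (\<lambda>k. B k x) \<longlonglongrightarrow> 2 * cross x"
      proof (rule AE_I2)
        fix x :: 'a
        have "(\<lambda>k. 2 * cross x * c k x)
          \<longlonglongrightarrow> 2 * cross x * 1"
          unfolding c_def by (intro tendsto_intros cutoff_limits)
        then show "(\<lambda>k. B k x) \<longlonglongrightarrow> 2 * cross x" by (simp add: B_def)
      qed
      show "AE x in lborel. norm (B k x) \<le> \<bar>2 * cross x\<bar>" for k
        unfolding B_def c_def real_norm_def
        by (intro AE_I2, subst abs_mult) (use cutoff_bounds in \<open>auto intro!: mult_left_le\<close>)
      show "integrable lborel (\<lambda>x. \<bar>2 * cross x\<bar>)"
        by (intro integrable_abs integrable_mult_right int_cross)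
    qed (unfold B_def c_def, measurable)
  qed
  ultimately have "0 = heis + (LBINT x. 2 * cross x)"
    by (simp add: LIMSEQ_const_iff)
  then show ?thesis by simp
qed

text \<open>With \<open>h\<close> the Gaussian of scale l > 0, this is \<open>h\<close> times the
  Euclidean gradient of \<open>U / h\<close>, since the Euclidean gradient of \<rho> is
  \<open>wt (norm x) *\<^sub>R sgn x\<close>.\<close>

definition shifted_gradient :: "real \<Rightarrow> 'a \<Rightarrow> 'a" where
  "shifted_gradient l x = g x + (rho x * wt (norm x) * U x / l\<^sup>2) *\<^sub>R sgn x"

lemma borel_shifted_gradient [measurable]: "shifted_gradient l \<in> borel_measurable borel"
  unfolding shifted_gradient_def sgn_div_norm by measurable

lemma shifted_energy:
  assumes "0 < l"
  shows "integrable lborel (\<lambda>x. wt (norm x) ^ (DIM('a) - 2) * (norm (shifted_gradient l x))\<^sup>2)"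
    and "(LBINT x. wt (norm x) ^ (DIM('a) - 2) * (norm (shifted_gradient l x))\<^sup>2)
      = energy + moment / l ^ 4 - heis / l\<^sup>2"
proof -
  have eq: "wt (norm x) ^ (DIM('a) - 2) * (norm (shifted_gradient l x))\<^sup>2
    = wt (norm x) ^ (DIM('a) - 2) * (norm (g x))\<^sup>2
      + (1 / l ^ 4) * (wt (norm x) ^ DIM('a) * ((rho x)\<^sup>2 * (U x)\<^sup>2))
      + (2 / l\<^sup>2) * cross x" for x
  proof -
    define t where "t = rho x * wt (norm x) * U x / l\<^sup>2"
    \<comment> \<open>\<open>sgn 0\<close> is not a unit vector, but \<open>rho 0 = 0\<close> makes
      t vanish there.\<close>
    have s: "t\<^sup>2 * (sgn x \<bullet> sgn x) = t\<^sup>2"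
      by (cases "x = 0") (auto simp: power2_norm_eq_inner[symmetric] norm_sgn t_def rho_rad)
    have "(norm (shifted_gradient l x))\<^sup>2 = (norm (g x))\<^sup>2 + 2 * t * (g x \<bullet> sgn x) + t\<^sup>2 * (sgn x \<bullet> sgn x)"
      unfolding shifted_gradient_def t_def[symmetric] power2_norm_eq_inner
      by (simp add: inner_add_left inner_add_right inner_commute power2_eq_square)
    then have "(norm (shifted_gradient l x))\<^sup>2 = (norm (g x))\<^sup>2 + 2 * t * (g x \<bullet> sgn x) + t\<^sup>2"
      unfolding s .
    then show ?thesis
      unfolding cross_def wt_power_Suc(2,3) by (simp add: t_def power_divide power_mult_distrib power4_eq_xxxx power2_eq_square algebra_simps)
  qed
  show "integrable lborel (\<lambda>x. wt (norm x) ^ (DIM('a) - 2) * (norm (shifted_gradient l x))\<^sup>2)"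
    unfolding eq by (intro Bochner_Integration.integrable_add integrable_mult_right int_g int_rho int_cross)
  have "(LBINT x. wt (norm x) ^ (DIM('a) - 2) * (norm (shifted_gradient l x))\<^sup>2)
    = energy + (1 / l ^ 4) * moment + (2 / l\<^sup>2) * (LBINT x. cross x)"
    unfolding eq using int_g int_rho int_cross
    by (subst Bochner_Integration.integral_add Bochner_Integration.integral_add,
        auto intro!: Bochner_Integration.integrable_add simp: energy_def moment_def)
  then show "(LBINT x. wt (norm x) ^ (DIM('a) - 2) * (norm (shifted_gradient l x))\<^sup>2)
      = energy + moment / l ^ 4 - heis / l\<^sup>2"
    by (simp add: heis_eq)
qed

end

section \<open>Distance to the Gaussians\<close>

lemma integrable_mult_bounded:
  fixes f a :: "'b \<Rightarrow> real"
  assumes f: "integrable M f" and [measurable]: "a \<in> borel_measurable M" and a: "\<And>x. \<bar>a x\<bar> \<le> C"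
  shows "integrable M (\<lambda>x. a x * f x)"
proof (rule Bochner_Integration.integrable_bound)
  show "integrable M (\<lambda>x. C * f x)" using f by simp
  show "(\<lambda>x. a x * f x) \<in> borel_measurable M" using f by measurable
  show "AE x in M. norm (a x * f x) \<le> norm (C * f x)"
    using a by (intro AE_I2) (auto simp: abs_mult intro!: mult_right_mono order_trans[OF a abs_ge_self])
qed

context finite_energy
begin

definition gauss :: "real \<Rightarrow> 'a \<Rightarrow> real" where
  "gauss l x = exp (- ((rho x)\<^sup>2 / (2 * l\<^sup>2)))"

lemma borel_gauss [measurable]: "gauss l \<in> borel_measurable borel"
  unfolding gauss_def by measurable

lemma gauss_bounds: "0 < gauss l x" "gauss l x \<le> 1"
  by (simp_all add: gauss_def)

lemma gauss_square: "(gauss l x)\<^sup>2 = exp (- (rad (norm x))\<^sup>2 / l\<^sup>2)"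
  by (simp add: gauss_def power2_eq_square exp_add[symmetric] rho_rad field_simps)

lemma gauss_antimono: "norm x \<le> norm y \<Longrightarrow> norm y < 1 \<Longrightarrow> (gauss l y)\<^sup>2 \<le> (gauss l x)\<^sup>2"
  unfolding gauss_square using rad_mono[of "norm x" "norm y"] rad_nonneg[of "norm x"]
  by (auto intro!: divide_right_mono power_mono)

text \<open>\<rho> itself has a conical singularity at the origin; its square is differentiable
  there by the bound \<open>\<rho> \<le> 3 * norm x\<close>. This is what makes the Gaussian
  differentiable on the whole ball.\<close>

lemma has_derivative_rho_square:
  fixes x :: 'a
  assumes x: "x \<in> ball 0 1"
  shows "((\<lambda>x. (rho x)\<^sup>2) has_derivative (\<lambda>v. (2 * rho x * wt (norm x)) *\<^sub>R sgn x \<bullet> v)) (at x)"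
proof (cases "x = 0")
  case True
  have "((\<lambda>x::'a. (rho x)\<^sup>2) has_derivative (\<lambda>v. 0)) (at 0)"
    unfolding has_derivative_at_alt
  proof (intro conjI allI impI)
    fix e :: real assume e: "0 < e"
    \<comment> \<open>1/2 secures the slope bound 8/3 \<le> 3, and e / 9 makes
      \<open>9 * norm y * norm y\<close> at most \<open>e * norm y\<close>.\<close>
    have "norm ((rho y)\<^sup>2) \<le> e * norm y" if y: "norm y < min (1 / 2) (e / 9)" for y :: 'a
    proof -
      have "rho y \<le> 3 * norm y"
      proof -
        have "rad (norm y) \<le> wt (1 / 2) * norm y" using rad_bounds(2)[of "norm y" "1 / 2"] y by simp
        also have "wt (1 / 2) = 8 / 3" by (simp add: wt_def power2_eq_square)
        finally show ?thesis using norm_ge_zero[of y] unfolding rho_rad by linarith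
      qed
      moreover have "0 \<le> rho y" using rad_nonneg[of "norm y"] y by (simp add: rho_rad)
      ultimately have "(rho y)\<^sup>2 \<le> (3 * norm y)\<^sup>2" by (intro power_mono)
      also have "\<dots> = 9 * norm y * norm y" by (simp add: power2_eq_square)
      also have "\<dots> \<le> e * norm y" using y by (intro mult_right_mono) auto
      finally show ?thesis by simp
    qed
    then show "\<exists>d>0. \<forall>y::'a. norm (y - 0) < d \<longrightarrow> norm ((rho y)\<^sup>2 - (rho (0::'a))\<^sup>2 - 0) \<le> e * norm (y - 0)"
      using e by (intro exI[of _ "min (1 / 2) (e / 9)"]) (auto simp: rho_rad)
  qed simp
  then show ?thesis using True by simp
next
  case False
  have "(norm has_derivative (\<lambda>v. v \<bullet> sgn x)) (at x)" using has_derivative_norm[OF False] by simp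
  from has_derivative_compose[OF this rad_has_derivative[of "norm x", unfolded has_field_derivative_def]]
  have "((\<lambda>x. rho x) has_derivative (\<lambda>v. wt (norm x) * (v \<bullet> sgn x))) (at x)"
    using x by (simp add: rho_rad)
  from has_derivative_power[OF this, of 2] show ?thesis
    by (simp add: inner_commute mult_ac)
qed

text \<open>\<open>sgn\<close> jumps at the origin, but it is bounded and the factor \<rho> tends to
  0.\<close>

lemma continuous_rho_sgn: "continuous_on (ball 0 1) (\<lambda>x::'a. (rho x * wt (norm x)) *\<^sub>R sgn x)"
proof (rule continuous_at_imp_continuous_on, rule ballI)
  fix x :: 'a assume x: "x \<in> ball 0 1"
  have cw: "isCont (\<lambda>x::'a. wt (norm x)) x"
    unfolding wt_def using one_minus_square_pos[of "norm x"] x by (intro continuous_intros) auto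
  have "isCont rad (norm x)" using x by (intro DERIV_isCont[OF rad_has_derivative]) auto
  then have cn: "isCont (\<lambda>x. rad (norm x)) x"
    by (rule isCont_o2[OF isCont_norm[OF continuous_ident]])
  have cr: "isCont (\<lambda>x::'a. rho x *\<^sub>R sgn x) x"
  proof (cases "x = 0")
    case True
    have "((\<lambda>x::'a. rho x *\<^sub>R sgn x) \<longlongrightarrow> 0) (at 0)"
    proof (rule Lim_null_comparison)
      have "((\<lambda>x::'a. rad (norm x)) \<longlongrightarrow> 0) (at 0)" using cn True by (simp add: isCont_def)
      from tendsto_rabs_zero[OF this] show "((\<lambda>x::'a. \<bar>rho x\<bar>) \<longlongrightarrow> 0) (at 0)" by (simp add: rho_rad)
      show "\<forall>\<^sub>F x::'a in at 0. norm (rho x *\<^sub>R sgn x) \<le> \<bar>rho x\<bar>"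
        by (simp add: norm_sgn)
    qed
    then show ?thesis using True by (simp add: isCont_def)
  next
    case False
    have "isCont (\<lambda>x::'a. inverse (norm x) *\<^sub>R x) x" using False by (intro continuous_intros) auto
    with cn show ?thesis unfolding rho_rad sgn_div_norm by (rule continuous_scaleR)
  qed
  have "isCont (\<lambda>x. wt (norm x) *\<^sub>R (rho x *\<^sub>R sgn x)) x" by (intro continuous_intros cw cr)
  then show "isCont (\<lambda>x. (rho x * wt (norm x)) *\<^sub>R sgn x) x" by (simp add: mult.commute)
qed

text \<open>The reciprocal of the Gaussian is C1 in the open ball but, for l > 0, blows up at the
  sphere; the local notion \<open>W1\<close> tolerates this.\<close>

lemma W1_quotient: "W1 (\<lambda>x. inverse (gauss l x) * U x) (\<lambda>x. inverse (gauss l x) *\<^sub>R shifted_gradient l x)"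
proof -
  define m where "m = (\<lambda>x::'a. exp ((rho x)\<^sup>2 / (2 * l\<^sup>2)))"
  define m' where "m' = (\<lambda>x::'a. (m x / l\<^sup>2) *\<^sub>R ((rho x * wt (norm x)) *\<^sub>R sgn x))"
  have m: "inverse (gauss l x) = m x" for x by (simp add: gauss_def m_def exp_minus)
  have dm: "(m has_derivative (\<lambda>v. m' x \<bullet> v)) (at x)" if x: "x \<in> ball 0 1" for x
  proof -
    have "((\<lambda>x::'a. (rho x)\<^sup>2 * (1 / (2 * l\<^sup>2))) has_derivative (\<lambda>v. ((2 * rho x * wt (norm x)) *\<^sub>R sgn x \<bullet> v) * (1 / (2 * l\<^sup>2)))) (at x)"
      by (rule has_derivative_mult_left[OF has_derivative_rho_square[OF x]])
    from has_derivative_exp[OF this] show ?thesis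
      by (simp add: m_def m'_def mult_ac)
  qed
  have "continuous_on (ball 0 1) m"
    by (intro continuous_at_imp_continuous_on ballI has_derivative_continuous[OF dm])
  then have "continuous_on (ball 0 1) m'"
    unfolding m'_def by (intro continuous_on_scaleR continuous_rho_sgn) (simp add: divide_inverse, intro continuous_intros)
  from W1_mult[OF W1 dm this] have "W1 (\<lambda>x. m x * U x) (\<lambda>x. m x *\<^sub>R g x + U x *\<^sub>R m' x)" .
  moreover have "m x *\<^sub>R g x + U x *\<^sub>R m' x = m x *\<^sub>R shifted_gradient l x" for x
    by (simp add: shifted_gradient_def m'_def scaleR_add_right mult_ac)
  ultimately show ?thesis by (simp add: m)
qed

section \<open>The Poincare inequality at scale l\<close>

lemma int_U2: "integrable lborel (\<lambda>x. (U x)\<^sup>2)"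
  by (rule integrable_of_weighted[OF int_U]) (auto simp: U_outside)

text \<open>In terms of \<open>v = U / h\<close> this is the integral of
  \<open>|\<nabla>v|\<^sup>2 h\<^sup>2\<close> over the ball, the quantity on the right of the
  Poincare inequality.\<close>

definition lenergy :: "real \<Rightarrow> real" where
  "lenergy l = (LBINT x. (norm (shifted_gradient l x))\<^sup>2)"

lemma lenergy_le:
  assumes "0 < l"
  shows "integrable lborel (\<lambda>x. (norm (shifted_gradient l x))\<^sup>2)"
    and "lenergy l \<le> energy + moment / l ^ 4 - heis / l\<^sup>2"
proof -
  have le: "(norm (shifted_gradient l x))\<^sup>2 \<le> wt (norm x) ^ (DIM('a) - 2) * (norm (shifted_gradient l x))\<^sup>2" for x
  proof (cases "x \<in> ball 0 1")
    case True
    have "1 \<le> wt (norm x) ^ (DIM('a) - 2)" using wt_pos(1)[OF True] by (rule one_le_power)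
    then show ?thesis using mult_right_mono[of 1 "wt (norm x) ^ (DIM('a) - 2)" "(norm (shifted_gradient l x))\<^sup>2"] by simp
  qed (simp add: shifted_gradient_def U_outside g_outside)
  show i: "integrable lborel (\<lambda>x. (norm (shifted_gradient l x))\<^sup>2)"
    by (rule integrable_of_weighted[OF shifted_energy(1)[OF assms]])
       (auto simp: shifted_gradient_def U_outside g_outside)
  have "lenergy l \<le> (LBINT x. wt (norm x) ^ (DIM('a) - 2) * (norm (shifted_gradient l x))\<^sup>2)"
    unfolding lenergy_def by (intro integral_mono i shifted_energy(1)[OF assms] le)
  then show "lenergy l \<le> energy + moment / l ^ 4 - heis / l\<^sup>2" unfolding shifted_energy(2)[OF assms] .
qed

text \<open>The weighted inequality for \<open>v = U / h\<close> with weight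
  \<open>h\<^sup>2\<close>: the products collapse to \<open>U\<^sup>2\<close>, \<open>h U\<close>
  and the shifted gradient. The case R = 1 is a limit from inside, as \<open>W1\<close> speaks of
  smaller balls only.\<close>

lemma inner_poincare:
  assumes l: "0 < l" and R: "0 < R" "R \<le> 1"
  shows "(LBINT x. indicator (ball 0 R) x * (gauss l x)\<^sup>2) * (LBINT x. indicator (ball 0 R) x * (U x)\<^sup>2)
      - (LBINT x. indicator (ball 0 R) x * (gauss l x * U x))\<^sup>2
    \<le> 2 * R\<^sup>2 * 2 ^ DIM('a) * measure lborel (ball (0::'a) R) * lenergy l"
proof -
  note iG = lenergy_le(1)[OF l]
  have [measurable]: "ball (0::'a) s \<in> sets borel" for s by simp
  define P where "P = (\<lambda>s. (LBINT x. indicator (ball 0 s) x * (gauss l x)\<^sup>2) * (LBINT x. indicator (ball 0 s) x * (U x)\<^sup>2)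
      - (LBINT x. indicator (ball 0 s) x * (gauss l x * U x))\<^sup>2)"
  have E0: "0 \<le> lenergy l" by (simp add: lenergy_def)
  have small: "P s \<le> 2 * s\<^sup>2 * 2 ^ DIM('a) * measure lborel (ball (0::'a) s) * lenergy l" if s: "0 < s" "s < 1" for s
  proof -
    let ?f = "\<lambda>x. (gauss l x)\<^sup>2"
    have 1: "indicator (ball 0 s) x * ?f x * (inverse (gauss l x) * U x)\<^sup>2 = indicator (ball 0 s) x * (U x)\<^sup>2"
      "indicator (ball 0 s) x * ?f x * (inverse (gauss l x) * U x) = indicator (ball 0 s) x * (gauss l x * U x)"
      "indicator (ball 0 s) x * ?f x * (norm (inverse (gauss l x) *\<^sub>R shifted_gradient l x))\<^sup>2
        = indicator (ball 0 s) x * (norm (shifted_gradient l x))\<^sup>2" for x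
      using gauss_bounds(1)[of l x] by (simp_all add: power_mult_distrib power2_eq_square field_simps)
    have "P s \<le> 2 * s\<^sup>2 * 2 ^ DIM('a) * measure lborel (ball (0::'a) s)
        * (LBINT x. indicator (ball 0 s) x * (norm (shifted_gradient l x))\<^sup>2)"
      unfolding P_def 1[symmetric]
    proof (rule W1_weighted_poincare[OF W1_quotient s])
      show "?f x \<le> 1" for x using gauss_bounds[of l x] by (simp add: power_le_one)
    qed (use gauss_antimono in auto)
    also have "\<dots> \<le> 2 * s\<^sup>2 * 2 ^ DIM('a) * measure lborel (ball (0::'a) s) * lenergy l"
    proof (rule mult_left_mono)
      show "(LBINT x. indicator (ball 0 s) x * (norm (shifted_gradient l x))\<^sup>2) \<le> lenergy l"
        unfolding lenergy_def by (intro integral_mono' iG) (auto simp: indicator_def)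
    qed simp
    finally show ?thesis .
  qed
  show ?thesis
  proof (cases "R < 1")
    case True
    then show ?thesis using small[OF R(1)] by (simp add: P_def)
  next
    case False
    then have R1: "R = 1" using R by simp
    define s where "s = (\<lambda>n. 1 - 1 / real (n + 2))"
    have s: "0 < s n" "s n < 1" for n by (auto simp: s_def field_simps)
    have s_lim: "s \<longlonglongrightarrow> 1"
    proof -
      have "(\<lambda>n. 1 - 1 / real (n + 2)) \<longlonglongrightarrow> 1 - 0"
        by (intro tendsto_diff tendsto_const LIMSEQ_ignore_initial_segment[OF lim_1_over_n, of 2])
      then show ?thesis by (simp add: s_def)
    qed
    have lim: "(\<lambda>n. LBINT x. indicator (ball 0 (s n)) x * f x) \<longlonglongrightarrow> (LBINT x. indicator (ball 0 1) x * f x)"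
      if f: "integrable lborel (\<lambda>x. indicator (ball 0 1) x * f x)" and [measurable]: "f \<in> borel_measurable borel" for f :: "'a \<Rightarrow> real"
    proof (rule integral_dominated_convergence[where w = "\<lambda>x. \<bar>indicator (ball 0 1) x * f x\<bar>"])
      show "AE x in lborel. (\<lambda>n. indicator (ball 0 (s n)) x * f x) \<longlonglongrightarrow> indicator (ball 0 1) x * f x"
      proof (rule AE_I2, rule tendsto_eventually)
        fix x :: 'a
        show "\<forall>\<^sub>F n in sequentially. indicator (ball 0 (s n)) x * f x = indicator (ball 0 1) x * f x"
        proof (cases "norm x < 1")
          case True
          from order_tendstoD(1)[OF s_lim True] show ?thesis
            by eventually_elim (use True in simp)
        next
          case False
          then have "\<not> norm x < s n" for n using s(2)[of n] by linarith
          then show ?thesis using False by simp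
        qed
      qed
      show "AE x in lborel. norm (indicator (ball 0 (s n)) x * f x) \<le> \<bar>indicator (ball 0 1) x * f x\<bar>" for n
        using s(2)[of n] by (intro AE_I2) (auto simp: indicator_def)
      show "integrable lborel (\<lambda>x. \<bar>indicator (ball 0 1) x * f x\<bar>)" using f by (rule integrable_abs)
    qed measurable
    have i1: "integrable lborel (\<lambda>x::'a. indicator (ball 0 1) x * (gauss l x)\<^sup>2)"
      by (rule integrable_bounded_support[of _ "ball 0 1" 1])
         (auto intro!: power_le_one simp: less_imp_le[OF gauss_bounds(1)] gauss_bounds(2))
    have i2: "integrable lborel (\<lambda>x. indicator (ball 0 1) x * (U x)\<^sup>2)"
      by (rule integrable_mult_bounded[OF int_U2, of _ 1]) auto
    have Ui: "integrable lborel U"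
      by (rule integrable_of_square_integrable[OF _ _ int_U2, of "ball 0 1"]) (use U_outside in auto)
    have "\<bar>indicator (ball 0 1) x * gauss l x\<bar> \<le> 1" for x
      using gauss_bounds[of l x] by (auto simp: indicator_def)
    then have "integrable lborel (\<lambda>x. (indicator (ball 0 1) x * gauss l x) * U x)"
      by (intro integrable_mult_bounded[OF Ui, of _ 1]) measurable
    then have i3: "integrable lborel (\<lambda>x. indicator (ball 0 1) x * (gauss l x * U x))" by (simp add: mult.assoc)
    have "(\<lambda>n. P (s n)) \<longlonglongrightarrow> P 1"
      unfolding P_def by (intro tendsto_diff tendsto_mult tendsto_power lim i1 i2 i3) measurable
    moreover have "P (s n) \<le> 2 * 1\<^sup>2 * 2 ^ DIM('a) * measure lborel (ball (0::'a) 1) * lenergy l" for n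
    proof -
      have "measure lborel (ball (0::'a) (s n)) \<le> measure lborel (ball (0::'a) 1)"
        using s(2)[of n] emeasure_lborel_finite[of "ball (0::'a) 1"]
        by (intro measure_mono_fmeasurable) (auto simp: fmeasurable_def)
      moreover have "(s n)\<^sup>2 \<le> 1\<^sup>2" using s[of n] by (intro power_mono) auto
      ultimately have "2 * (s n)\<^sup>2 * 2 ^ DIM('a) * measure lborel (ball (0::'a) (s n)) * lenergy l
        \<le> 2 * 1\<^sup>2 * 2 ^ DIM('a) * measure lborel (ball (0::'a) 1) * lenergy l"
        using E0 by (intro mult_mono) auto
      with small[OF s] show ?thesis by (rule order_trans)
    qed
    ultimately have "P 1 \<le> 2 * 1\<^sup>2 * 2 ^ DIM('a) * measure lborel (ball (0::'a) 1) * lenergy l"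
      by (intro LIMSEQ_le_const2) auto
    then show ?thesis unfolding R1 P_def .
  qed
qed

text \<open>Lyapunov estimate: integrating \<open>div (x |u - c h|\<^sup>2)\<close> confines the mass of \<open>u - c h\<close> to \<open>4 |x|\<^sup>2 < N l\<^sup>2\<close>.
  The boundary flux has a favourable sign, so no decay is required.\<close>
lemma lyapunov:
  assumes l: "0 < l"
  shows "integrable lborel (\<lambda>x. indicator (ball 0 1) x * (U x - c * gauss l x)\<^sup>2)"
    and "(LBINT x. indicator (ball 0 1) x * (4 * (norm x)\<^sup>2 / l\<^sup>2 - real DIM('a)) * (U x - c * gauss l x)\<^sup>2)
      \<le> l\<^sup>2 / 4 * lenergy l"
proof -
  have [measurable]: "ball (0::'a) s \<in> sets borel" for s by simp
  note iG = lenergy_le(1)[OF l]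
  define q where "q = (\<lambda>x. U x - c * gauss l x)"
  have [measurable]: "q \<in> borel_measurable borel" unfolding q_def by measurable
  have i_h: "integrable lborel (\<lambda>x::'a. (indicator (ball 0 1) x * (c * gauss l x))\<^sup>2)"
  proof (rule integrable_bounded_support[of _ "ball 0 1" "c\<^sup>2"])
    fix x :: 'a assume "x \<in> ball 0 1"
    have "(gauss l x)\<^sup>2 \<le> 1" using gauss_bounds[of l x] by (simp add: power_le_one)
    then show "\<bar>(indicator (ball 0 1) x * (c * gauss l x))\<^sup>2\<bar> \<le> c\<^sup>2"
      by (auto simp: indicator_def power_mult_distrib intro!: mult_left_le)
  qed auto
  have "integrable lborel (\<lambda>x. (U x - indicator (ball 0 1) x * (c * gauss l x))\<^sup>2)"
    by (rule square_integrable_diff[OF _ _ int_U2 i_h]) measurable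
  moreover have "(U x - indicator (ball 0 1) x * (c * gauss l x))\<^sup>2 = indicator (ball 0 1) x * (q x)\<^sup>2" for x
    using U_outside[of x] by (auto simp: q_def indicator_def)
  ultimately have iq: "integrable lborel (\<lambda>x. indicator (ball 0 1) x * (q x)\<^sup>2)" by simp
  then show "integrable lborel (\<lambda>x. indicator (ball 0 1) x * (U x - c * gauss l x)\<^sup>2)" by (simp add: q_def)
  \<comment> \<open>The radial identity is applied to p with coefficient \<open>a\<close>, the
    square of the Gaussian, so that \<open>a * p\<^sup>2\<close> becomes
    \<open>q\<^sup>2\<close>.\<close>
  define p where "p = (\<lambda>x. inverse (gauss l x) * U x - c)"
  define G where "G = (\<lambda>x. inverse (gauss l x) *\<^sub>R shifted_gradient l x)"
  have Wp: "W1 p G" unfolding p_def G_def by (intro W1_diff_const W1_quotient)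
  define a where "a = (\<lambda>r. exp (- (rad r)\<^sup>2 / l\<^sup>2))"
  define a' where "a' = (\<lambda>r. a r * (- (2 * rad r * wt r) / l\<^sup>2))"
  have meas [measurable]: "a \<in> borel_measurable borel" "a' \<in> borel_measurable borel"
    unfolding a_def a'_def by measurable
  have a1: "0 < a r" "a r \<le> 1" for r by (simp_all add: a_def)
  have da: "(a has_real_derivative a' r) (at r)" if "0 < r" "r < 1" for r
  proof -
    have "((\<lambda>r. - (rad r)\<^sup>2 / l\<^sup>2) has_real_derivative - (2 * rad r * wt r) / l\<^sup>2) (at r)"
      by (rule DERIV_cdivide) (use rad_has_derivative[of r] that in \<open>auto intro!: derivative_eq_intros\<close>)
    from DERIV_chain2[OF DERIV_exp this] show ?thesis by (simp only: a_def a'_def)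
  qed
  have bounds: "\<exists>C. \<forall>r. 0 \<le> r \<and> r \<le> s \<longrightarrow> \<bar>a r\<bar> \<le> C \<and> \<bar>r * a' r\<bar> \<le> C" if s: "0 < s" "s < 1" for s
  proof -
    define C where "C = 2 * (wt s * 1) * wt s / l\<^sup>2"
    have W: "2 \<le> wt s" using wt_ge_2[of s] s by simp
    have C: "0 \<le> C" using W by (simp add: C_def)
    have "\<bar>a r\<bar> \<le> 1 + C \<and> \<bar>r * a' r\<bar> \<le> 1 + C" if r: "0 \<le> r" "r \<le> s" for r
    proof -
      have w: "0 \<le> wt r" "wt r \<le> wt s" using r s wt_ge_2[of r] wt_mono[of r s] by auto
      have "rad r \<le> wt s * r" using rad_bounds(2)[OF r s(2)] .
      also have "\<dots> \<le> wt s * 1" using r s W by (intro mult_left_mono) auto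
      finally have rd: "0 \<le> rad r" "rad r \<le> wt s * 1" using rad_nonneg[of r] r s by auto
      have "2 * rad r * wt r \<le> 2 * (wt s * 1) * wt s" using rd w W by (intro mult_mono) auto
      then have b: "0 \<le> 2 * rad r * wt r / l\<^sup>2" "2 * rad r * wt r / l\<^sup>2 \<le> C"
        unfolding C_def using rd w by (auto intro!: divide_right_mono divide_nonneg_nonneg)
      have "\<bar>r * a' r\<bar> = r * (a r * (2 * rad r * wt r / l\<^sup>2))"
      proof -
        have "r * a' r = - (r * (a r * (2 * rad r * wt r / l\<^sup>2)))" by (simp add: a'_def)
        moreover have "0 \<le> r * (a r * (2 * rad r * wt r / l\<^sup>2))"
          by (rule mult_nonneg_nonneg[OF r(1) mult_nonneg_nonneg[OF less_imp_le[OF a1(1)] b(1)]])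
        ultimately show ?thesis by linarith
      qed
      also have "\<dots> \<le> 1 * (1 * C)"
        by (rule mult_mono[OF _ mult_mono[OF a1(2) b(2) zero_le_one b(1)] zero_le_one
              mult_nonneg_nonneg[OF less_imp_le[OF a1(1)] b(1)]]) (use r s in linarith)
      finally show ?thesis using C a1[of r] by simp
    qed
    then show ?thesis by blast
  qed
  define ct where "ct = (\<lambda>k (x::'a). cutoff (rho x / real (Suc k)))"
  \<comment> \<open>What is left after Young's inequality: the drift supplies at least
    \<open>8 r\<^sup>2 / l\<^sup>2\<close>, half of which absorbs the gradient term.\<close>
  define D where "D = (\<lambda>x::'a. indicator (ball 0 1) x * (real DIM('a) - 4 * (norm x)\<^sup>2 / l\<^sup>2) * (q x)\<^sup>2 + l\<^sup>2 / 4 * (norm (shifted_gradient l x))\<^sup>2)"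
  have [measurable]: "D \<in> borel_measurable borel" unfolding D_def by measurable
  have i1: "integrable lborel (\<lambda>x. indicator (ball 0 1) x * (real DIM('a) - 4 * (norm x)\<^sup>2 / l\<^sup>2) * (q x)\<^sup>2)"
  proof -
    have "integrable lborel (\<lambda>x. (indicator (ball 0 1) x * (real DIM('a) - 4 * (norm x)\<^sup>2 / l\<^sup>2)) * (indicator (ball 0 1) x * (q x)\<^sup>2))"
    proof (rule integrable_mult_bounded[OF iq, where C = "real DIM('a) + 4 / l\<^sup>2"])
      fix x :: 'a
      show "\<bar>indicator (ball 0 1) x * (real DIM('a) - 4 * (norm x)\<^sup>2 / l\<^sup>2)\<bar> \<le> real DIM('a) + 4 / l\<^sup>2"
      proof (cases "x \<in> ball 0 1")
        case True
        then have "(norm x)\<^sup>2 \<le> 1" by (simp add: power_le_one)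
        then have "0 \<le> 4 * (norm x)\<^sup>2 / l\<^sup>2" "4 * (norm x)\<^sup>2 / l\<^sup>2 \<le> 4 / l\<^sup>2"
          by (auto intro!: divide_right_mono)
        then have "\<bar>real DIM('a) - 4 * (norm x)\<^sup>2 / l\<^sup>2\<bar> \<le> real DIM('a) + 4 / l\<^sup>2" by linarith
        then show ?thesis using True by simp
      qed simp
    qed measurable
    then show ?thesis by (rule back_subst[of "integrable lborel"]) (auto simp: indicator_def)
  qed
  have iD: "integrable lborel D" unfolding D_def using i1 iG by simp
  have step: "0 \<le> (LBINT x. ct k x * D x)" for k
  proof -
    have k: "0 < real (Suc k)" by simp
    define A where "A = (\<lambda>x. indicator (ball 0 1) x * ((p x)\<^sup>2 * ((real DIM('a) * a (norm x) + norm x * a' (norm x)) * cutoff (rho x / real (Suc k))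
      + a (norm x) * norm x * wt (norm x) * cutoff' (rho x / real (Suc k)) / real (Suc k))))"
    define B where "B = (\<lambda>x. indicator (ball 0 1) x * (2 * a (norm x) * cutoff (rho x / real (Suc k)) * (p x * (G x \<bullet> x))))"
    note ibp = W1_cutoff_ibp[OF Wp k meas da bounds, folded A_def B_def]
    have ict: "integrable lborel (\<lambda>x. ct k x * D x)"
      by (rule integrable_mult_bounded[OF iD, where C = 1]) (auto simp: ct_def cutoff_bounds)
    have le: "A x + B x \<le> ct k x * D x" for x
    proof (cases "x \<in> ball 0 1")
      case True
      define r where "r = norm x"
      define t where "t = rho x / real (Suc k)"
      define y where "y = norm (shifted_gradient l x)"
      have r: "0 \<le> r" "r < 1" using True by (auto simp: r_def)
      have w: "2 \<le> wt r" using r by (rule wt_ge_2)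
      have rd: "2 * r \<le> rad r" using rad_bounds(1)[of r r] r by simp
      have ct: "0 \<le> cutoff t" by (rule cutoff_bounds)
      have t0: "0 \<le> t" using rad_nonneg[OF r] by (simp add: t_def rho_rad r_def)
      have a_eq: "a r = (gauss l x)\<^sup>2" by (simp add: a_def gauss_square r_def)
      have ap: "a r * (p x)\<^sup>2 = (q x)\<^sup>2"
      proof -
        have "gauss l x * p x = q x" using gauss_bounds(1)[of l x] by (simp add: p_def q_def right_diff_distrib mult.commute)
        then show ?thesis unfolding a_eq power_mult_distrib[symmetric] by simp
      qed
      have aB: "a r * (p x * (G x \<bullet> x)) = q x * (shifted_gradient l x \<bullet> x)"
        using gauss_bounds(1)[of l x] unfolding a_eq by (simp add: p_def q_def G_def power2_eq_square field_simps)
      have "A x = (q x)\<^sup>2 * ((real DIM('a) - r * (2 * rad r * wt r) / l\<^sup>2) * cutoff t + r * wt r * (cutoff' t / real (Suc k)))"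
        unfolding ap[symmetric] using True by (simp add: A_def a'_def r_def t_def algebra_simps)
      \<comment> \<open>The cutoff decreases along rays, so the term with its derivative is
        nonpositive and drops out of the upper bound.\<close>
      moreover have "cutoff' t \<le> 0" using t0 by (simp add: cutoff'_def)
      then have "r * wt r * (cutoff' t / real (Suc k)) \<le> 0"
        using r w by (intro mult_nonneg_nonpos divide_nonpos_pos) auto
      moreover have "(real DIM('a) - r * (2 * rad r * wt r) / l\<^sup>2) * cutoff t \<le> (real DIM('a) - 8 * r\<^sup>2 / l\<^sup>2) * cutoff t"
      proof (intro mult_right_mono diff_left_mono divide_right_mono ct)
        have "(2 * r) * 2 \<le> rad r * wt r" using rd w r by (intro mult_mono) auto
        then have "r * (2 * ((2 * r) * 2)) \<le> r * (2 * (rad r * wt r))" using r by (intro mult_left_mono) auto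
        then show "8 * r\<^sup>2 \<le> r * (2 * rad r * wt r)" by (simp add: power2_eq_square)
      qed simp
      ultimately have Ale: "A x \<le> (q x)\<^sup>2 * ((real DIM('a) - 8 * r\<^sup>2 / l\<^sup>2) * cutoff t)"
        by (simp only:) (intro mult_left_mono, linarith, simp)
      have "B x = cutoff t * (2 * (q x * (shifted_gradient l x \<bullet> x)))"
        unfolding aB[symmetric] using True by (simp add: B_def r_def t_def)
      also have "\<dots> \<le> cutoff t * (4 * r\<^sup>2 / l\<^sup>2 * (q x)\<^sup>2 + l\<^sup>2 / 4 * y\<^sup>2)"
      proof (rule mult_left_mono[OF _ ct])
        have "q x * (shifted_gradient l x \<bullet> x) \<le> \<bar>q x\<bar> * (y * r)"
        proof -
          have "\<bar>q x\<bar> * \<bar>shifted_gradient l x \<bullet> x\<bar> \<le> \<bar>q x\<bar> * (y * r)"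
            unfolding y_def r_def by (intro mult_left_mono Cauchy_Schwarz_ineq2) simp
          then show ?thesis unfolding abs_mult[symmetric] by linarith
        qed
        \<comment> \<open>Young's inequality with the weights chosen to spend exactly
          \<open>4 r\<^sup>2 / l\<^sup>2\<close> of the drift.\<close>
        moreover have "2 * (2 * r * \<bar>q x\<bar> / l) * (l * y / 2) \<le> (2 * r * \<bar>q x\<bar> / l)\<^sup>2 + (l * y / 2)\<^sup>2"
          by (rule sum_squares_bound)
        moreover have "2 * (2 * r * \<bar>q x\<bar> / l) * (l * y / 2) = 2 * (\<bar>q x\<bar> * (y * r))" using l by simp
        moreover have "(2 * r * \<bar>q x\<bar> / l)\<^sup>2 + (l * y / 2)\<^sup>2 = 4 * r\<^sup>2 / l\<^sup>2 * (q x)\<^sup>2 + l\<^sup>2 / 4 * y\<^sup>2"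
          by (simp add: power_mult_distrib power_divide)
        ultimately show "2 * (q x * (shifted_gradient l x \<bullet> x)) \<le> 4 * r\<^sup>2 / l\<^sup>2 * (q x)\<^sup>2 + l\<^sup>2 / 4 * y\<^sup>2" by linarith
      qed
      finally have Ble: "B x \<le> cutoff t * (4 * r\<^sup>2 / l\<^sup>2 * (q x)\<^sup>2 + l\<^sup>2 / 4 * y\<^sup>2)" .
      have "ct k x * D x = (q x)\<^sup>2 * ((real DIM('a) - 8 * r\<^sup>2 / l\<^sup>2) * cutoff t) + cutoff t * (4 * r\<^sup>2 / l\<^sup>2 * (q x)\<^sup>2 + l\<^sup>2 / 4 * y\<^sup>2)"
        using True by (simp add: ct_def D_def r_def t_def y_def algebra_simps)
      with Ale Ble show ?thesis by linarith
    next
      case False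
      then show ?thesis by (simp add: A_def B_def D_def ct_def cutoff_bounds)
    qed
    have "0 = (LBINT x. A x + B x)" using ibp by simp
    also have "\<dots> \<le> (LBINT x. ct k x * D x)"
      using ibp(1,2) ict le by (intro integral_mono) auto
    finally show ?thesis .
  qed
  have "(\<lambda>k. LBINT x. ct k x * D x) \<longlonglongrightarrow> (LBINT x. D x)"
  proof (rule integral_dominated_convergence[where w = "\<lambda>x. \<bar>D x\<bar>"])
    show "AE x in lborel. (\<lambda>k. ct k x * D x) \<longlonglongrightarrow> D x"
      using tendsto_mult[OF cutoff_limits(1) tendsto_const] by (intro AE_I2) (simp add: ct_def)
    show "AE x in lborel. norm (ct k x * D x) \<le> \<bar>D x\<bar>" for k
      using cutoff_bounds by (intro AE_I2) (auto simp: ct_def abs_mult intro!: mult_left_le_one_le)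
    show "integrable lborel (\<lambda>x. \<bar>D x\<bar>)" using iD by (rule integrable_abs)
  qed (unfold ct_def, measurable)
  then have D0: "0 \<le> (LBINT x. D x)" by (rule LIMSEQ_le_const) (use step in auto)
  have "(LBINT x. D x) = (LBINT x. indicator (ball 0 1) x * (real DIM('a) - 4 * (norm x)\<^sup>2 / l\<^sup>2) * (q x)\<^sup>2) + l\<^sup>2 / 4 * lenergy l"
    unfolding D_def lenergy_def using i1 iG by simp
  moreover have "(LBINT x. indicator (ball 0 1) x * (4 * (norm x)\<^sup>2 / l\<^sup>2 - real DIM('a)) * (q x)\<^sup>2)
    = - (LBINT x. indicator (ball 0 1) x * (real DIM('a) - 4 * (norm x)\<^sup>2 / l\<^sup>2) * (q x)\<^sup>2)"
    by (subst Bochner_Integration.integral_minus[symmetric]) (simp add: algebra_simps)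
  ultimately show "(LBINT x. indicator (ball 0 1) x * (4 * (norm x)\<^sup>2 / l\<^sup>2 - real DIM('a)) * (U x - c * gauss l x)\<^sup>2)
      \<le> l\<^sup>2 / 4 * lenergy l" using D0 by (simp add: q_def)
qed

text \<open>The Lyapunov estimate reduces the unit ball to the ball of radius R, where the inner
  Poincare inequality applies. Since \<open>R\<^sup>2 \<le> N l\<^sup>2 / 2\<close>, both
  contributions scale like \<open>l\<^sup>2\<close> with constants free of l.\<close>

lemma gaussian_distance:
  assumes l: "0 < l"
  shows "\<exists>c. (LBINT x. indicator (ball 0 1) x * (U x - c * gauss l x)\<^sup>2)
    \<le> (2 * real DIM('a) * 4 ^ DIM('a) * exp (9 * real DIM('a) / 8) + 1) * (l\<^sup>2 * lenergy l)"
proof -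
  let ?N = "real DIM('a)"
  have N: "2 \<le> ?N" using dim by simp
  have [measurable]: "ball (0::'a) s \<in> sets borel" for s by simp
  define E where "E = lenergy l"
  have E0: "0 \<le> E" by (simp add: E_def lenergy_def)
  \<comment> \<open>At \<open>norm x = l * sqrt (N / 2)\<close> the Lyapunov coefficient
    \<open>4 (norm x)\<^sup>2 / l\<^sup>2 - N\<close> equals N; it is larger beyond and never below
    -N. For large l the cap leaves nothing outside.\<close>
  define R where "R = min (l * sqrt (?N / 2)) 1"
  have R: "0 < R" "R \<le> 1" using l N by (auto simp: R_def)
  have R2: "R\<^sup>2 \<le> l\<^sup>2 * ?N / 2"
  proof -
    have "R\<^sup>2 \<le> (l * sqrt (?N / 2))\<^sup>2" using R by (intro power_mono) (auto simp: R_def)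
    then show ?thesis using N by (simp add: power_mult_distrib)
  qed
  define V where "V = measure lborel (ball (0::'a) R)"
  have V: "0 < V" using R by (simp add: V_def content_ball_pos)
  define m where "m = (LBINT x. indicator (ball (0::'a) R) x * (gauss l x)\<^sup>2)"
  define L where "L = (LBINT x. indicator (ball 0 R) x * (gauss l x * U x))"
  define P where "P = (LBINT x. indicator (ball 0 R) x * (U x)\<^sup>2)"
  have i1: "integrable lborel (\<lambda>x::'a. indicator (ball 0 R) x * (gauss l x)\<^sup>2)"
    by (rule integrable_bounded_support[of _ "ball 0 R" 1])
       (auto intro!: power_le_one simp: less_imp_le[OF gauss_bounds(1)] gauss_bounds(2))
  have i2: "integrable lborel (\<lambda>x. indicator (ball 0 R) x * (U x)\<^sup>2)"
    by (rule integrable_mult_bounded[OF int_U2, of _ 1]) auto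
  have Ui: "integrable lborel U"
    by (rule integrable_of_square_integrable[OF _ _ int_U2, of "ball 0 1"]) (use U_outside in auto)
  have "\<bar>indicator (ball 0 R) x * gauss l x\<bar> \<le> 1" for x
    using gauss_bounds[of l x] by (auto simp: indicator_def)
  then have "integrable lborel (\<lambda>x. (indicator (ball 0 R) x * gauss l x) * U x)"
    by (intro integrable_mult_bounded[OF Ui, of _ 1]) measurable
  then have i3: "integrable lborel (\<lambda>x. indicator (ball 0 R) x * (gauss l x * U x))" by (simp add: mult.assoc)
  \<comment> \<open>On the half ball \<rho> \<le> (8/3) norm x \<le> 3 R / 2, so
    \<open>\<rho>\<^sup>2 / l\<^sup>2 \<le> (9/4) (N/2) = 9 N / 8\<close>, whatever l is; the half
    ball has \<open>1 / 2 ^ N\<close> of the volume.\<close>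
  have m_ge: "exp (- (9 * ?N / 8)) * (V / 2 ^ DIM('a)) \<le> m"
  proof -
    have "exp (- (9 * ?N / 8)) * (V / 2 ^ DIM('a)) = exp (- (9 * ?N / 8)) * measure lborel (ball (0::'a) (R / 2))"
      using R by (simp add: V_def content_ball power_divide)
    also have "\<dots> = (LBINT x. exp (- (9 * ?N / 8)) * indicator (ball (0::'a) (R / 2)) x)" by simp
    also have "\<dots> \<le> m" unfolding m_def
    proof (rule integral_mono'[OF i1])
      fix x :: 'a
      show "exp (- (9 * ?N / 8)) * indicator (ball 0 (R / 2)) x \<le> indicator (ball 0 R) x * (gauss l x)\<^sup>2"
      proof (cases "x \<in> ball 0 (R / 2)")
        case True
        then have x: "norm x < R / 2" "norm x \<le> 1 / 2" using R by auto
        have "rad (norm x) \<le> wt (1 / 2) * norm x" using rad_bounds(2)[of "norm x" "1 / 2"] x by simp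
        also have "wt (1 / 2) = 8 / 3" by (simp add: wt_def power2_eq_square)
        finally have "rad (norm x) \<le> 3 * R / 2" using x norm_ge_zero[of x] by linarith
        moreover have "0 \<le> rad (norm x)" using x by (intro rad_nonneg) auto
        ultimately have "(rad (norm x))\<^sup>2 \<le> (3 * R / 2)\<^sup>2" by (intro power_mono)
        also have "\<dots> = 9 / 4 * R\<^sup>2" by (simp add: power2_eq_square)
        also have "\<dots> \<le> 9 / 4 * (l\<^sup>2 * ?N / 2)" by (intro mult_left_mono R2) simp
        finally have "(rad (norm x))\<^sup>2 / l\<^sup>2 \<le> 9 * ?N / 8" using l by (simp add: pos_divide_le_eq mult_ac)
        then show ?thesis using True R by (simp add: gauss_square)
      qed simp
    qed simp
    finally show ?thesis .
  qed
  have m0: "0 < m" using V by (intro less_le_trans[OF _ m_ge]) simp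
  \<comment> \<open>The best c on the inner ball: the mean of \<open>U / h\<close> for the weight
    \<open>h\<^sup>2\<close>.\<close>
  define c where "c = L / m"
  define q where "q = (\<lambda>x. U x - c * gauss l x)"
  have inner: "(LBINT x. indicator (ball 0 R) x * (q x)\<^sup>2) = (m * P - L\<^sup>2) / m"
    and iq: "integrable lborel (\<lambda>x. indicator (ball 0 R) x * (q x)\<^sup>2)"
  proof -
    have eq: "(\<lambda>x. indicator (ball 0 R) x * (q x)\<^sup>2) = (\<lambda>x. indicator (ball 0 R) x * (U x)\<^sup>2
        - 2 * c * (indicator (ball 0 R) x * (gauss l x * U x)) + c\<^sup>2 * (indicator (ball 0 R) x * (gauss l x)\<^sup>2))"
      by (auto simp: q_def power2_eq_square algebra_simps)
    show "integrable lborel (\<lambda>x. indicator (ball 0 R) x * (q x)\<^sup>2)"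
      unfolding eq using i1 i2 i3 by (intro Bochner_Integration.integrable_add Bochner_Integration.integrable_diff integrable_mult_right)
    have "(LBINT x. indicator (ball 0 R) x * (q x)\<^sup>2) = P - 2 * c * L + c\<^sup>2 * m"
      unfolding eq using i1 i2 i3 by (simp add: m_def L_def P_def)
    also have "\<dots> = (m * P - L\<^sup>2) / m" using m0 by (simp add: c_def power2_eq_square field_simps)
    finally show "(LBINT x. indicator (ball 0 R) x * (q x)\<^sup>2) = (m * P - L\<^sup>2) / m" .
  qed
  define I where "I = (LBINT x. indicator (ball 0 R) x * (q x)\<^sup>2)"
  \<comment> \<open>One factor \<open>2 ^ N\<close> is the Jacobian bound in the Poincare
    inequality, the other the volume ratio in the lower bound for m; together they give
    \<open>4 ^ N\<close>.\<close>
  have I_le: "I \<le> ?N * 4 ^ DIM('a) * exp (9 * ?N / 8) * (l\<^sup>2 * E)"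
  proof -
    have "m * P - L\<^sup>2 \<le> 2 * R\<^sup>2 * 2 ^ DIM('a) * V * E"
      unfolding m_def P_def L_def V_def E_def by (rule inner_poincare[OF l R])
    also have "\<dots> = 2 * R\<^sup>2 * 4 ^ DIM('a) * exp (9 * ?N / 8) * E * (exp (- (9 * ?N / 8)) * (V / 2 ^ DIM('a)))"
      by (simp add: exp_minus field_simps power_mult_distrib[symmetric])
    also have "\<dots> \<le> 2 * R\<^sup>2 * 4 ^ DIM('a) * exp (9 * ?N / 8) * E * m"
      using E0 by (intro mult_left_mono m_ge) auto
    finally have "I \<le> 2 * R\<^sup>2 * 4 ^ DIM('a) * exp (9 * ?N / 8) * E"
      unfolding I_def inner using m0 by (simp add: pos_divide_le_eq)
    also have "\<dots> = (R\<^sup>2) * (2 * 4 ^ DIM('a) * exp (9 * ?N / 8) * E)" by simp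
    also have "\<dots> \<le> (l\<^sup>2 * ?N / 2) * (2 * 4 ^ DIM('a) * exp (9 * ?N / 8) * E)"
      using E0 by (intro mult_right_mono R2) auto
    finally show ?thesis by (simp add: mult_ac)
  qed
  define J where "J = (LBINT x. indicator (ball 0 1) x * (q x)\<^sup>2)"
  have iJ: "integrable lborel (\<lambda>x. indicator (ball 0 1) x * (q x)\<^sup>2)"
    unfolding q_def by (rule lyapunov(1)[OF l])
  have iW: "integrable lborel (\<lambda>x. indicator (ball 0 1) x * (4 * (norm x)\<^sup>2 / l\<^sup>2 - ?N) * (q x)\<^sup>2)"
  proof -
    have "integrable lborel (\<lambda>x. (indicator (ball 0 1) x * (4 * (norm x)\<^sup>2 / l\<^sup>2 - ?N)) * (indicator (ball 0 1) x * (q x)\<^sup>2))"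
    proof (rule integrable_mult_bounded[OF iJ, where C = "?N + 4 / l\<^sup>2"])
      fix x :: 'a
      show "\<bar>indicator (ball 0 1) x * (4 * (norm x)\<^sup>2 / l\<^sup>2 - ?N)\<bar> \<le> ?N + 4 / l\<^sup>2"
      proof (cases "x \<in> ball 0 1")
        case True
        then have "(norm x)\<^sup>2 \<le> 1" by (simp add: power_le_one)
        then have "0 \<le> 4 * (norm x)\<^sup>2 / l\<^sup>2" "4 * (norm x)\<^sup>2 / l\<^sup>2 \<le> 4 / l\<^sup>2"
          by (auto intro!: divide_right_mono)
        then have "\<bar>4 * (norm x)\<^sup>2 / l\<^sup>2 - ?N\<bar> \<le> ?N + 4 / l\<^sup>2" using N by linarith
        then show ?thesis using True by simp
      qed simp
    qed measurable
    then show ?thesis by (rule back_subst[of "integrable lborel"]) (auto simp: indicator_def)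
  qed
  \<comment> \<open>Pointwise the Lyapunov coefficient is at least N outside the ball of radius R
    and at least N - 2 N inside it.\<close>
  have "(LBINT x. ?N * (indicator (ball 0 1) x * (q x)\<^sup>2) - 2 * ?N * (indicator (ball 0 R) x * (q x)\<^sup>2))
    \<le> (LBINT x. indicator (ball 0 1) x * (4 * (norm x)\<^sup>2 / l\<^sup>2 - ?N) * (q x)\<^sup>2)"
  proof (rule integral_mono[OF _ iW])
    fix x :: 'a
    show "?N * (indicator (ball 0 1) x * (q x)\<^sup>2) - 2 * ?N * (indicator (ball 0 R) x * (q x)\<^sup>2)
      \<le> indicator (ball 0 1) x * (4 * (norm x)\<^sup>2 / l\<^sup>2 - ?N) * (q x)\<^sup>2"
    proof (cases "x \<in> ball 0 R")
      case True
      have "- ?N * (q x)\<^sup>2 \<le> (4 * (norm x)\<^sup>2 / l\<^sup>2 - ?N) * (q x)\<^sup>2" by (intro mult_right_mono) auto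
      then show ?thesis using True R by simp
    next
      case False
      show ?thesis
      proof (cases "x \<in> ball 0 1")
        case x: True
        have "R = l * sqrt (?N / 2)" using x False by (auto simp: R_def min_def split: if_splits)
        then have "l * sqrt (?N / 2) \<le> norm x" using False by simp
        then have "(l * sqrt (?N / 2))\<^sup>2 \<le> (norm x)\<^sup>2" using l N by (intro power_mono) auto
        then have "2 * ?N * l\<^sup>2 \<le> 4 * (norm x)\<^sup>2" using N by (simp add: power_mult_distrib mult_ac)
        then have "2 * ?N \<le> 4 * (norm x)\<^sup>2 / l\<^sup>2" using l by (simp add: pos_le_divide_eq)
        then have "?N * (q x)\<^sup>2 \<le> (4 * (norm x)\<^sup>2 / l\<^sup>2 - ?N) * (q x)\<^sup>2" by (intro mult_right_mono) auto
        then show ?thesis using False x by simp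
      qed (use False R in auto)
    qed
  qed (use iJ iq in auto)
  also have "\<dots> \<le> l\<^sup>2 / 4 * E" unfolding q_def E_def by (rule lyapunov(2)[OF l])
  finally have "?N * J - 2 * ?N * I \<le> l\<^sup>2 * E / 4" using iJ iq by (simp add: J_def I_def)
  then have "?N * J \<le> 2 * ?N * I + ?N * (l\<^sup>2 * E)"
    using mult_right_mono[of "1 / 4" ?N "l\<^sup>2 * E"] N E0 by simp
  then have "?N * J \<le> ?N * (2 * I + l\<^sup>2 * E)" by (simp add: algebra_simps)
  then have "J \<le> 2 * I + l\<^sup>2 * E" using N by simp
  also have "\<dots> \<le> 2 * (?N * 4 ^ DIM('a) * exp (9 * ?N / 8) * (l\<^sup>2 * E)) + l\<^sup>2 * E" using I_le by simp
  also have "\<dots> = (2 * ?N * 4 ^ DIM('a) * exp (9 * ?N / 8) + 1) * (l\<^sup>2 * E)" by (simp add: algebra_simps)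
  finally show ?thesis unfolding J_def q_def E_def by blast
qed

section \<open>Choice of the scale and the degenerate cases\<close>

lemma energy_nonneg: "0 \<le> energy" "0 \<le> moment"
proof -
  have "0 \<le> wt (norm x) ^ k * (norm (g x))\<^sup>2" "0 \<le> wt (norm x) ^ k * ((rho x)\<^sup>2 * (U x)\<^sup>2)" for x k
    using wt_pos(2)[of x] by (cases "x \<in> ball 0 1"; simp add: U_outside g_outside)+
  then show "0 \<le> energy" "0 \<le> moment" by (simp_all add: energy_def moment_def)
qed

text \<open>Both \<open>wt\<close> and \<open>theta\<close> are at least 1. Besides the sign of
  \<open>heis\<close>, this shows that \<open>heis = 0\<close> forces \<open>U\<close> to vanish
  almost everywhere, which settles the degenerate case.\<close>

lemma heis_ge: "(LBINT x. (U x)\<^sup>2) \<le> heis"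
  unfolding heis_def
proof (rule integral_mono[OF int_U2 int_theta])
  fix x :: 'a
  show "(U x)\<^sup>2 \<le> wt (norm x) ^ DIM('a) * (theta x * (U x)\<^sup>2)"
  proof (cases "x \<in> ball 0 1")
    case True
    have "1 * 1 \<le> wt (norm x) ^ DIM('a) * theta x"
      using wt_pos(1)[OF True] theta_bounds(1)[OF True] by (intro mult_mono one_le_power) auto
    then show ?thesis using mult_right_mono[of 1 "wt (norm x) ^ DIM('a) * theta x" "(U x)\<^sup>2"] by (simp add: mult.assoc)
  qed (simp add: U_outside)
qed

text \<open>The scale \<open>l\<^sup>2 = sqrt (moment / energy)\<close> turns the shifted energy into twice the deficit.\<close>
lemma deficit_bound:
  "\<exists>c l. 0 < l \<and> (LBINT x. indicator (ball 0 1) x * (U x - c * gauss l x)\<^sup>2)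
    \<le> (2 * real DIM('a) * 4 ^ DIM('a) * exp (9 * real DIM('a) / 8) + 1) * (2 * sqrt energy * sqrt moment - heis)"
proof (cases "0 < energy \<and> 0 < moment")
  case True
  define K where "K = 2 * real DIM('a) * 4 ^ DIM('a) * exp (9 * real DIM('a) / 8) + 1"
  have K: "0 \<le> K" by (simp add: K_def)
  define l where "l = sqrt (sqrt moment / sqrt energy)"
  have l: "0 < l" using True by (simp add: l_def)
  have l2: "l\<^sup>2 = sqrt moment / sqrt energy" using True by (simp add: l_def)
  obtain c where c: "(LBINT x. indicator (ball 0 1) x * (U x - c * gauss l x)\<^sup>2) \<le> K * (l\<^sup>2 * lenergy l)"
    using gaussian_distance[OF l] by (auto simp: K_def)
  have "l\<^sup>2 * lenergy l \<le> l\<^sup>2 * (energy + moment / l ^ 4 - heis / l\<^sup>2)"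
    by (intro mult_left_mono lenergy_le(2)[OF l]) simp
  also have "\<dots> = l\<^sup>2 * energy + moment / l\<^sup>2 - heis"
  proof -
    have "l ^ 4 = l\<^sup>2 * l\<^sup>2" by (simp add: power2_eq_square power4_eq_xxxx)
    then show ?thesis using l by (simp add: field_simps)
  qed
  also have "l\<^sup>2 * energy = sqrt energy * sqrt moment"
  proof -
    have cancel: "a / b * (b * b) = b * a" if "b \<noteq> 0" for a b :: real using that by simp
    have "sqrt moment / sqrt energy * (sqrt energy * sqrt energy) = sqrt energy * sqrt moment"
      by (rule cancel) (use True in simp)
    moreover have "sqrt energy * sqrt energy = energy" using True by simp
    ultimately show ?thesis by (simp only: l2)
  qed
  also have "moment / l\<^sup>2 = sqrt energy * sqrt moment"
  proof -
    have cancel: "(a * a) / (a / b) = b * a" if "a \<noteq> 0" for a b :: real using that by simp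
    have "(sqrt moment * sqrt moment) / (sqrt moment / sqrt energy) = sqrt energy * sqrt moment"
      by (rule cancel) (use True in simp)
    moreover have "sqrt moment * sqrt moment = moment" using True by simp
    ultimately show ?thesis by (simp only: l2)
  qed
  finally have "l\<^sup>2 * lenergy l \<le> 2 * sqrt energy * sqrt moment - heis" by simp
  then have "K * (l\<^sup>2 * lenergy l) \<le> K * (2 * sqrt energy * sqrt moment - heis)" using K by (rule mult_left_mono)
  with c show ?thesis using l unfolding K_def by (blast intro: order_trans)
next
  case False
  \<comment> \<open>If energy or moment vanishes there is no optimal scale. Instead, nonnegativity
    of the shifted energy for every l forces \<open>heis = 0\<close>, and c = 0 then gives distance
    0.\<close>
  have zero: "0 \<le> energy + moment / l ^ 4 - heis / l\<^sup>2" if "0 < l" for l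
    using lenergy_le(2)[OF that] by (rule order_trans[rotated]) (simp add: lenergy_def)
  have U0: "0 \<le> (LBINT x. (U x)\<^sup>2)" by simp
  have h0: "0 \<le> heis" using heis_ge U0 by linarith
  have "heis = 0"
  proof (rule ccontr)
    assume "heis \<noteq> 0"
    with h0 have h: "0 < heis" by simp
    show False
    proof (cases "energy = 0")
      case True
      \<comment> \<open>With zero energy, \<open>l\<^sup>2 = t\<close> gives
        \<open>heis * t \<le> moment\<close>, although \<open>heis * t\<close> is
        \<open>moment + heis\<close> for this choice.\<close>
      define t where "t = moment / heis + 1"
      have t: "0 < t" using energy_nonneg h by (simp add: t_def add_nonneg_pos)
      have "sqrt t ^ 4 = t * t" using power_mult[of "sqrt t" 2 2] t by (simp add: power2_eq_square)
      then have "0 \<le> moment / (t * t) - heis / t"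
        using zero[of "sqrt t"] t True by simp
      then have "heis * t \<le> moment" using t by (simp add: field_simps)
      moreover have "heis * t = moment + heis" using h by (simp add: t_def distrib_left)
      ultimately show False using h by linarith
    next
      case False
      with \<open>\<not> (0 < energy \<and> 0 < moment)\<close> energy_nonneg have M: "moment = 0" "0 < energy" by auto
      \<comment> \<open>With zero moment the shifted energy at \<open>l\<^sup>2 = t\<close> is
        energy - 2 energy < 0.\<close>
      define t where "t = heis / (2 * energy)"
      have t: "0 < t" using h M by (simp add: t_def)
      have "0 \<le> energy - heis / t" using zero[of "sqrt t"] t M by simp
      then show False using h M by (simp add: t_def)
    qed
  qed
  moreover from this have "(LBINT x. (U x)\<^sup>2) = 0" using heis_ge U0 by linarith
  moreover have "(LBINT x. indicator (ball 0 1) x * (U x - 0 * gauss 1 x)\<^sup>2) = (LBINT x. (U x)\<^sup>2)"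
    using U_outside by (intro Bochner_Integration.integral_cong) (auto simp: indicator_def)
  moreover have "energy = 0 \<or> moment = 0" using False energy_nonneg by auto
  ultimately show ?thesis by (intro exI[of _ 0] exI[of _ 1]) auto
qed

end

section \<open>Transfer to hyperbolic space\<close>

lemma cosh_borel [measurable]: "(cosh :: real \<Rightarrow> real) \<in> borel_measurable borel"
  and sinh_borel [measurable]: "(sinh :: real \<Rightarrow> real) \<in> borel_measurable borel"
  and tanh_borel [measurable]: "(tanh :: real \<Rightarrow> real) \<in> borel_measurable borel"
  unfolding tanh_def[abs_def] by (intro borel_measurable_divide borel_measurable_continuous_onI continuous_intros)+

lemma measurable_hvol: "borel_measurable (hvol :: 'a::euclidean_space measure) = borel_measurable (lebesgue_on (ball 0 1))"
  unfolding hvol_def by (intro measurable_cong_sets) auto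

lemma borel_measurable_lebesgue_onI:
  "f \<in> borel_measurable borel \<Longrightarrow> f \<in> borel_measurable (lebesgue_on S)"
  by (intro measurable_restrict_space1) (auto intro: measurable_completion)

text \<open>\<open>hvol\<close> is a density over Lebesgue measure on the ball, whereas the analysis
  runs over \<open>lborel\<close>. The Borel function F, tied to f only almost everywhere, absorbs
  density and indicator.\<close>

lemma hvol_integral:
  fixes f F :: "'a::euclidean_space \<Rightarrow> real"
  assumes f: "f \<in> borel_measurable (lebesgue_on (ball 0 1))" and F: "F \<in> borel_measurable borel"
    and eq: "AE x in lborel. F x = indicator (ball 0 1) x * (wt (norm x) ^ DIM('a) * f x)"
  shows "integrable hvol f \<longleftrightarrow> integrable lborel F" "(\<integral>x. f x \<partial>hvol) = (LBINT x. F x)"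
proof -
  let ?B = "ball (0::'a) 1"
  define w where "w = (\<lambda>x::'a. (2 / (1 - (norm x)\<^sup>2)) ^ DIM('a))"
  have hv: "hvol = density (lebesgue_on ?B) (\<lambda>x. ennreal (w x))" by (simp add: hvol_def w_def)
  have wb: "w \<in> borel_measurable borel" unfolding w_def by measurable
  then have wm: "w \<in> borel_measurable (lebesgue_on ?B)" by (rule borel_measurable_lebesgue_onI)
  have w0: "AE x in lebesgue_on ?B. 0 \<le> w x"
  proof (rule AE_I2)
    fix x assume "x \<in> space (lebesgue_on ?B)"
    then have "norm x < 1" by (simp add: space_restrict_space)
    then show "0 \<le> w x" using one_minus_square_pos[of "norm x"] by (simp add: w_def)
  qed
  have B: "?B \<inter> space lebesgue \<in> sets lebesgue" by simp
  have "AE x in lborel. indicator ?B x *\<^sub>R (w x *\<^sub>R f x) = F x"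
    using eq by eventually_elim (simp add: w_def wt_def)
  then have eq': "AE x in lebesgue. indicator ?B x *\<^sub>R (w x *\<^sub>R f x) = F x"
    by (simp only: AE_completion_iff)
  have m1: "(\<lambda>x. indicator ?B x *\<^sub>R (w x *\<^sub>R f x)) \<in> borel_measurable lebesgue"
    using borel_measurable_scaleR[OF wm f] unfolding borel_measurable_restrict_space_iff[OF B] .
  have m2: "F \<in> borel_measurable lebesgue" using F by (auto intro: measurable_completion)
  have "integrable hvol f \<longleftrightarrow> integrable lebesgue (\<lambda>x. indicator ?B x *\<^sub>R (w x *\<^sub>R f x))"
    unfolding hv integrable_density[OF f wm w0] integrable_restrict_space[OF B] ..
  also have "\<dots> \<longleftrightarrow> integrable lebesgue F" by (rule integrable_cong_AE[OF m1 m2 eq'])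
  also have "\<dots> \<longleftrightarrow> integrable lborel F" using F by (intro integrable_completion) simp
  finally show "integrable hvol f \<longleftrightarrow> integrable lborel F" .
  have "(\<integral>x. f x \<partial>hvol) = (\<integral>x. indicator ?B x *\<^sub>R (w x *\<^sub>R f x) \<partial>lebesgue)"
    unfolding hv integral_density[OF f wm w0] integral_restrict_space[OF B] ..
  also have "\<dots> = (\<integral>x. F x \<partial>lebesgue)" by (rule integral_cong_AE[OF m1 m2 eq'])
  also have "\<dots> = (LBINT x. F x)" using F by (intro integral_completion) simp
  finally show "(\<integral>x. f x \<partial>hvol) = (LBINT x. F x)" .
qed

text \<open>Lebesgue measurable functions agree almost everywhere with Borel ones; multiplying by
  the indicator makes the vanishing outside the ball hold at every point, as the locale
  demands.\<close>

lemma borel_version: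
  fixes f :: "'a::euclidean_space \<Rightarrow> real"
  assumes "f \<in> borel_measurable (lebesgue_on (ball 0 1))"
  shows "\<exists>F\<in>borel_measurable borel. (\<forall>x. x \<notin> ball 0 1 \<longrightarrow> F x = 0) \<and>
    (AE x in lborel. F x = indicator (ball 0 1) x * f x)"
proof -
  let ?B = "ball (0::'a) 1"
  have B: "?B \<inter> space lebesgue \<in> sets lebesgue" by simp
  have [measurable]: "?B \<in> sets borel" by simp
  have "(\<lambda>x. indicator ?B x *\<^sub>R f x) \<in> borel_measurable lebesgue"
    using assms unfolding borel_measurable_restrict_space_iff[OF B] .
  from completion_ex_borel_measurable_real[OF this] obtain F where
    F [measurable]: "F \<in> borel_measurable borel" and eq: "AE x in lborel. indicator ?B x *\<^sub>R f x = F x" by auto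
  show ?thesis
  proof (intro bexI[of _ "\<lambda>x. indicator ?B x * F x"] conjI)
    show "(\<lambda>x. indicator ?B x * F x) \<in> borel_measurable borel" by measurable
    show "AE x in lborel. indicator ?B x * F x = indicator ?B x * f x"
      using eq by eventually_elim (auto simp: indicator_def split: if_splits)
  qed auto
qed

text \<open>The definition of a weak gradient offers integrability on compact subsets. Closed balls
  exhaust the open ball, and at each point the truncations are eventually constant.\<close>

lemma weak_gradient_measurable:
  fixes g :: "'a::euclidean_space \<Rightarrow> 'a"
  assumes "has_weak_gradient u g"
  shows "(\<lambda>x. g x \<bullet> b) \<in> borel_measurable (lebesgue_on (ball 0 1))"
proof -
  let ?B = "ball (0::'a) 1"
  have B: "?B \<inter> space lebesgue \<in> sets lebesgue" by simp
  define s where "s = (\<lambda>n. 1 - 1 / real (n + 2))"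
  have s: "s n < 1" for n by (auto simp: s_def field_simps)
  have s_lim: "s \<longlonglongrightarrow> 1"
  proof -
    have "(\<lambda>n. 1 - 1 / real (n + 2)) \<longlonglongrightarrow> 1 - 0"
      by (intro tendsto_diff tendsto_const LIMSEQ_ignore_initial_segment[OF lim_1_over_n, of 2])
    then show ?thesis by (simp add: s_def)
  qed
  have "(\<lambda>x. indicator ?B x *\<^sub>R g x) \<in> borel_measurable lebesgue"
  proof (rule borel_measurable_LIMSEQ_metric)
    fix n
    have "compact (cball (0::'a) (s n))" "cball (0::'a) (s n) \<subseteq> ?B" using s[of n] by auto
    then have "g absolutely_integrable_on cball 0 (s n)"
      using assms unfolding has_weak_gradient_def by blast
    then show "(\<lambda>x. indicator (cball 0 (s n)) x *\<^sub>R g x) \<in> borel_measurable lebesgue"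
      unfolding set_integrable_def by (rule borel_measurable_integrable)
  next
    fix x :: 'a
    show "(\<lambda>n. indicator (cball 0 (s n)) x *\<^sub>R g x) \<longlonglongrightarrow> indicator ?B x *\<^sub>R g x"
    proof (rule tendsto_eventually, cases "norm x < 1")
      case True
      from order_tendstoD(1)[OF s_lim True]
      show "\<forall>\<^sub>F n in sequentially. indicator (cball 0 (s n)) x *\<^sub>R g x = indicator ?B x *\<^sub>R g x"
        by eventually_elim (use True in simp)
    next
      case False
      then have "\<not> norm x \<le> s n" for n using s[of n] by linarith
      then show "\<forall>\<^sub>F n in sequentially. indicator (cball 0 (s n)) x *\<^sub>R g x = indicator ?B x *\<^sub>R g x"
        using False by simp
    qed
  qed
  then have "g \<in> borel_measurable (lebesgue_on ?B)"
    unfolding borel_measurable_restrict_space_iff[OF B] .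
  then show ?thesis by (intro borel_measurable_inner) auto
qed

lemma integral_ball_lborel:
  fixes f F :: "'a::euclidean_space \<Rightarrow> real"
  assumes f: "f \<in> borel_measurable (lebesgue_on (ball 0 1))" and F: "F \<in> borel_measurable borel"
    and eq: "AE x in lborel. F x = indicator (ball 0 1) x * f x"
  shows "(\<integral>x. f x \<partial>lebesgue_on (ball 0 1)) = (LBINT x. F x)"
proof -
  let ?B = "ball (0::'a) 1"
  have B: "?B \<inter> space lebesgue \<in> sets lebesgue" by simp
  have m1: "(\<lambda>x. indicator ?B x *\<^sub>R f x) \<in> borel_measurable lebesgue"
    using f unfolding borel_measurable_restrict_space_iff[OF B] .
  have m2: "F \<in> borel_measurable lebesgue" using F by (auto intro: measurable_completion)
  have "AE x in lborel. indicator ?B x *\<^sub>R f x = F x" using eq by eventually_elim simp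
  then have eq': "AE x in lebesgue. indicator ?B x *\<^sub>R f x = F x" by (simp only: AE_completion_iff)
  have "(\<integral>x. f x \<partial>lebesgue_on ?B) = (\<integral>x. indicator ?B x *\<^sub>R f x \<partial>lebesgue)"
    by (rule integral_restrict_space[OF B])
  also have "\<dots> = (\<integral>x. F x \<partial>lebesgue)" by (rule integral_cong_AE[OF m1 m2 eq'])
  also have "\<dots> = (LBINT x. F x)" using F by (intro integral_completion) simp
  finally show ?thesis .
qed

text \<open>Borel representatives of u and of its gradient put the problem into the locale. In the
  constant, \<open>2 ^ N\<close> is the density of M dV, and \<open>2 * delta1 u\<close> is the
  locale's \<open>2 * sqrt energy * sqrt moment - heis\<close>. The sign of the Heisenberg term is
  recorded for the second deficit.\<close>

lemma hyperbolic_deficit_bound: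
  fixes u :: "'a::euclidean_space \<Rightarrow> real"
  assumes dim: "2 \<le> DIM('a)" and u: "u \<in> W12" and mom: "integrable hvol (\<lambda>x. (rho x)\<^sup>2 * \<bar>u x\<bar>\<^sup>2)"
  shows "0 \<le> heis_term u"
    and "\<exists>c l. 0 < l \<and> (\<integral>x. \<bar>u x - c * exp (- ((rho x)\<^sup>2 / (2 * l\<^sup>2)))\<bar>\<^sup>2 * (1 - (tanh (rho x / 2))\<^sup>2) ^ DIM('a) \<partial>hvol)
      \<le> 2 ^ DIM('a) * (2 * real DIM('a) * 4 ^ DIM('a) * exp (9 * real DIM('a) / 8) + 1) * (2 * delta1 u)"
proof -
  let ?B = "ball (0::'a) 1"
  have [measurable]: "?B \<in> sets borel" by simp
  define h where "h = weak_gradient u"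
  have um: "u \<in> borel_measurable (lebesgue_on ?B)" using u by (simp add: W12_def measurable_hvol)
  have "\<exists>g. has_weak_gradient u g" using u by (simp add: W12_def)
  then have wg: "has_weak_gradient u h" unfolding h_def weak_gradient_def by (rule someI_ex)
  have hm: "(\<lambda>x. h x \<bullet> b) \<in> borel_measurable (lebesgue_on ?B)" for b by (rule weak_gradient_measurable[OF wg])
  obtain U where U [measurable]: "U \<in> borel_measurable borel" and U0: "\<And>x. x \<notin> ?B \<Longrightarrow> U x = 0"
    and Uu: "AE x in lborel. U x = indicator ?B x * u x" using borel_version[OF um] unfolding Bex_def by (elim exE conjE) (rule that; (assumption | simp))
  \<comment> \<open>One Borel representative per direction, selected by choice, to be assembled over
    the basis into a vector field.\<close>
  define G where "G = (\<lambda>b. SOME F. F \<in> borel_measurable borel \<and> (\<forall>x. x \<notin> ?B \<longrightarrow> F x = 0)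
    \<and> (AE x in lborel. F x = indicator ?B x * (h x \<bullet> b)))"
  have G: "G b \<in> borel_measurable borel" "x \<notin> ?B \<Longrightarrow> G b x = 0"
    "AE x in lborel. G b x = indicator ?B x * (h x \<bullet> b)" for b x
  proof -
    have "G b \<in> borel_measurable borel \<and> (\<forall>x. x \<notin> ?B \<longrightarrow> G b x = 0)
      \<and> (AE x in lborel. G b x = indicator ?B x * (h x \<bullet> b))"
      unfolding G_def using borel_version[OF hm[of b]] unfolding Bex_def by (rule someI_ex)
    then show "G b \<in> borel_measurable borel" "x \<notin> ?B \<Longrightarrow> G b x = 0"
      "AE x in lborel. G b x = indicator ?B x * (h x \<bullet> b)" by blast+
  qed
  note [measurable] = G(1)
  define g where "g = (\<lambda>x. \<Sum>b\<in>Basis. G b x *\<^sub>R b)"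
  have g [measurable]: "g \<in> borel_measurable borel" unfolding g_def by measurable
  have gb: "g x \<bullet> b = G b x" if "b \<in> Basis" for x b
    using that by (simp add: g_def inner_sum_left_Basis)
  have g0: "g x = 0" if "x \<notin> ?B" for x using G(2)[OF that] by (simp add: g_def)
  have "AE x in lborel. \<forall>b\<in>Basis. G b x = indicator ?B x * (h x \<bullet> b)"
    using G(3) by (subst AE_ball_countable) (auto intro: countable_finite)
  then have gh: "AE x in lborel. g x = indicator ?B x *\<^sub>R h x"
    by eventually_elim (rule euclidean_eqI, simp add: gb)
  have wt_B: "0 < wt (norm x)" if "x \<in> ?B" for x :: 'a using wt_ge_2[of "norm x"] that by simp
  have U2: "integrable lborel (\<lambda>x. wt (norm x) ^ DIM('a) * (U x)\<^sup>2)"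
  proof -
    have "AE x in lborel. wt (norm x) ^ DIM('a) * (U x)\<^sup>2 = indicator ?B x * (wt (norm x) ^ DIM('a) * \<bar>u x\<bar>\<^sup>2)"
      using Uu by eventually_elim (auto simp: indicator_def)
    from hvol_integral(1)[OF _ _ this] um u show ?thesis by (simp add: W12_def)
  qed
  have mom': "integrable lborel (\<lambda>x. wt (norm x) ^ DIM('a) * ((rho x)\<^sup>2 * (U x)\<^sup>2))"
    "second_moment u = (LBINT x. wt (norm x) ^ DIM('a) * ((rho x)\<^sup>2 * (U x)\<^sup>2))"
  proof -
    have AE: "AE x in lborel. wt (norm x) ^ DIM('a) * ((rho x)\<^sup>2 * (U x)\<^sup>2) = indicator ?B x * (wt (norm x) ^ DIM('a) * ((rho x)\<^sup>2 * \<bar>u x\<bar>\<^sup>2))"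
      using Uu by eventually_elim (auto simp: indicator_def)
    have m: "(\<lambda>x. (rho x)\<^sup>2 * \<bar>u x\<bar>\<^sup>2) \<in> borel_measurable (lebesgue_on ?B)"
      using mom by (auto simp: measurable_hvol[symmetric])
    show "integrable lborel (\<lambda>x. wt (norm x) ^ DIM('a) * ((rho x)\<^sup>2 * (U x)\<^sup>2))"
      "second_moment u = (LBINT x. wt (norm x) ^ DIM('a) * ((rho x)\<^sup>2 * (U x)\<^sup>2))"
      using hvol_integral[OF m _ AE] mom unfolding second_moment_def by auto
  qed
  have en: "integrable lborel (\<lambda>x. wt (norm x) ^ (DIM('a) - 2) * (norm (g x))\<^sup>2)"
    "grad_energy u = (LBINT x. wt (norm x) ^ (DIM('a) - 2) * (norm (g x))\<^sup>2)"
  proof -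
    have AE: "AE x in lborel. wt (norm x) ^ (DIM('a) - 2) * (norm (g x))\<^sup>2
      = indicator ?B x * (wt (norm x) ^ DIM('a) * (riem_norm x (hyp_gradient u x))\<^sup>2)"
      using gh
    proof eventually_elim
      fix x :: 'a assume gx: "g x = indicator ?B x *\<^sub>R h x"
      show "wt (norm x) ^ (DIM('a) - 2) * (norm (g x))\<^sup>2
        = indicator ?B x * (wt (norm x) ^ DIM('a) * (riem_norm x (hyp_gradient u x))\<^sup>2)"
      proof (cases "x \<in> ?B")
        case True
        define w where "w = wt (norm x)"
        have w: "0 < w" "1 - (norm x)\<^sup>2 = 2 / w"
          using wt_B[OF True] by (auto simp: w_def wt_def)
        \<comment> \<open>The gradient carries two inverse powers of the conformal factor and the
          norm one power, so the square has \<open>wt\<close> to the power -2; with the volume this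
          leaves N - 2.\<close>
        have "riem_norm x (hyp_gradient u x) = w * ((1 / w)\<^sup>2 * norm (h x))"
          using w(1) by (simp add: riem_norm_def hyp_gradient_def w(2) h_def[symmetric])
        also have "\<dots> = norm (h x) / w" using w(1) by (simp add: power2_eq_square)
        finally have "(riem_norm x (hyp_gradient u x))\<^sup>2 = (norm (h x))\<^sup>2 / w\<^sup>2" by (simp add: power_divide)
        moreover have "w ^ DIM('a) = w ^ (DIM('a) - 2) * w\<^sup>2" by (simp only: power_add[symmetric] le_add_diff_inverse2[OF dim])
        ultimately show ?thesis using True gx w(1) by (simp add: w_def[symmetric])
      qed (simp add: gx)
    qed
    have i: "integrable hvol (\<lambda>x. (riem_norm x (hyp_gradient u x))\<^sup>2)" using u by (simp add: W12_def)
    then have m: "(\<lambda>x. (riem_norm x (hyp_gradient u x))\<^sup>2) \<in> borel_measurable (lebesgue_on ?B)"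
      by (auto simp: measurable_hvol[symmetric])
    show "integrable lborel (\<lambda>x. wt (norm x) ^ (DIM('a) - 2) * (norm (g x))\<^sup>2)"
      "grad_energy u = (LBINT x. wt (norm x) ^ (DIM('a) - 2) * (norm (g x))\<^sup>2)"
      using hvol_integral[OF m _ AE] i unfolding grad_energy_def by auto
  qed
  have W: "W1 U g"
  proof (rule weak_gradient_W1)
    show "integrable lborel (\<lambda>x. (U x)\<^sup>2)"
      by (rule integrable_of_weighted[OF U2]) (auto simp: U0)
    show "integrable lborel (\<lambda>x. (g x \<bullet> b)\<^sup>2)" if b: "b \<in> Basis" for b
    proof (rule integrable_of_weighted[OF en(1)])
      show "\<bar>(g x \<bullet> b)\<^sup>2\<bar> \<le> (norm (g x))\<^sup>2" for x
        using power_mono[OF Basis_le_norm[OF b, of "g x"], of 2] by simp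
    qed (auto simp: g0)
    fix \<phi> :: "'a \<Rightarrow> real" and b :: 'a assume \<phi>: "\<phi> \<in> test_functions" and b: "b \<in> Basis"
    have "Ck 0 \<phi>" "Ck (Suc 0) \<phi>" using \<phi> unfolding test_functions_def by blast+
    then have c: "continuous_on UNIV \<phi>" "continuous_on UNIV (\<lambda>x. frechet_derivative \<phi> (at x) b)" by auto
    then have [measurable]: "\<phi> \<in> borel_measurable borel" "(\<lambda>x. frechet_derivative \<phi> (at x) b) \<in> borel_measurable borel"
      by (auto intro: borel_measurable_continuous_onI)
    have "(LBINT x. U x * frechet_derivative \<phi> (at x) b) = (\<integral>x. u x * frechet_derivative \<phi> (at x) b \<partial>lebesgue_on ?B)"
    proof (rule integral_ball_lborel[symmetric])
      show "(\<lambda>x. u x * frechet_derivative \<phi> (at x) b) \<in> borel_measurable (lebesgue_on ?B)"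
        by (intro borel_measurable_times um borel_measurable_lebesgue_onI) measurable
      show "AE x in lborel. U x * frechet_derivative \<phi> (at x) b = indicator ?B x * (u x * frechet_derivative \<phi> (at x) b)"
        using Uu by eventually_elim simp
    qed measurable
    also have "\<dots> = - (\<integral>x. (h x \<bullet> b) * \<phi> x \<partial>lebesgue_on ?B)"
      using wg \<phi> b unfolding has_weak_gradient_def by blast
    also have "(\<integral>x. (h x \<bullet> b) * \<phi> x \<partial>lebesgue_on ?B) = (LBINT x. (g x \<bullet> b) * \<phi> x)"
    proof (rule integral_ball_lborel)
      show "(\<lambda>x. (h x \<bullet> b) * \<phi> x) \<in> borel_measurable (lebesgue_on ?B)"
        by (intro borel_measurable_times hm borel_measurable_lebesgue_onI) measurable
      show "AE x in lborel. (g x \<bullet> b) * \<phi> x = indicator ?B x * ((h x \<bullet> b) * \<phi> x)"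
        using gh by eventually_elim simp
    qed measurable
    finally show "(LBINT x. U x * frechet_derivative \<phi> (at x) b) = - (LBINT x. (g x \<bullet> b) * \<phi> x)" .
  qed (use U0 g0 in \<open>auto\<close>)
  interpret finite_energy U g
    by unfold_locales (fact dim U U0 g0 W U2 mom'(1) en(1) g)+
  have heis: "heis_term u = heis"
    unfolding heis_term_def heis_def
  proof (rule hvol_integral(2))
    show "(\<lambda>x. (real DIM('a) + (real DIM('a) - 1) * ((rho x * cosh (rho x) - sinh (rho x)) / sinh (rho x))) * \<bar>u x\<bar>\<^sup>2)
      \<in> borel_measurable (lebesgue_on ?B)"
      by (intro borel_measurable_times borel_measurable_power borel_measurable_abs um borel_measurable_lebesgue_onI) measurable
    show "AE x in lborel. wt (norm x) ^ DIM('a) * (theta x * (U x)\<^sup>2)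
      = indicator ?B x * (wt (norm x) ^ DIM('a) * ((real DIM('a) + (real DIM('a) - 1) * ((rho x * cosh (rho x) - sinh (rho x)) / sinh (rho x))) * \<bar>u x\<bar>\<^sup>2))"
      using Uu AE_lborel_singleton[of "0::'a"]
    proof eventually_elim
      fix x :: 'a assume Ux: "U x = indicator ?B x * u x" and x: "x \<noteq> 0"
      show "wt (norm x) ^ DIM('a) * (theta x * (U x)\<^sup>2)
        = indicator ?B x * (wt (norm x) ^ DIM('a) * ((real DIM('a) + (real DIM('a) - 1) * ((rho x * cosh (rho x) - sinh (rho x)) / sinh (rho x))) * \<bar>u x\<bar>\<^sup>2))"
      proof (cases "x \<in> ?B")
        case True
        have "real DIM('a) + (real DIM('a) - 1) * ((rho x * cosh (rho x) - sinh (rho x)) / sinh (rho x)) = theta x"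
          unfolding rho_rad theta_def by (rule hyperbolic_weight) (use x True in auto)
        moreover have "U x = u x" using Ux True by simp
        ultimately show ?thesis using True by (simp only: power2_abs) simp
      qed (use Ux in simp)
    qed
  qed measurable
  have energy: "grad_energy u = energy" and moment: "second_moment u = moment"
    using en mom' by (simp_all add: energy_def moment_def)
  show "0 \<le> heis_term u"
    unfolding heis by (rule order_trans[OF _ heis_ge]) simp
  obtain c l where cl: "0 < l" "(LBINT x. indicator ?B x * (U x - c * gauss l x)\<^sup>2)
    \<le> (2 * real DIM('a) * 4 ^ DIM('a) * exp (9 * real DIM('a) / 8) + 1) * (2 * sqrt energy * sqrt moment - heis)"
    using deficit_bound by blast
  have "(\<integral>x. \<bar>u x - c * exp (- ((rho x)\<^sup>2 / (2 * l\<^sup>2)))\<bar>\<^sup>2 * (1 - (tanh (rho x / 2))\<^sup>2) ^ DIM('a) \<partial>hvol)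
    = (LBINT x. 2 ^ DIM('a) * (indicator ?B x * (U x - c * gauss l x)\<^sup>2))"
  proof (rule hvol_integral(2))
    show "(\<lambda>x. \<bar>u x - c * exp (- ((rho x)\<^sup>2 / (2 * l\<^sup>2)))\<bar>\<^sup>2 * (1 - (tanh (rho x / 2))\<^sup>2) ^ DIM('a)) \<in> borel_measurable (lebesgue_on ?B)"
      by (intro borel_measurable_times borel_measurable_power borel_measurable_abs borel_measurable_diff um borel_measurable_lebesgue_onI) measurable
    show "AE x in lborel. 2 ^ DIM('a) * (indicator ?B x * (U x - c * gauss l x)\<^sup>2)
      = indicator ?B x * (wt (norm x) ^ DIM('a) * (\<bar>u x - c * exp (- ((rho x)\<^sup>2 / (2 * l\<^sup>2)))\<bar>\<^sup>2 * (1 - (tanh (rho x / 2))\<^sup>2) ^ DIM('a)))"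
      using Uu
    proof eventually_elim
      fix x :: 'a assume Ux: "U x = indicator ?B x * u x"
      show "2 ^ DIM('a) * (indicator ?B x * (U x - c * gauss l x)\<^sup>2)
        = indicator ?B x * (wt (norm x) ^ DIM('a) * (\<bar>u x - c * exp (- ((rho x)\<^sup>2 / (2 * l\<^sup>2)))\<bar>\<^sup>2 * (1 - (tanh (rho x / 2))\<^sup>2) ^ DIM('a)))"
      proof (cases "x \<in> ?B")
        case True
        have th: "tanh (rho x / 2) = norm x" unfolding rho_rad by (rule tanh_half_rad) (use True in auto)
        have cancel: "a / d * d = a" if "d \<noteq> 0" for a d :: real using that by simp
        have "wt (norm x) * (1 - (norm x)\<^sup>2) = 2"
          unfolding wt_def by (rule cancel) (use True one_minus_square_pos[of "norm x"] in auto)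
        then have "wt (norm x) ^ DIM('a) * (1 - (norm x)\<^sup>2) ^ DIM('a) = 2 ^ DIM('a)"
          by (simp only: power_mult_distrib[symmetric])
        then have "2 ^ DIM('a) * (indicator ?B x * (U x - c * gauss l x)\<^sup>2)
          = wt (norm x) ^ DIM('a) * (1 - (norm x)\<^sup>2) ^ DIM('a) * (u x - c * gauss l x)\<^sup>2"
          using True Ux by simp
        then show ?thesis using True by (simp add: th gauss_def)
      qed simp
    qed
  qed measurable
  also have "\<dots> = 2 ^ DIM('a) * (LBINT x. indicator ?B x * (U x - c * gauss l x)\<^sup>2)" by simp
  also have "\<dots> \<le> 2 ^ DIM('a) * ((2 * real DIM('a) * 4 ^ DIM('a) * exp (9 * real DIM('a) / 8) + 1) * (2 * sqrt energy * sqrt moment - heis))"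
    by (intro mult_left_mono cl) simp
  also have "2 * sqrt energy * sqrt moment - heis = 2 * delta1 u"
    by (simp add: delta1_def energy moment heis)
  finally show "\<exists>c l. 0 < l \<and> (\<integral>x. \<bar>u x - c * exp (- ((rho x)\<^sup>2 / (2 * l\<^sup>2)))\<bar>\<^sup>2 * (1 - (tanh (rho x / 2))\<^sup>2) ^ DIM('a) \<partial>hvol)
      \<le> 2 ^ DIM('a) * (2 * real DIM('a) * 4 ^ DIM('a) * exp (9 * real DIM('a) / 8) + 1) * (2 * delta1 u)"
    using cl(1) unfolding mult.assoc by blast
qed

theorem theorem1p7:
  assumes "DIM('a::euclidean_space) \<ge> 2"
  shows "\<exists>K>0. \<forall>u :: 'a \<Rightarrow> real.
    u \<in> W12 \<and> integrable hvol (\<lambda>x. (rho x)\<^sup>2 * \<bar>u x\<bar>\<^sup>2) \<longrightarrow>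
      delta1 u \<ge> K * (INF (c, l) \<in> UNIV \<times> {0<..}.
        \<integral>x. \<bar>u x - c * exp (- ((rho x)\<^sup>2 / (2 * l\<^sup>2)))\<bar>\<^sup>2 *
            (1 - (tanh (rho x / 2))\<^sup>2) ^ DIM('a) \<partial>hvol) \<and>
      K * (INF (c, l) \<in> UNIV \<times> {0<..}.
        \<integral>x. \<bar>u x - c * exp (- ((rho x)\<^sup>2 / (2 * l\<^sup>2)))\<bar>\<^sup>2 *
            (1 - (tanh (rho x / 2))\<^sup>2) ^ DIM('a) \<partial>hvol)
      \<ge> K * (INF (c, l) \<in> UNIV \<times> {0<..}.
        (L2norm tanh_weight (\<lambda>x. u x - c * exp (- ((rho x)\<^sup>2 / (2 * l\<^sup>2)))))\<^sup>2) \<and>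
      K * (INF (c, l) \<in> UNIV \<times> {0<..}.
        (L2norm tanh_weight (\<lambda>x. u x - c * exp (- ((rho x)\<^sup>2 / (2 * l\<^sup>2)))))\<^sup>2)
      \<ge> K * (dist1 u Gaussians tanh_weight)\<^sup>2 \<and>
      delta2 u \<ge> K * heis_term u * (dist1 u Gaussians tanh_weight)\<^sup>2
                 + K\<^sup>2 * (dist1 u Gaussians tanh_weight) ^ 4"
proof -
  \<comment> \<open>The trailing 2 accounts for \<open>2 * delta1 u\<close> in the bound; only the
    dimension enters.\<close>
  define C where "C = 2 ^ DIM('a) * (2 * real DIM('a) * 4 ^ DIM('a) * exp (9 * real DIM('a) / 8) + 1) * 2"
  have C: "0 < C" unfolding C_def by (intro mult_pos_pos add_nonneg_pos) auto
  show ?thesis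
  proof (intro exI[of _ "1 / C"] conjI[of "0 < 1 / C"] allI impI)
    show "0 < 1 / C" using C by simp
    fix u :: "'a \<Rightarrow> real"
    assume asm: "u \<in> W12 \<and> integrable hvol (\<lambda>x. (rho x)\<^sup>2 * \<bar>u x\<bar>\<^sup>2)"
    define S where "S c l = (\<integral>x. \<bar>u x - c * exp (- ((rho x)\<^sup>2 / (2 * l\<^sup>2)))\<bar>\<^sup>2 *
            (1 - (tanh (rho x / 2))\<^sup>2) ^ DIM('a) \<partial>hvol)" for c l
    define I where "I = (INF (c, l) \<in> UNIV \<times> {0<..}. S c l)"
    define d where "d = dist1 u Gaussians tanh_weight"
    have tanh: "0 \<le> 1 - (tanh t)\<^sup>2" for t :: real
      using tanh_real_bounds[of t] abs_square_le_1[of "tanh t"] by auto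
    have S0: "0 \<le> S c l" for c l
      unfolding S_def by (intro Bochner_Integration.integral_nonneg mult_nonneg_nonneg zero_le_power tanh) simp
    \<comment> \<open>The square undoes the root in \<open>L2norm\<close>, so the first two infima
      coincide and the middle inequality is an equality.\<close>
    have L2: "(L2norm tanh_weight (\<lambda>x. u x - c * exp (- ((rho x)\<^sup>2 / (2 * l\<^sup>2)))))\<^sup>2 = S c l" for c l
      unfolding L2norm_def tanh_weight_def S_def using S0[of c l, unfolded S_def] by (rule real_sqrt_pow2)
    have L2nn: "0 \<le> L2norm tanh_weight f" for f :: "'a \<Rightarrow> real"
      unfolding L2norm_def tanh_weight_def
      by (intro real_sqrt_ge_zero Bochner_Integration.integral_nonneg mult_nonneg_nonneg zero_le_power tanh) simp
    have bdd: "bdd_below ((\<lambda>(c, l). S c l) ` (UNIV \<times> {0<..}))"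
      using S0 by (intro bdd_belowI[of _ 0]) auto
    obtain c l where cl: "0 < l" "S c l \<le> C * delta1 u"
      using hyperbolic_deficit_bound(2)[OF assms conjunct1[OF asm] conjunct2[OF asm], folded S_def]
      unfolding C_def mult.assoc by blast
    have "I \<le> S c l" unfolding I_def using cl(1) by (intro cINF_lower2[OF bdd, of "(c, l)"]) auto
    with cl(2) have "I \<le> C * delta1 u" by linarith
    then have 1: "1 / C * I \<le> delta1 u" using C by (simp add: pos_divide_le_eq mult.commute)
    have "(\<lambda>x. 0 * exp (- 1 * (rho x)\<^sup>2)) \<in> (Gaussians :: ('a \<Rightarrow> real) set)"
      unfolding Gaussians_def by (intro CollectI exI[of _ 0] exI[of _ 1]) simp
    then have ne: "(Gaussians :: ('a \<Rightarrow> real) set) \<noteq> {}" by blast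
    have d0: "0 \<le> d" unfolding d_def dist1_def by (intro cINF_greatest ne L2nn)
    \<comment> \<open>Each pair (c, l) yields a member of the family with
      \<open>\<alpha> = 1 / (2 l\<^sup>2)\<close>, so d is below every norm entering
      \<open>I\<close>; nonnegativity of d permits squaring.\<close>
    have 2: "d\<^sup>2 \<le> I" unfolding I_def
    proof (rule cINF_greatest)
      fix y :: "real \<times> real" assume "y \<in> UNIV \<times> {0<..}"
      then obtain c l where y: "y = (c, l)" "0 < l" by auto
      have "(\<lambda>x. c * exp (- (1 / (2 * l\<^sup>2)) * (rho x)\<^sup>2)) \<in> (Gaussians :: ('a \<Rightarrow> real) set)"
        unfolding Gaussians_def using y(2) by (intro CollectI exI[of _ c] exI[of _ "1 / (2 * l\<^sup>2)"]) simp
      moreover have "bdd_below ((\<lambda>f. L2norm tanh_weight (\<lambda>x. u x - f x)) ` Gaussians)"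
        using L2nn by (intro bdd_belowI[of _ 0]) auto
      ultimately have "d \<le> L2norm tanh_weight (\<lambda>x. u x - c * exp (- (1 / (2 * l\<^sup>2)) * (rho x)\<^sup>2))"
        unfolding d_def dist1_def by (intro cINF_lower)
      then have "d \<le> L2norm tanh_weight (\<lambda>x. u x - c * exp (- ((rho x)\<^sup>2 / (2 * l\<^sup>2))))" by simp
      then have "d\<^sup>2 \<le> (L2norm tanh_weight (\<lambda>x. u x - c * exp (- ((rho x)\<^sup>2 / (2 * l\<^sup>2)))))\<^sup>2"
        using d0 by (rule power_mono)
      then show "d\<^sup>2 \<le> (case y of (c, l) \<Rightarrow> S c l)" by (simp add: L2 y)
    qed auto
    have 4: "1 / C * d\<^sup>2 \<le> 1 / C * I" using 2 C by (intro mult_left_mono) auto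
    then have dK: "1 / C * d\<^sup>2 \<le> delta1 u" using 1 by (rule order_trans)
    have H: "0 \<le> heis_term u" using hyperbolic_deficit_bound(1)[of u] assms asm by simp
    have "0 \<le> grad_energy u" "0 \<le> second_moment u" by (simp_all add: grad_energy_def second_moment_def)
    then have "delta2 u = delta1 u * (delta1 u + heis_term u)"
      by (simp add: delta1_def delta2_def algebra_simps power2_eq_square)
    \<comment> \<open>The map s \<mapsto> s (s + H) is increasing for s \<ge> 0 because H \<ge> 0;
      it is applied to \<open>1 / C * d\<^sup>2 \<le> delta1 u\<close>.\<close>
    moreover have "1 / C * d\<^sup>2 * (1 / C * d\<^sup>2 + heis_term u) \<le> delta1 u * (delta1 u + heis_term u)"
      using dK C H order_trans[OF _ dK] by (intro mult_mono add_right_mono) auto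
    moreover have "1 / C * heis_term u * d\<^sup>2 + (1 / C)\<^sup>2 * d ^ 4 = 1 / C * d\<^sup>2 * (1 / C * d\<^sup>2 + heis_term u)"
      by (simp add: power4_eq_xxxx power2_eq_square algebra_simps)
    ultimately have 3: "1 / C * heis_term u * d\<^sup>2 + (1 / C)\<^sup>2 * d ^ 4 \<le> delta2 u" by simp
    show "delta1 u \<ge> 1 / C * (INF (c, l) \<in> UNIV \<times> {0<..}.
        \<integral>x. \<bar>u x - c * exp (- ((rho x)\<^sup>2 / (2 * l\<^sup>2)))\<bar>\<^sup>2 *
            (1 - (tanh (rho x / 2))\<^sup>2) ^ DIM('a) \<partial>hvol) \<and>
      1 / C * (INF (c, l) \<in> UNIV \<times> {0<..}.
        \<integral>x. \<bar>u x - c * exp (- ((rho x)\<^sup>2 / (2 * l\<^sup>2)))\<bar>\<^sup>2 *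
            (1 - (tanh (rho x / 2))\<^sup>2) ^ DIM('a) \<partial>hvol)
      \<ge> 1 / C * (INF (c, l) \<in> UNIV \<times> {0<..}.
        (L2norm tanh_weight (\<lambda>x. u x - c * exp (- ((rho x)\<^sup>2 / (2 * l\<^sup>2)))))\<^sup>2) \<and>
      1 / C * (INF (c, l) \<in> UNIV \<times> {0<..}.
        (L2norm tanh_weight (\<lambda>x. u x - c * exp (- ((rho x)\<^sup>2 / (2 * l\<^sup>2)))))\<^sup>2)
      \<ge> 1 / C * (dist1 u Gaussians tanh_weight)\<^sup>2 \<and>
      delta2 u \<ge> 1 / C * heis_term u * (dist1 u Gaussians tanh_weight)\<^sup>2
                 + (1 / C)\<^sup>2 * (dist1 u Gaussians tanh_weight) ^ 4"
      unfolding L2 S_def[symmetric] I_def[symmetric] d_def[symmetric]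
      using 1 3 4 by blast
  qed
qed

end
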